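(* Let $\theta$ be an irrational number, let $\gamma\in C(\mathbb{T})$ be a non-negative function, let $Y=\{z\in\mathbb{T}:\gamma(z)=0\}$, and let $\phi:\mathbb{T}\to\mathbb{T}$ be the rotation $\phi(z)=e^{2\pi i\theta}z$. Let $A_{\theta,\gamma}$ be the generalized universal irrational rotation $C^*$-algebra. Then the following are equivalent: (1) $A_{\theta,\gamma}$ is simple; (2) $A_{\theta,\gamma}$ has a unique tracial state; (3) $\phi^n(Y)\cap Y=\emptyset$ for all integers $n\neq 0$; (4) for each $\xi\in\mathbb{T}$, the set $Orb(\xi)\cap Y$ contains at most one point, where $Orb(\xi)=\{\phi^n(\xi):n\in\mathbb{Z}\}$.
   Context: $\mathbb{T}$ is the unit circle. For an irrational number $\theta$ and a non-negative function $\gamma\in C(\mathbb{T})$, $A_{\theta,\gamma}=C^*(x,w)$ is the universal unital $C^*$-algebra generated by elements $x,w$ subject to the relations $w^*w=ww^*=1$, $x^*x=\gamma(w)$, $xx^*=\gamma(e^{-2\pi i\theta}w)$, $xw=e^{-2\pi i\theta}wx$ (functions of the unitary $w$ are taken by continuous functional calculus). Universality means that whenever $x',w'$ in some $C^*$-algebra satisfy the same relations, there is a $*$-homomorphism of $A_{\theta,\gamma}$ onto $C^*(x',w')$ with $x\mapsto x'$, $w\mapsto w'$. *)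

theory Defs
  imports
    "HOL-Analysis.Analysis"
    "HOL-Algebra.Module"
    "HOL-Algebra.Ideal"
    "HOL-Algebra.Subrings"
begin

section \<open>Unital C*-algebras with an explicit carrier\<close>

text \<open>
  The algebras below are records extending the rings and modules of HOL-Algebra, so that ideals, subrings
  and ring homomorphisms (all of them unital there) are those of the library.  An explicit carrier
  is needed because the universal property at the end quantifies over C*-algebras.
\<close>

record 'a cstar = "(complex, 'a) module" +
  star :: "'a \<Rightarrow> 'a"
  nrm :: "'a \<Rightarrow> real"

definition complex_field :: "complex ring" where
  "complex_field = \<lparr>carrier = UNIV, mult = (*), one = 1, zero = 0, add = (+)\<rparr>"

text \<open>The value off the carrier only serves to meet the unrelativised axioms of
  \<^locale>\<open>Metric_space\<close>.\<close>

definition cstar_dist :: "('a, 'm) cstar_scheme \<Rightarrow> 'a \<Rightarrow> 'a \<Rightarrow> real" where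
  "cstar_dist A a b =
     (if a \<in> carrier A \<and> b \<in> carrier A then nrm A (a \<ominus>\<^bsub>A\<^esub> b) else 0)"

text \<open>The zero algebra is not excluded.\<close>

locale unital_cstar_algebra = module complex_field A + ring A
    for A :: "('a, 'm) cstar_scheme" (structure) +
  assumes smult_mult_left:
      "\<lbrakk>a \<in> carrier A; b \<in> carrier A\<rbrakk> \<Longrightarrow> (c \<odot> a) \<otimes> b = c \<odot> (a \<otimes> b)"
    and smult_mult_right:
      "\<lbrakk>a \<in> carrier A; b \<in> carrier A\<rbrakk> \<Longrightarrow> a \<otimes> (c \<odot> b) = c \<odot> (a \<otimes> b)"
    and star_closed: "a \<in> carrier A \<Longrightarrow> star A a \<in> carrier A"
    and star_star: "a \<in> carrier A \<Longrightarrow> star A (star A a) = a"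
    and star_add:
      "\<lbrakk>a \<in> carrier A; b \<in> carrier A\<rbrakk> \<Longrightarrow> star A (a \<oplus> b) = star A a \<oplus> star A b"
    and star_smult: "a \<in> carrier A \<Longrightarrow> star A (c \<odot> a) = cnj c \<odot> star A a"
    and star_mult:
      "\<lbrakk>a \<in> carrier A; b \<in> carrier A\<rbrakk> \<Longrightarrow> star A (a \<otimes> b) = star A b \<otimes> star A a"
    and nrm_nonneg: "a \<in> carrier A \<Longrightarrow> 0 \<le> nrm A a"
    and nrm_eq_zero: "a \<in> carrier A \<Longrightarrow> nrm A a = 0 \<longleftrightarrow> a = \<zero>"
    and nrm_triangle:
      "\<lbrakk>a \<in> carrier A; b \<in> carrier A\<rbrakk> \<Longrightarrow> nrm A (a \<oplus> b) \<le> nrm A a + nrm A b"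
    and nrm_smult: "a \<in> carrier A \<Longrightarrow> nrm A (c \<odot> a) = cmod c * nrm A a"
    and nrm_mult:
      "\<lbrakk>a \<in> carrier A; b \<in> carrier A\<rbrakk> \<Longrightarrow> nrm A (a \<otimes> b) \<le> nrm A a * nrm A b"
    and cstar_identity: "a \<in> carrier A \<Longrightarrow> nrm A (star A a \<otimes> a) = (nrm A a)\<^sup>2"
    and complete: "Metric_space.mcomplete (carrier A) (cstar_dist A)"

definition norm_closed :: "('a, 'm) cstar_scheme \<Rightarrow> 'a set \<Rightarrow> bool" where
  "norm_closed A S \<longleftrightarrow> closedin (Metric_space.mtopology (carrier A) (cstar_dist A)) S"

definition cstar_subalgebra :: "'a set \<Rightarrow> ('a, 'm) cstar_scheme \<Rightarrow> bool" where
  "cstar_subalgebra D A \<longleftrightarrow>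
     subring D A \<and> norm_closed A D \<and>
     (\<forall>c. \<forall>a\<in>D. c \<odot>\<^bsub>A\<^esub> a \<in> D) \<and> (\<forall>a\<in>D. star A a \<in> D)"

definition cstar_generated :: "('a, 'm) cstar_scheme \<Rightarrow> 'a set \<Rightarrow> 'a set" where
  "cstar_generated A S = \<Inter>{D. cstar_subalgebra D A \<and> S \<subseteq> D}"

definition star_hom :: "('a, 'm) cstar_scheme \<Rightarrow> ('b, 'n) cstar_scheme \<Rightarrow> ('a \<Rightarrow> 'b) \<Rightarrow> bool" where
  "star_hom A B h \<longleftrightarrow>
     h \<in> ring_hom A B \<and>
     (\<forall>c. \<forall>a\<in>carrier A. h (c \<odot>\<^bsub>A\<^esub> a) = c \<odot>\<^bsub>B\<^esub> h a) \<and>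
     (\<forall>a\<in>carrier A. h (star A a) = star B (h a))"

definition simple_cstar :: "('a, 'm) cstar_scheme \<Rightarrow> bool" where
  "simple_cstar A \<longleftrightarrow>
     carrier A \<noteq> {\<zero>\<^bsub>A\<^esub>} \<and>
     (\<forall>I. ideal I A \<and> norm_closed A I \<longrightarrow> I = {\<zero>\<^bsub>A\<^esub>} \<or> I = carrier A)"

definition tracial_state :: "('a, 'm) cstar_scheme \<Rightarrow> ('a \<Rightarrow> complex) \<Rightarrow> bool" where
  "tracial_state A \<tau> \<longleftrightarrow>
     (\<forall>a\<in>carrier A. \<forall>b\<in>carrier A. \<tau> (a \<oplus>\<^bsub>A\<^esub> b) = \<tau> a + \<tau> b) \<and>
     (\<forall>c. \<forall>a\<in>carrier A. \<tau> (c \<odot>\<^bsub>A\<^esub> a) = c * \<tau> a) \<and>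
     (\<forall>a\<in>carrier A. \<tau> (star A a \<otimes>\<^bsub>A\<^esub> a) \<in> \<real>\<^sub>\<ge>\<^sub>0) \<and>
     \<tau> \<one>\<^bsub>A\<^esub> = 1 \<and>
     (\<forall>a\<in>carrier A. \<forall>b\<in>carrier A. \<tau> (a \<otimes>\<^bsub>A\<^esub> b) = \<tau> (b \<otimes>\<^bsub>A\<^esub> a))"

text \<open>Functionals are identified when they agree on the carrier.\<close>

definition unique_tracial_state :: "('a, 'm) cstar_scheme \<Rightarrow> bool" where
  "unique_tracial_state A \<longleftrightarrow>
     (\<exists>\<tau>. tracial_state A \<tau>) \<and>
     (\<forall>\<tau> \<tau>'. tracial_state A \<tau> \<and> tracial_state A \<tau>' \<longrightarrow> (\<forall>a\<in>carrier A. \<tau> a = \<tau>' a))"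

section \<open>Continuous functional calculus\<close>

definition spectrum :: "('a, 'm) cstar_scheme \<Rightarrow> 'a \<Rightarrow> complex set" where
  "spectrum A a = {l. l \<odot>\<^bsub>A\<^esub> \<one>\<^bsub>A\<^esub> \<ominus>\<^bsub>A\<^esub> a \<notin> Units A}"

text \<open>The C*-algebra $C(K)$.  The inserted 0 does not change the supremum norm unless $K$ is empty.\<close>

definition continuous_functions :: "complex set \<Rightarrow> (complex \<Rightarrow> complex) cstar" where
  "continuous_functions K =
     \<lparr>carrier = {f \<in> extensional K. continuous_on K f},
      mult = (\<lambda>f g. \<lambda>z\<in>K. f z * g z),
      one = (\<lambda>z\<in>K. 1),
      zero = (\<lambda>z\<in>K. 0),
      add = (\<lambda>f g. \<lambda>z\<in>K. f z + g z),
      smult = (\<lambda>c f. \<lambda>z\<in>K. c * f z),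
      star = (\<lambda>f. \<lambda>z\<in>K. cnj (f z)),
      nrm = (\<lambda>f. Sup (insert 0 ((\<lambda>z. cmod (f z)) ` K)))\<rparr>"

text \<open>
  \<open>continuous_calculus A u f a\<close> says that \<open>a = f(u)\<close>, where \<open>u\<close> is normal and \<open>f\<close> is continuous on
  the spectrum of \<open>u\<close>: \<open>a\<close> is the image of \<open>f\<close> under the unital *-homomorphism from the continuous
  functions on the spectrum to \<open>A\<close> that maps the identity function to \<open>u\<close>.  This homomorphism exists
  and is unique, so that \<open>a\<close> is determined by \<open>u\<close> and \<open>f\<close>.
\<close>

definition continuous_calculus ::
    "('a, 'm) cstar_scheme \<Rightarrow> 'a \<Rightarrow> (complex \<Rightarrow> complex) \<Rightarrow> 'a \<Rightarrow> bool" where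
  "continuous_calculus A u f a \<longleftrightarrow>
     (\<exists>\<Phi>. star_hom (continuous_functions (spectrum A u)) A \<Phi> \<and>
          \<Phi> (\<lambda>z\<in>spectrum A u. z) = u \<and>
          a = \<Phi> (restrict f (spectrum A u)))"

section \<open>The generalized universal irrational rotation algebra\<close>

abbreviation unit_circle :: "complex set" where
  "unit_circle \<equiv> sphere 0 1"

definition rotation_relations ::
    "real \<Rightarrow> (complex \<Rightarrow> real) \<Rightarrow> ('a, 'm) cstar_scheme \<Rightarrow> 'a \<Rightarrow> 'a \<Rightarrow> bool" where
  "rotation_relations \<theta> \<gamma> A x w \<longleftrightarrow>
     x \<in> carrier A \<and> w \<in> carrier A \<and>
     star A w \<otimes>\<^bsub>A\<^esub> w = \<one>\<^bsub>A\<^esub> \<and>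
     w \<otimes>\<^bsub>A\<^esub> star A w = \<one>\<^bsub>A\<^esub> \<and>
     continuous_calculus A w (\<lambda>z. complex_of_real (\<gamma> z)) (star A x \<otimes>\<^bsub>A\<^esub> x) \<and>
     continuous_calculus A (exp (- 2 * pi * \<i> * \<theta>) \<odot>\<^bsub>A\<^esub> w) (\<lambda>z. complex_of_real (\<gamma> z))
       (x \<otimes>\<^bsub>A\<^esub> star A x) \<and>
     x \<otimes>\<^bsub>A\<^esub> w = exp (- 2 * pi * \<i> * \<theta>) \<odot>\<^bsub>A\<^esub> (w \<otimes>\<^bsub>A\<^esub> x)"

text \<open>
  \<open>A\<close> is generated by \<open>x\<close> and \<open>w\<close>, which satisfy the relations and are universal for them.  HOL does
  not allow quantification over types, so the algebras \<open>B\<close> have their carriers in the fixed type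
  \<^typ>\<open>nat \<Rightarrow> real\<close>.  This is no restriction: the C*-algebra generated by two elements is
  separable, and every separable metric space with dense sequence \<open>d\<close> embeds in this type by
  \<open>a \<mapsto> (\<lambda>n. dist a (d n))\<close>, so that every C*-algebra generated by two elements has an isomorphic
  copy there.
\<close>

definition universal_rotation_algebra ::
    "real \<Rightarrow> (complex \<Rightarrow> real) \<Rightarrow> ('a, 'm) cstar_scheme \<Rightarrow> 'a \<Rightarrow> 'a \<Rightarrow> bool" where
  "universal_rotation_algebra \<theta> \<gamma> A x w \<longleftrightarrow>
     unital_cstar_algebra A \<and>
     rotation_relations \<theta> \<gamma> A x w \<and>
     cstar_generated A {x, w} = carrier A \<and>
     (\<forall>(B :: (nat \<Rightarrow> real) cstar) x' w'.
        unital_cstar_algebra B \<and> rotation_relations \<theta> \<gamma> B x' w' \<longrightarrow>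
        (\<exists>h. star_hom A B h \<and> h x = x' \<and> h w = w' \<and>
             h ` carrier A = cstar_generated B {x', w'}))"

section \<open>The rotation\<close>

definition rotation :: "real \<Rightarrow> complex \<Rightarrow> complex" where
  "rotation \<theta> z = exp (2 * pi * \<i> * \<theta>) * z"

text \<open>Integer iterates of a bijection.\<close>

definition int_iterate :: "('a \<Rightarrow> 'a) \<Rightarrow> int \<Rightarrow> 'a \<Rightarrow> 'a" where
  "int_iterate f n = (if 0 \<le> n then f ^^ nat n else inv_into UNIV f ^^ nat (- n))"

definition rotation_orbit :: "real \<Rightarrow> complex \<Rightarrow> complex set" where
  "rotation_orbit \<theta> \<xi> = range (\<lambda>n. int_iterate (rotation \<theta>) n \<xi>)"

definition zero_set :: "(complex \<Rightarrow> real) \<Rightarrow> complex set" where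
  "zero_set \<gamma> = {z \<in> unit_circle. \<gamma> z = 0}"

end

theory Submission
  imports Defs
begin

text \<open>
  For each \<open>\<xi>\<close> on the circle there is a representation of the algebra on \<open>\<ell>\<^sup>2(\<int>)\<close> in which
  \<open>w\<close> is the diagonal operator with entries \<open>\<mu>\<^sup>k \<xi>\<close>, where \<open>\<mu> = exp (2 \<pi> \<i> \<theta>)\<close>, and \<open>x\<close> is the
  shift with weights \<open>sqrt (\<gamma> (\<mu>\<^sup>k \<xi>))\<close>; bounded operators are matrices, so they fit into
  \<^typ>\<open>nat \<Rightarrow> real\<close>.  Conjugation by powers of \<open>w\<close> multiplies the component of degree \<open>n\<close> by \<open>\<mu>\<^sup>n\<^sup>k\<close>,
  so averaging over \<open>k\<close> yields an expectation onto \<open>C*(w) = C(\<T>)\<close>, and the Fejer means show that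
  these representations are jointly faithful on the base vector.  Hence every nonzero closed ideal
  meets \<open>C(\<T>)\<close>.  The closed set where this intersection vanishes is invariant under the
  rotation, in both directions, as long as no zero of \<open>\<gamma>\<close> is met; if each orbit contains at most
  one zero then this set contains a dense half-orbit unless it is empty.

  A tracial state is determined by its restriction to \<open>C(\<T>)\<close>, which is rotation invariant away from
  the zeros.  If each orbit contains at most one zero then the zeros carry no mass, so the restriction
  is Haar measure.  Conversely, two zeros on one orbit cut a finite-dimensional block out of an orbit
  representation.  The normalised trace of the block is a second tracial state, and it is not
  faithful, whereas the null space of a tracial state is a closed ideal.
\<close>

section \<open>Irrational rotations of the circle\<close>

text \<open>The universal property maps only into algebras with carrier in
  \<open>nat \<Rightarrow> real\<close>, whereas the type of \<open>A\<close> is arbitrary. The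
  gauge automorphisms, which multiply x by a phase and fix w, are therefore not at hand as
  homomorphisms of \<open>A\<close> into itself. Conjugations by powers of w stand in for them:
  their phases are powers of \<mu>, which are dense in the circle because \<theta> is irrational, so
  means over these powers replace integrals over the gauge group. The norm of \<open>A\<close> is
  likewise not computed. It is estimated from below by vector states of the orbit representations,
  and from above by the C*-identity together with the contractivity of the functional calculus on
  the part of degree 0. The relations give rotation invariance only up to the factor \<gamma>:
  compressing a function f by x yields f one step ahead multiplied by \<gamma>, and the trace
  property says something only about multiples of \<gamma>. The real work therefore takes place near
  the zeros of \<gamma>.\<close>

lemma average_power_tendsto_0:
  fixes \<nu> :: complex
  assumes "cmod \<nu> = 1" "\<nu> \<noteq> 1"
  shows "(\<lambda>M. (\<Sum>k<M. \<nu> ^ k) / of_nat M) \<longlonglongrightarrow> 0"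
proof (rule tendsto_norm_zero_cancel, rule tendsto_sandwich)
  let ?C = "2 / cmod (\<nu> - 1)"
  show "\<forall>\<^sub>F M in sequentially. 0 \<le> cmod ((\<Sum>k<M. \<nu> ^ k) / of_nat M)"
    by simp
  show "\<forall>\<^sub>F M in sequentially. cmod ((\<Sum>k<M. \<nu> ^ k) / of_nat M) \<le> ?C / real M"
  proof (intro always_eventually allI)
    fix M
    have "(\<Sum>k<M. \<nu> ^ k) = (\<nu> ^ M - 1) / (\<nu> - 1)"
      using assms(2) by (simp add: geometric_sum)
    moreover have "cmod (\<nu> ^ M - 1) \<le> 2"
      using norm_triangle_ineq4[of "\<nu> ^ M" 1] assms(1) by (simp add: norm_power)
    ultimately have "cmod (\<Sum>k<M. \<nu> ^ k) \<le> ?C"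
      by (simp add: norm_divide divide_right_mono)
    then show "cmod ((\<Sum>k<M. \<nu> ^ k) / of_nat M) \<le> ?C / real M"
      by (simp add: norm_divide divide_right_mono del: divide_divide_eq_left)
  qed
  show "(\<lambda>M. ?C / real M) \<longlonglongrightarrow> 0"
    by (rule lim_const_over_n)
qed simp

lemma average_one_tendsto_1: "(\<lambda>M. (\<Sum>k<M. 1) / of_nat M :: complex) \<longlonglongrightarrow> 1"
\<comment> \<open>At \<open>M = 0\<close> the quotient is 0 by convention, so equality with 1 holds
  only eventually.\<close>
proof (rule Lim_transform_eventually[OF tendsto_const])
  show "\<forall>\<^sub>F M in sequentially. 1 = (\<Sum>k<M. 1) / (of_nat M :: complex)"
    using eventually_gt_at_top[of 0] by eventually_elim simp
qed

section \<open>Laurent polynomials are dense in C(T)\<close>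

inductive laurent :: "(complex \<Rightarrow> complex) \<Rightarrow> bool" where
  monom: "laurent (\<lambda>z. c * z powi k)"
| add: "laurent f \<Longrightarrow> laurent g \<Longrightarrow> laurent (\<lambda>z. f z + g z)"

text \<open>Agreement is required only on the circle because the identities in use fail elsewhere:
  exponents need not add at 0, and the inverse of z is its conjugate only for modulus 1.\<close>

definition circle_laurent :: "(complex \<Rightarrow> complex) \<Rightarrow> bool" where
  "circle_laurent f \<longleftrightarrow> (\<exists>g. laurent g \<and> (\<forall>z\<in>unit_circle. f z = g z))"

lemma circle_laurent_add:
  "circle_laurent f \<Longrightarrow> circle_laurent g \<Longrightarrow> circle_laurent (\<lambda>z. f z + g z)"
  unfolding circle_laurent_def by (metis laurent.add)

lemma circle_laurent_monom: "circle_laurent (\<lambda>z. c * z powi k)"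
  unfolding circle_laurent_def using laurent.monom by blast

lemma circle_laurent_monom_mult:
  assumes "laurent g" shows "circle_laurent (\<lambda>z. (c * z powi k) * g z)"
  using assms
proof induction
  case (monom d l)
  have "\<forall>z\<in>unit_circle. (c * z powi k) * (d * z powi l) = (c * d) * z powi (k + l)"
    by (metis (no_types, lifting) mult.assoc mult.left_commute power_int_add norm_zero mem_sphere_0 zero_neq_one)
  then show ?case unfolding circle_laurent_def using laurent.monom by blast
next
  case (add f g)
  then show ?case
    using circle_laurent_add[OF add.IH] by (simp add: distrib_left)
qed

lemma circle_laurent_mult:
  assumes "circle_laurent f" "circle_laurent g" shows "circle_laurent (\<lambda>z. f z * g z)"
proof -
  obtain f' g' where f': "laurent f'" "\<forall>z\<in>unit_circle. f z = f' z"
    and g': "laurent g'" "\<forall>z\<in>unit_circle. g z = g' z"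
    using assms unfolding circle_laurent_def by blast
  from f'(1) have "circle_laurent (\<lambda>z. f' z * g' z)"
  proof induction
    case (monom c k)
    then show ?case by (rule circle_laurent_monom_mult[OF g'(1)])
  next
    case (add f g)
    then show ?case using circle_laurent_add[OF add.IH] by (simp add: distrib_right)
  qed
  then show ?thesis unfolding circle_laurent_def using f'(2) g'(2) by simp
qed

text \<open>Real polynomial functions are built from linear functionals, and these are Laurent
  polynomials of degree one on the circle. The factor \<open>c\<close> lets a real and an imaginary
  part be combined with the coefficients 1 and \<open>\<i>\<close>.\<close>

lemma circle_laurent_real_polynomial:
  assumes "real_polynomial_function p"
  shows "circle_laurent (\<lambda>z. c * complex_of_real (p z))"
proof -
  have "circle_laurent (\<lambda>z. complex_of_real (p z))"
    using assms
  proof induction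
    case (linear f)
    \<comment> \<open>Substitute \<open>(z + inverse z) / 2\<close> for \<open>Re z\<close> and
      \<open>(z - inverse z) / (2 * \<i>)\<close> for \<open>Im z\<close> in
      \<open>f z = Re z * f 1 + Im z * f \<i>\<close>.\<close>
    have "complex_of_real (f z) = (f 1 / 2 - \<i> * f \<i> / 2) * z powi 1 + (f 1 / 2 + \<i> * f \<i> / 2) * z powi (-1)"
      if "z \<in> unit_circle" for z
    proof -
      interpret bounded_linear f by fact
      have "inverse z = cnj z"
        using that by (simp add: inverse_complex_def complex_eq_iff cmod_power2[symmetric])
      have "z = Re z *\<^sub>R 1 + Im z *\<^sub>R \<i>"
        by (simp add: complex_eq_iff)
      then have "f z = Re z * f 1 + Im z * f \<i>"
        by (metis add scaleR real_scaleR_def)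
      then show ?thesis
        by (simp add: \<open>inverse z = cnj z\<close> power_int_minus complex_eq_iff algebra_simps)
    qed
    then show ?case
      unfolding circle_laurent_def
      using laurent.add[OF laurent.monom[of "f 1 / 2 - \<i> * f \<i> / 2" 1] laurent.monom[of "f 1 / 2 + \<i> * f \<i> / 2" "-1"]]
      by blast
  next
    case (const c)
    then show ?case using circle_laurent_monom[of "of_real c" 0] by simp
  next
    case (add f g)
    then show ?case using circle_laurent_add[OF add.IH] by simp
  next
    case (mult f g)
    then show ?case using circle_laurent_mult[OF mult.IH] by simp
  qed
  from circle_laurent_mult[OF circle_laurent_monom[of c 0] this] show ?thesis by simp
qed

lemma laurent_dense:
  fixes f :: "complex \<Rightarrow> complex"
  assumes "continuous_on unit_circle f" "0 < e"
  obtains g where "laurent g" "\<And>z. z \<in> unit_circle \<Longrightarrow> cmod (f z - g z) < e"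
proof -
  have "0 < e / 2" using assms(2) by simp
  obtain p where p: "real_polynomial_function p" "\<And>z. z \<in> unit_circle \<Longrightarrow> \<bar>Re (f z) - p z\<bar> < e / 2"
    using Stone_Weierstrass_real_polynomial_function[OF _ _ \<open>0 < e / 2\<close>, of unit_circle "\<lambda>z. Re (f z)"] assms
    by (auto intro!: continuous_on_Re)
  obtain q where q: "real_polynomial_function q" "\<And>z. z \<in> unit_circle \<Longrightarrow> \<bar>Im (f z) - q z\<bar> < e / 2"
    using Stone_Weierstrass_real_polynomial_function[OF _ _ \<open>0 < e / 2\<close>, of unit_circle "\<lambda>z. Im (f z)"] assms
    by (auto intro!: continuous_on_Im)
  have "circle_laurent (\<lambda>z. 1 * complex_of_real (p z) + \<i> * complex_of_real (q z))"
    by (intro circle_laurent_add circle_laurent_real_polynomial p q)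
  then obtain g where g: "laurent g"
    "\<forall>z\<in>unit_circle. 1 * complex_of_real (p z) + \<i> * complex_of_real (q z) = g z"
    unfolding circle_laurent_def by blast
  show thesis
  proof (rule that[OF g(1)])
    fix z :: complex assume z: "z \<in> unit_circle"
    have "f z - g z = Complex (Re (f z) - p z) (Im (f z) - q z)"
      using g(2)[rule_format, OF z, symmetric] by (simp add: complex_eq_iff)
    then have "cmod (f z - g z) \<le> \<bar>Re (f z) - p z\<bar> + \<bar>Im (f z) - q z\<bar>"
      using cmod_le[of "f z - g z"] by simp
    with p(2)[OF z] q(2)[OF z] show "cmod (f z - g z) < e" by simp
  qed
qed

lemma laurent_continuous: "laurent g \<Longrightarrow> continuous_on unit_circle g"
  by (induction rule: laurent.induct) (auto intro!: continuous_intros)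

section \<open>Dense half-orbits and averages of characters\<close>

locale irrational_rotation =
  fixes \<theta> :: real and \<mu> :: complex
  assumes irrational: "\<theta> \<notin> \<rat>"
  defines "\<mu> \<equiv> cis (2 * pi * \<theta>)"
begin

lemma norm_mu [simp]: "cmod \<mu> = 1" and mu_nonzero [simp]: "\<mu> \<noteq> 0"
  by (simp_all add: \<mu>_def)

lemma mu_circle [simp]: "cmod (\<mu> powi k) = 1"
  by (simp add: norm_power_int)

lemma mu_powi: "\<mu> powi k = cis (2 * pi * (of_int k * \<theta>))"
  by (simp add: \<mu>_def cis_power_int algebra_simps)

lemma mu_powi_eq_1_iff: "\<mu> powi k = 1 \<longleftrightarrow> k = 0"
proof
  assume "\<mu> powi k = 1"
  then have "cos (2 * pi * (of_int k * \<theta>)) = 1"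
    by (metis mu_powi cis.sel(1) one_complex.sel(1))
  then obtain n :: int where "2 * pi * (of_int k * \<theta>) = of_int n * 2 * pi"
    unfolding cos_one_2pi_int by blast
  then have n: "of_int k * \<theta> = of_int n" by simp
  show "k = 0"
  proof (rule ccontr)
    assume "k \<noteq> 0"
    then have "\<theta> = of_int n / of_int k" using n by (simp add: field_simps)
    then show False using irrational by (metis Rats_divide Rats_of_int)
  qed
qed simp

text \<open>Kronecker's theorem on fractional parts, carried to the circle by continuity of
  \<open>cis\<close>. The exponents are natural numbers: in the simplicity argument a zero of
  \<gamma> may block one direction, so each half-orbit alone has to be dense.\<close>

lemma forward_orbit_dense:
  assumes "cmod \<xi> = 1" "cmod z = 1" "0 < e"
  obtains k :: nat where "cmod (\<mu> ^ k * \<xi> - z) < e"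
proof -
  define t where "t = Arg2pi (z / \<xi>)"
  have t: "0 \<le> t" "t < 2 * pi" "z / \<xi> = cis t"
    using Arg2pi[of "z / \<xi>"] assms
    by (auto simp: t_def norm_divide cis_conv_exp mult.commute is_Arg_def)
  have "isCont cis t"
    using continuous_on_cis[OF continuous_on_id, of UNIV] by (simp add: continuous_on_eq_continuous_at)
  then obtain d where d: "0 < d" "\<And>s. dist s t < d \<Longrightarrow> dist (cis s) (cis t) < e"
    unfolding continuous_at_eps_delta using assms(3) by blast
  obtain k :: nat where k: "\<bar>frac (real k * \<theta>) - t / (2 * pi)\<bar> < d / (2 * pi)"
    using Kronecker_approx_1_explicit[OF irrational, of "t / (2 * pi)" "d / (2 * pi)"] t d(1)
    by (auto simp: field_simps)
  have "2 * pi * frac (real k * \<theta>) - t = 2 * pi * (frac (real k * \<theta>) - t / (2 * pi))"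
    by (simp add: right_diff_distrib)
  then have "dist (2 * pi * frac (real k * \<theta>)) t = 2 * pi * \<bar>frac (real k * \<theta>) - t / (2 * pi)\<bar>"
    by (simp only: dist_real_def abs_mult) simp
  also have "\<dots> < d"
    using k by (simp add: field_simps)
  finally have "dist (2 * pi * frac (real k * \<theta>)) t < d" .
  then have "dist (cis (2 * pi * frac (real k * \<theta>))) (cis t) < e" by (rule d(2))
  \<comment> \<open>The integer part of \<open>real k * \<theta>\<close> contributes only full
    turns.\<close>
  moreover have "cis (2 * pi * frac (real k * \<theta>)) = \<mu> ^ k"
  proof -
    have "cis (2 * pi * frac (real k * \<theta>)) = cis (2 * pi * (real k * \<theta>)) / cis (2 * pi * of_int \<lfloor>real k * \<theta>\<rfloor>)"
      by (simp only: frac_def cis_divide right_diff_distrib)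
    also have "cis (2 * pi * of_int \<lfloor>real k * \<theta>\<rfloor>) = 1"
      by (rule cis_multiple_2pi) auto
    also have "cis (2 * pi * (real k * \<theta>)) = \<mu> ^ k"
      using mu_powi[of "int k"] by (simp add: power_int_def)
    finally show ?thesis by simp
  qed
  moreover have "\<mu> ^ k * \<xi> - z = (\<mu> ^ k - cis t) * \<xi>"
    using t(3) assms(1) by (cases "\<xi> = 0") (auto simp: field_simps)
  ultimately have "cmod (\<mu> ^ k * \<xi> - z) < e"
    using assms(1) by (simp add: dist_norm norm_mult)
  then show thesis by (rule that)
qed

end

lemma irrational_rotation_minus:
  "irrational_rotation \<theta> \<Longrightarrow> irrational_rotation (- \<theta>)"
  by (metis irrational_rotation_def Rats_minus_iff)

context irrational_rotation
begin

text \<open>The rotation by \<open>- \<theta>\<close> is irrational as well, and its multiplier is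
  \<open>inverse \<mu>\<close>.\<close>

lemma backward_orbit_dense:
  assumes "cmod \<xi> = 1" "cmod z = 1" "0 < e"
  obtains k :: nat where "cmod (inverse \<mu> ^ k * \<xi> - z) < e"
proof -
  have "irrational_rotation (- \<theta>)"
    by (rule irrational_rotation_minus) unfold_locales
  from irrational_rotation.forward_orbit_dense[OF this assms] that show thesis
    by (metis \<mu>_def cis_inverse mult_minus_right)
qed

text \<open>Orthogonality of characters, with the integral over the circle replaced by means along
  the orbit of 1. The Fourier, Fejer and Haar averages below rest on it.\<close>

lemma average_mu_powi_tendsto:
  "(\<lambda>M. (\<Sum>k<M. \<mu> powi (n * int k)) / of_nat M) \<longlonglongrightarrow> (if n = 0 then 1 else 0)"
proof (cases "n = 0")
  case True
  then show ?thesis using average_one_tendsto_1 by simp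
next
  case False
  have "(\<mu> powi n) ^ k = \<mu> powi (n * int k)" for k
    by (simp add: power_int_mult)
  then show ?thesis
    using average_power_tendsto_0[of "\<mu> powi n"] False by (simp add: mu_powi_eq_1_iff)
qed

end

section \<open>The Hilbert space of square summable sequences\<close>

definition square_summable :: "(int \<Rightarrow> complex) \<Rightarrow> bool" where
  "square_summable u \<longleftrightarrow> (\<lambda>i. (cmod (u i))\<^sup>2) summable_on UNIV"

lemma square_summableI:
  assumes "\<And>F. finite F \<Longrightarrow> (\<Sum>i\<in>F. (cmod (u i))\<^sup>2) \<le> C"
  shows "square_summable u"
  unfolding square_summable_def
  by (rule nonneg_bdd_above_summable_on) (auto intro!: bdd_aboveI2 assms)

lemma square_summable_add:
  assumes "square_summable u" "square_summable v"
  shows "square_summable (\<lambda>i. u i + v i)"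
proof -
  have "(\<lambda>i. 2 * (cmod (u i))\<^sup>2 + 2 * (cmod (v i))\<^sup>2) summable_on UNIV"
    using assms unfolding square_summable_def
    by (intro summable_on_add summable_on_cmult_right)
  moreover have "(cmod (u i + v i))\<^sup>2 \<le> 2 * (cmod (u i))\<^sup>2 + 2 * (cmod (v i))\<^sup>2" for i
  proof -
    have "(cmod (u i + v i))\<^sup>2 \<le> (cmod (u i) + cmod (v i))\<^sup>2"
      by (intro power_mono norm_triangle_ineq) simp
    also have "\<dots> \<le> 2 * (cmod (u i))\<^sup>2 + 2 * (cmod (v i))\<^sup>2"
      using zero_le_power2[of "cmod (u i) - cmod (v i)"] unfolding power2_diff power2_sum
      by linarith
    finally show ?thesis .
  qed
  ultimately show ?thesis
    unfolding square_summable_def by (rule summable_on_comparison_test) auto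
qed

lemma square_summable_mult:
  assumes "square_summable u" "\<And>i. cmod (d i) \<le> C"
  shows "square_summable (\<lambda>i. d i * u i)"
proof -
  have "(\<lambda>i. C\<^sup>2 * (cmod (u i))\<^sup>2) summable_on UNIV"
    using assms(1) unfolding square_summable_def by (rule summable_on_cmult_right)
  then show ?thesis
    unfolding square_summable_def
    by (rule summable_on_comparison_test)
      (auto simp: norm_mult power_mult_distrib intro!: mult_right_mono power_mono assms)
qed

lemma square_summable_shift:
  assumes "square_summable u" shows "square_summable (\<lambda>i. u (i - s))"
proof -
  have "bij_betw (\<lambda>i::int. i - s) UNIV UNIV"
    by (rule bij_betwI[where g = "\<lambda>i. i + s"]) auto
  then show ?thesis
    using assms summable_on_reindex_bij_betw[of "\<lambda>i::int. i - s" UNIV UNIV "\<lambda>i. (cmod (u i))\<^sup>2"]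
    unfolding square_summable_def by simp
qed

lemma square_summable_finite_support:
  assumes "finite {i. u i \<noteq> 0}" shows "square_summable u"
proof (rule square_summableI)
  fix F :: "int set" assume "finite F"
  then have "(\<Sum>i\<in>F. (cmod (u i))\<^sup>2) = (\<Sum>i\<in>F \<inter> {i. u i \<noteq> 0}. (cmod (u i))\<^sup>2)"
    by (intro sum.mono_neutral_right) auto
  also have "\<dots> \<le> (\<Sum>i | u i \<noteq> 0. (cmod (u i))\<^sup>2)"
    by (intro sum_mono2 assms) auto
  finally show "(\<Sum>i\<in>F. (cmod (u i))\<^sup>2) \<le> (\<Sum>i | u i \<noteq> 0. (cmod (u i))\<^sup>2)" .
qed

typedef ell2 = "{u. square_summable u}" morphisms coord Abs_ell2
  by (rule exI[of _ "\<lambda>_. 0"]) (simp add: square_summable_finite_support)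

lemma square_summable_coord [simp]: "square_summable (coord u)"
  using coord by simp

lemma coord_Abs: "square_summable u \<Longrightarrow> coord (Abs_ell2 u) = u"
  by (simp add: Abs_ell2_inverse)

lemma ell2_eqI: "(\<And>i. coord u i = coord v i) \<Longrightarrow> u = v"
  by (metis coord_inject ext)

lemma inner_summable:
  assumes "square_summable u" "square_summable v"
  shows "(\<lambda>i. inner (u i) (v i)) summable_on UNIV"
proof -
  have "(\<lambda>i. (cmod (u i))\<^sup>2 + (cmod (v i))\<^sup>2) summable_on UNIV"
    using assms unfolding square_summable_def by (rule summable_on_add)
  moreover have "norm (inner (u i) (v i)) \<le> (cmod (u i))\<^sup>2 + (cmod (v i))\<^sup>2" for i
  proof -
    have "norm (inner (u i) (v i)) \<le> cmod (u i) * cmod (v i)"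
      by (simp add: Cauchy_Schwarz_ineq2)
    also have "\<dots> \<le> (cmod (u i))\<^sup>2 + (cmod (v i))\<^sup>2"
      using zero_le_power2[of "cmod (u i) - cmod (v i)"] zero_le_power2[of "cmod (u i)"]
        zero_le_power2[of "cmod (v i)"]
      unfolding power2_diff by linarith
    finally show ?thesis .
  qed
  ultimately have "(\<lambda>i. norm (inner (u i) (v i))) summable_on UNIV"
    by (rule summable_on_comparison_test) auto
  then show ?thesis by (rule abs_summable_summable)
qed

text \<open>The inner product is the real part of the Hermitian one. The complex structure returns
  as the family of operators \<open>scalar_op\<close>, by which complex linearity and imaginary
  parts are expressed.\<close>

instantiation ell2 :: real_inner
begin

definition "0 = Abs_ell2 (\<lambda>_. 0)"
definition "u + v = Abs_ell2 (\<lambda>i. coord u i + coord v i)"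
definition "- u = Abs_ell2 (\<lambda>i. - coord u i)"
definition "u - (v :: ell2) = u + - v"
definition "r *\<^sub>R u = Abs_ell2 (\<lambda>i. of_real r * coord u i)"
definition "inner u v = infsum (\<lambda>i. inner (coord u i) (coord v i)) UNIV"
definition "norm (u :: ell2) = sqrt (inner u u)"
definition "sgn (u :: ell2) = inverse (norm u) *\<^sub>R u"
definition "dist u (v :: ell2) = norm (u - v)"
definition "(uniformity :: (ell2 \<times> ell2) filter) = (INF e\<in>{0<..}. principal {(u, v). dist u v < e})"
definition "open (U :: ell2 set) \<longleftrightarrow> (\<forall>u\<in>U. eventually (\<lambda>(u', v). u' = u \<longrightarrow> v \<in> U) uniformity)"

lemma coord_zero [simp]: "coord 0 i = 0"
  by (simp add: zero_ell2_def coord_Abs square_summable_finite_support)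

lemma coord_add [simp]: "coord (u + v) i = coord u i + coord v i"
  by (simp add: plus_ell2_def coord_Abs square_summable_add)

lemma coord_uminus [simp]: "coord (- u) i = - coord u i"
  using square_summable_mult[of "coord u" "\<lambda>_. - 1" 1] by (simp add: uminus_ell2_def coord_Abs)

lemma coord_diff [simp]: "coord (u - v) i = coord u i - coord v i"
  by (simp add: minus_ell2_def)

lemma coord_scaleR [simp]: "coord (r *\<^sub>R u) i = of_real r * coord u i"
  using square_summable_mult[of "coord u" "\<lambda>_. of_real r" "\<bar>r\<bar>"]
  by (simp add: scaleR_ell2_def coord_Abs)

instance
proof
  fix u v w :: ell2 and r s :: real
  show "u + v + w = u + (v + w)" "u + v = v + u" "0 + u = u" "- u + u = 0" "u - v = u + - v"
    "r *\<^sub>R (u + v) = r *\<^sub>R u + r *\<^sub>R v" "(r + s) *\<^sub>R u = r *\<^sub>R u + s *\<^sub>R u"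
    "r *\<^sub>R s *\<^sub>R u = (r * s) *\<^sub>R u" "1 *\<^sub>R u = u"
    by (auto intro!: ell2_eqI simp: algebra_simps)
  show "sgn u = inverse (norm u) *\<^sub>R u" "dist u v = norm (u - v)" "norm u = sqrt (inner u u)"
    by (simp_all add: sgn_ell2_def dist_ell2_def norm_ell2_def)
  show "inner u v = inner v u"
    by (simp add: inner_ell2_def inner_commute)
  show "inner (u + v) w = inner u w + inner v w"
    by (simp add: inner_ell2_def inner_add_left infsum_add inner_summable)
  show "inner (r *\<^sub>R u) v = r * inner u v"
    by (simp add: inner_ell2_def flip: infsum_cmult_right' scaleR_conv_of_real)
  show "0 \<le> inner u u"
    unfolding inner_ell2_def by (rule infsum_nonneg) simp
  show "inner u u = 0 \<longleftrightarrow> u = 0"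
  proof
    assume "inner u u = 0"
    show "u = 0"
    proof (rule ell2_eqI)
      fix i
      have "inner (coord u i) (coord u i) = 0"
        by (rule nonneg_infsum_le_0D[where A = UNIV])
           (use \<open>inner u u = 0\<close> in \<open>auto simp: inner_ell2_def inner_summable\<close>)
      then show "coord u i = coord 0 i" by simp
    qed
  qed (simp add: inner_ell2_def)
qed (simp_all add: uniformity_ell2_def open_ell2_def)

end

lemma norm_ell2_power2: "(norm u)\<^sup>2 = infsum (\<lambda>i. (cmod (coord u i))\<^sup>2) UNIV"
  by (simp add: power2_norm_eq_inner inner_ell2_def)

lemma sum_coord_le:
  assumes "finite F" shows "(\<Sum>i\<in>F. (cmod (coord u i))\<^sup>2) \<le> (norm u)\<^sup>2"
  unfolding norm_ell2_power2
  by (rule finite_sum_le_infsum[OF _ assms])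
     (use square_summable_coord[of u] in \<open>auto simp: square_summable_def\<close>)

lemma norm_coord_le: "cmod (coord u i) \<le> norm u"
  by (rule power2_le_imp_le) (use sum_coord_le[of "{i}" u] in simp_all)

lemma norm_ell2_le:
  assumes "\<And>F. finite F \<Longrightarrow> (\<Sum>i\<in>F. (cmod (coord u i))\<^sup>2) \<le> C\<^sup>2" "0 \<le> C"
  shows "norm u \<le> C"
proof (rule power2_le_imp_le)
  show "(norm u)\<^sup>2 \<le> C\<^sup>2"
    unfolding norm_ell2_power2
    by (rule infsum_le_finite_sums)
       (use square_summable_coord[of u] assms in \<open>auto simp: square_summable_def\<close>)
qed fact

text \<open>The limit is taken coordinatewise. Estimates over finite index sets pass to it, and
  since they are uniform in the finite set they give both membership in the space and convergence in
  norm.\<close>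

instance ell2 :: complete_space
proof
  fix X :: "nat \<Rightarrow> ell2" assume X: "Cauchy X"
  define L where "L i = lim (\<lambda>n. coord (X n) i)" for i
  have "Cauchy (\<lambda>n. coord (X n) i)" for i
  proof (rule metric_CauchyI)
    fix e :: real assume "0 < e"
    then obtain N where "\<forall>m\<ge>N. \<forall>n\<ge>N. norm (X m - X n) < e"
      using X unfolding Cauchy_def dist_norm by blast
    moreover have "dist (coord (X m) i) (coord (X n) i) \<le> norm (X m - X n)" for m n
      using norm_coord_le[of "X m - X n" i] by (simp add: dist_norm)
    ultimately show "\<exists>N. \<forall>m\<ge>N. \<forall>n\<ge>N. dist (coord (X m) i) (coord (X n) i) < e"
      by (meson le_less_trans)
  qed
  then have L: "(\<lambda>n. coord (X n) i) \<longlonglongrightarrow> L i" for i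
    by (simp add: L_def Cauchy_convergent_iff convergent_LIMSEQ_iff)
  have tail: "\<exists>N. \<forall>n\<ge>N. \<forall>F. finite F \<longrightarrow> (\<Sum>i\<in>F. (cmod (coord (X n) i - L i))\<^sup>2) \<le> e\<^sup>2"
    if e: "0 < e" for e :: real
  proof -
    obtain N where "\<forall>m\<ge>N. \<forall>n\<ge>N. norm (X m - X n) < e"
      using X e unfolding Cauchy_def dist_norm by blast
    then have N: "\<And>m n. N \<le> m \<Longrightarrow> N \<le> n \<Longrightarrow> norm (X n - X m) < e" by blast
    have "(\<Sum>i\<in>F. (cmod (coord (X n) i - L i))\<^sup>2) \<le> e\<^sup>2" if "N \<le> n" "finite F" for n F
    proof (rule Lim_bounded)
      show "(\<lambda>m. \<Sum>i\<in>F. (cmod (coord (X n) i - coord (X m) i))\<^sup>2)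
          \<longlonglongrightarrow> (\<Sum>i\<in>F. (cmod (coord (X n) i - L i))\<^sup>2)"
        by (intro tendsto_intros L)
      show "\<forall>m\<ge>N. (\<Sum>i\<in>F. (cmod (coord (X n) i - coord (X m) i))\<^sup>2) \<le> e\<^sup>2"
      proof (intro allI impI)
        fix m assume "N \<le> m"
        have "(\<Sum>i\<in>F. (cmod (coord (X n) i - coord (X m) i))\<^sup>2) \<le> (norm (X n - X m))\<^sup>2"
          using sum_coord_le[OF that(2), of "X n - X m"] by simp
        also have "\<dots> \<le> e\<^sup>2"
          using N[OF \<open>N \<le> m\<close> that(1)] by (intro power_mono) auto
        finally show "(\<Sum>i\<in>F. (cmod (coord (X n) i - coord (X m) i))\<^sup>2) \<le> e\<^sup>2" .
      qed
    qed
    then show ?thesis by blast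
  qed
  \<comment> \<open>The limit \<open>L\<close> is \<open>X N\<close> minus the square summable
    sequence \<open>X N - L\<close>.\<close>
  obtain N where "\<forall>F. finite F \<longrightarrow> (\<Sum>i\<in>F. (cmod (coord (X N) i - L i))\<^sup>2) \<le> 1\<^sup>2"
    using tail[of 1] by auto
  then have "square_summable (\<lambda>i. coord (X N) i - L i)"
    by (intro square_summableI) auto
  from square_summable_add[OF square_summable_coord[of "X N"] square_summable_mult[OF this, of "\<lambda>_. - 1" 1]]
  have "square_summable L" by simp
  have "X \<longlonglongrightarrow> Abs_ell2 L"
  proof (rule metric_LIMSEQ_I)
    fix r :: real assume "0 < r"
    then obtain N where N: "\<And>n F. N \<le> n \<Longrightarrow> finite F \<Longrightarrow>
        (\<Sum>i\<in>F. (cmod (coord (X n) i - L i))\<^sup>2) \<le> (r / 2)\<^sup>2"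
      using tail[of "r / 2"] by auto
    have "dist (X n) (Abs_ell2 L) < r" if "N \<le> n" for n
    proof -
      have "norm (X n - Abs_ell2 L) \<le> r / 2"
        by (rule norm_ell2_le)
           (use N[OF that] \<open>0 < r\<close> \<open>square_summable L\<close> in \<open>auto simp: coord_Abs\<close>)
      then show ?thesis using \<open>0 < r\<close> by (simp add: dist_norm)
    qed
    then show "\<exists>N. \<forall>n\<ge>N. dist (X n) (Abs_ell2 L) < r" by blast
  qed
  then show "convergent X" by (auto simp: convergent_def)
qed

instance ell2 :: banach ..

definition unit_vector :: "int \<Rightarrow> ell2" where
  "unit_vector k = Abs_ell2 (\<lambda>i. if i = k then 1 else 0)"

lemma coord_unit_vector: "coord (unit_vector k) i = (if i = k then 1 else 0)"
  by (simp add: unit_vector_def coord_Abs square_summable_finite_support)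

lemma inner_unit_vector: "inner u (unit_vector k) = Re (coord u k)"
proof -
  have "inner u (unit_vector k) = infsum (\<lambda>i. inner (coord u i) (coord (unit_vector k) i)) {k}"
    unfolding inner_ell2_def by (rule infsum_cong_neutral) (auto simp: coord_unit_vector)
  then show ?thesis by (simp add: coord_unit_vector inner_complex_def)
qed

lemma norm_unit_vector [simp]: "norm (unit_vector k) = 1"
  by (simp add: norm_eq_sqrt_inner inner_unit_vector coord_unit_vector)

section \<open>Weighted shifts\<close>

definition bounded_weights :: "(int \<Rightarrow> complex) \<Rightarrow> bool" where
  "bounded_weights d \<longleftrightarrow> (\<exists>C. \<forall>i. cmod (d i) \<le> C)"

text \<open>\<open>Blinfun\<close> is meaningful here only for bounded weights. Shift 0 gives the
  scalars and the diagonal operators, shift 1 the images of x, and the adjoint of a weighted shift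
  is again one, with the opposite shift.\<close>

definition weighted_shift :: "int \<Rightarrow> (int \<Rightarrow> complex) \<Rightarrow> ell2 \<Rightarrow>\<^sub>L ell2" where
  "weighted_shift s d = Blinfun (\<lambda>u. Abs_ell2 (\<lambda>i. d i * coord u (i - s)))"

lemma coord_weighted_shift:
  assumes "bounded_weights d"
  shows "coord (weighted_shift s d u) i = d i * coord u (i - s)"
proof -
  obtain C where C: "cmod (d i) \<le> C" for i
    using assms unfolding bounded_weights_def by blast
  then have "0 \<le> C" using norm_ge_zero order_trans by blast
  define f where "f u = Abs_ell2 (\<lambda>i. d i * coord u (i - s))" for u
  have c: "coord (f u) i = d i * coord u (i - s)" for u i
    unfolding f_def by (simp add: coord_Abs square_summable_mult[where C = C] square_summable_shift C)
  have "bounded_linear f"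
  proof (rule bounded_linear_intro[where K = C])
    fix u v :: ell2 and r :: real
    show "f (u + v) = f u + f v" "f (r *\<^sub>R u) = r *\<^sub>R f u"
      by (auto intro!: ell2_eqI simp: c distrib_left)
    show "norm (f u) \<le> norm u * C"
    proof (rule norm_ell2_le)
      fix F :: "int set" assume "finite F"
      have "(\<Sum>i\<in>F. (cmod (d i * coord u (i - s)))\<^sup>2) \<le> (\<Sum>i\<in>F. C\<^sup>2 * (cmod (coord u (i - s)))\<^sup>2)"
        by (intro sum_mono) (auto simp: norm_mult power_mult_distrib intro!: mult_right_mono power_mono C)
      also have "\<dots> = C\<^sup>2 * (\<Sum>i\<in>(\<lambda>i. i - s) ` F. (cmod (coord u i))\<^sup>2)"
        by (subst sum.reindex) (auto simp: sum_distrib_left inj_on_def)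
      also have "\<dots> \<le> C\<^sup>2 * (norm u)\<^sup>2"
        by (intro mult_left_mono sum_coord_le) (auto simp: \<open>finite F\<close>)
      finally show "(\<Sum>i\<in>F. (cmod (coord (f u) i))\<^sup>2) \<le> (norm u * C)\<^sup>2"
        by (simp add: c power_mult_distrib mult.commute)
    qed (simp add: \<open>0 \<le> C\<close>)
  qed
  moreover have "weighted_shift s d = Blinfun f"
    unfolding weighted_shift_def f_def ..
  ultimately show ?thesis
    by (simp add: bounded_linear_Blinfun_apply c)
qed

lemma bounded_weights_const [simp]: "bounded_weights (\<lambda>_. c)"
  unfolding bounded_weights_def by blast

lemma bounded_weights_mult:
  assumes "bounded_weights d" "bounded_weights e"
  shows "bounded_weights (\<lambda>i. d i * e (i - s))"
proof -
  obtain C D where "\<And>i. cmod (d i) \<le> C" "\<And>i. cmod (e i) \<le> D"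
    using assms unfolding bounded_weights_def by blast
  moreover from this have "0 \<le> C" using norm_ge_zero order_trans by blast
  ultimately have "cmod (d i * e (i - s)) \<le> C * D" for i
    by (simp add: norm_mult mult_mono)
  then show ?thesis unfolding bounded_weights_def by blast
qed

lemma bounded_weights_cnj:
  assumes "bounded_weights d" shows "bounded_weights (\<lambda>i. cnj (d (i + s)))"
  using assms unfolding bounded_weights_def by (metis complex_mod_cnj)

lemma weighted_shift_compose:
  assumes "bounded_weights d" "bounded_weights e"
  shows "weighted_shift s d o\<^sub>L weighted_shift t e = weighted_shift (s + t) (\<lambda>i. d i * e (i - s))"
  by (rule blinfun_eqI, rule ell2_eqI)
     (simp add: coord_weighted_shift assms bounded_weights_mult diff_diff_eq)

lemma weighted_shift_id: "weighted_shift 0 (\<lambda>_. 1) = id_blinfun"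
  by (rule blinfun_eqI, rule ell2_eqI) (simp add: coord_weighted_shift)

lemma weighted_shift_inner:
  assumes "bounded_weights d"
  shows "inner (weighted_shift s d u) v = inner u (weighted_shift (- s) (\<lambda>i. cnj (d (i + s))) v)"
proof -
  have "bij_betw (\<lambda>i::int. i + s) UNIV UNIV"
    by (rule bij_betwI[where g = "\<lambda>i. i - s"]) auto
  from infsum_reindex_bij_betw[OF this, of "\<lambda>i. inner (d i * coord u (i - s)) (coord v i)"]
  show ?thesis
    by (simp add: inner_ell2_def coord_weighted_shift assms bounded_weights_cnj inner_complex_def algebra_simps)
qed

section \<open>The operator algebra\<close>

definition scalar_op :: "complex \<Rightarrow> ell2 \<Rightarrow>\<^sub>L ell2" where
  "scalar_op c = weighted_shift 0 (\<lambda>_. c)"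

lemma coord_scalar_op [simp]: "coord (scalar_op c u) i = c * coord u i"
  by (simp add: scalar_op_def coord_weighted_shift)

lemma scalar_op_simps:
  "scalar_op (c + d) = scalar_op c + scalar_op d"
  "scalar_op (c * d) = scalar_op c o\<^sub>L scalar_op d"
  "scalar_op 1 = id_blinfun"
  by (rule blinfun_eqI, rule ell2_eqI, simp add: algebra_simps blinfun.add_left)+

lemma inner_scalar_op: "inner (scalar_op c u) v = inner u (scalar_op (cnj c) v)"
  unfolding scalar_op_def by (subst weighted_shift_inner) auto

lemma norm_scalar_op_apply: "norm (scalar_op c u) = cmod c * norm u"
proof -
  have "(norm (scalar_op c u))\<^sup>2 = (cmod c * norm u)\<^sup>2"
    unfolding norm_ell2_power2 power_mult_distrib
    by (simp add: norm_mult power_mult_distrib infsum_cmult_right')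
  then show ?thesis by (simp add: power2_eq_iff_nonneg)
qed

lemma norm_scalar_op_compose: "norm (scalar_op c o\<^sub>L T) = cmod c * norm T"
proof (rule antisym)
  show "norm (scalar_op c o\<^sub>L T) \<le> cmod c * norm T"
    by (rule norm_blinfun_bound)
       (auto simp: norm_scalar_op_apply mult.assoc intro!: mult_left_mono norm_blinfun)
  show "cmod c * norm T \<le> norm (scalar_op c o\<^sub>L T)"
  proof (cases "c = 0")
    case False
    have "norm T \<le> norm (scalar_op c o\<^sub>L T) / cmod c"
    proof (rule norm_blinfun_bound)
      fix u
      have "cmod c * norm (T u) \<le> norm (scalar_op c o\<^sub>L T) * norm u"
        using norm_blinfun[of "scalar_op c o\<^sub>L T" u] by (simp add: norm_scalar_op_apply)
      then show "norm (T u) \<le> norm (scalar_op c o\<^sub>L T) / cmod c * norm u"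
        using False by (simp add: field_simps)
    qed simp
    then show ?thesis using False by (simp add: field_simps)
  qed simp
qed

lemma inner_scalar_unit_vector: "inner u (scalar_op c (unit_vector k)) = Re (cnj c * coord u k)"
  using inner_scalar_op[of "cnj c" u "unit_vector k"] by (simp add: inner_unit_vector)

text \<open>The factors 1 and \<open>\<i>\<close> in front of the unit vector make the real inner
  product return the real and the imaginary part of a coordinate.\<close>

lemma ell2_eqI_inner:
  assumes "\<And>c k. inner u (scalar_op c (unit_vector k)) = inner v (scalar_op c (unit_vector k))"
  shows "u = v"
proof (rule ell2_eqI)
  fix k
  have "Re (coord u k) = Re (coord v k)" "Im (coord u k) = Im (coord v k)"
    using assms[of 1 k] assms[of \<i> k] by (simp_all add: inner_scalar_unit_vector)
  then show "coord u k = coord v k" by (rule complex_eqI)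
qed

lemma weighted_shift_unit_vector:
  assumes "bounded_weights d"
  shows "weighted_shift s d (unit_vector k) = scalar_op (d (k + s)) (unit_vector (k + s))"
  by (rule ell2_eqI) (auto simp: coord_weighted_shift assms coord_unit_vector)

section \<open>Adjoints and complex-linear operators\<close>

definition is_adjoint :: "(ell2 \<Rightarrow>\<^sub>L ell2) \<Rightarrow> (ell2 \<Rightarrow>\<^sub>L ell2) \<Rightarrow> bool" where
  "is_adjoint T S \<longleftrightarrow> (\<forall>u v. inner (T u) v = inner u (S v))"

definition adjoint_op :: "(ell2 \<Rightarrow>\<^sub>L ell2) \<Rightarrow> (ell2 \<Rightarrow>\<^sub>L ell2)" where
  "adjoint_op T = (THE S. is_adjoint T S)"

lemma adjoint_op_eqI:
  assumes "is_adjoint T S" shows "adjoint_op T = S"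
  unfolding adjoint_op_def
proof (rule the_equality[where P = "is_adjoint T", OF assms])
  fix S' assume "is_adjoint T S'"
  show "S' = S"
  proof (rule blinfun_eqI)
    fix v
    have "inner u (S' v - S v) = 0" for u
      using assms \<open>is_adjoint T S'\<close> by (simp add: is_adjoint_def inner_diff_right)
    from this[of "S' v - S v"] show "S' v = S v" by simp
  qed
qed

text \<open>The existence of an adjoint is part of the definition: for weighted shifts it is
  explicit, sums and products inherit it, and \<open>complex_op_limit\<close> carries it over to
  norm limits. Commuting with every \<open>scalar_op c\<close> is complex linearity.\<close>

definition complex_op :: "(ell2 \<Rightarrow>\<^sub>L ell2) \<Rightarrow> bool" where
  "complex_op T \<longleftrightarrow> (\<exists>S. is_adjoint T S) \<and> (\<forall>c. T o\<^sub>L scalar_op c = scalar_op c o\<^sub>L T)"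

lemma is_adjoint_adjoint_op:
  assumes "complex_op T" shows "is_adjoint T (adjoint_op T)"
  using assms adjoint_op_eqI unfolding complex_op_def by blast

lemma inner_adjoint_op: "complex_op T \<Longrightarrow> inner (T u) v = inner u (adjoint_op T v)"
  using is_adjoint_adjoint_op unfolding is_adjoint_def by blast

lemma complex_op_scalar: "complex_op T \<Longrightarrow> T (scalar_op c u) = scalar_op c (T u)"
  unfolding complex_op_def by (metis blinfun_compose.rep_eq comp_apply)

lemma is_adjoint_sym: "is_adjoint T S \<Longrightarrow> is_adjoint S T"
  unfolding is_adjoint_def by (metis inner_commute)

lemma complex_op_adjoint:
  assumes "complex_op T" shows "complex_op (adjoint_op T)"
  unfolding complex_op_def
proof (intro conjI allI)
  show "\<exists>S. is_adjoint (adjoint_op T) S"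
    using is_adjoint_sym[OF is_adjoint_adjoint_op[OF assms]] by blast
  fix c
  show "adjoint_op T o\<^sub>L scalar_op c = scalar_op c o\<^sub>L adjoint_op T"
  proof (rule blinfun_eqI)
    fix v
    have "inner u (adjoint_op T (scalar_op c v) - scalar_op c (adjoint_op T v)) = 0" for u
      using inner_adjoint_op[OF assms, of u "scalar_op c v"]
        inner_adjoint_op[OF assms, of "scalar_op (cnj c) u" v]
      by (simp add: inner_diff_right complex_op_scalar[OF assms] inner_scalar_op)
    from this[of "adjoint_op T (scalar_op c v) - scalar_op c (adjoint_op T v)"]
    show "(adjoint_op T o\<^sub>L scalar_op c) v = (scalar_op c o\<^sub>L adjoint_op T) v" by simp
  qed
qed

lemma adjoint_op_adjoint_op: "complex_op T \<Longrightarrow> adjoint_op (adjoint_op T) = T"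
  by (simp add: adjoint_op_eqI is_adjoint_adjoint_op is_adjoint_sym)

lemma complex_op_weighted_shift:
  assumes "bounded_weights d" shows "complex_op (weighted_shift s d)"
  unfolding complex_op_def is_adjoint_def scalar_op_def
  using weighted_shift_inner[OF assms]
  by (auto simp: weighted_shift_compose assms mult.commute)

lemma adjoint_weighted_shift:
  assumes "bounded_weights d"
  shows "adjoint_op (weighted_shift s d) = weighted_shift (- s) (\<lambda>i. cnj (d (i + s)))"
  by (rule adjoint_op_eqI) (simp add: is_adjoint_def weighted_shift_inner[OF assms])

lemma complex_op_scalar_op [simp]: "complex_op (scalar_op c)"
  by (simp add: scalar_op_def complex_op_weighted_shift)

lemma complex_op_id [simp]: "complex_op id_blinfun"
  using complex_op_scalar_op[of 1] by (simp add: scalar_op_simps)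

lemma complex_op_zero [simp]: "complex_op 0"
proof -
  have "scalar_op 0 = 0" by (rule blinfun_eqI, rule ell2_eqI) simp
  then show ?thesis using complex_op_scalar_op[of 0] by simp
qed

lemma complex_op_compose [simp]:
  assumes "complex_op S" "complex_op T" shows "complex_op (S o\<^sub>L T)"
    and "adjoint_op (S o\<^sub>L T) = adjoint_op T o\<^sub>L adjoint_op S"
proof -
  have *: "is_adjoint (S o\<^sub>L T) (adjoint_op T o\<^sub>L adjoint_op S)"
    using assms by (simp add: is_adjoint_def inner_adjoint_op)
  then show "adjoint_op (S o\<^sub>L T) = adjoint_op T o\<^sub>L adjoint_op S" by (rule adjoint_op_eqI)
  have "(S o\<^sub>L T) o\<^sub>L scalar_op c = scalar_op c o\<^sub>L (S o\<^sub>L T)" for c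
    by (rule blinfun_eqI) (simp add: complex_op_scalar assms)
  with * show "complex_op (S o\<^sub>L T)" unfolding complex_op_def by blast
qed

lemma complex_op_add [simp]:
  assumes "complex_op S" "complex_op T" shows "complex_op (S + T)"
    and "adjoint_op (S + T) = adjoint_op S + adjoint_op T"
proof -
  have *: "is_adjoint (S + T) (adjoint_op S + adjoint_op T)"
    using assms by (simp add: is_adjoint_def inner_adjoint_op blinfun.add_left inner_add_left inner_add_right)
  then show "adjoint_op (S + T) = adjoint_op S + adjoint_op T" by (rule adjoint_op_eqI)
  have "(S + T) o\<^sub>L scalar_op c = scalar_op c o\<^sub>L (S + T)" for c
    by (rule blinfun_eqI) (simp add: complex_op_scalar assms blinfun.add_left blinfun.add_right)
  with * show "complex_op (S + T)" unfolding complex_op_def by blast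
qed

lemma adjoint_scalar_op: "adjoint_op (scalar_op c) = scalar_op (cnj c)"
  by (rule adjoint_op_eqI) (simp add: is_adjoint_def inner_scalar_op)

lemma scalar_op_minus_one: "scalar_op (- 1) o\<^sub>L T = - T"
  by (rule blinfun_eqI, rule ell2_eqI) (simp add: blinfun.minus_left)

lemma complex_op_uminus [simp]: "complex_op T \<Longrightarrow> complex_op (- T)"
  by (metis complex_op_compose(1) complex_op_scalar_op scalar_op_minus_one)

lemma adjoint_op_uminus: "complex_op T \<Longrightarrow> adjoint_op (- T) = - adjoint_op T"
  by (rule adjoint_op_eqI)
     (simp add: is_adjoint_def inner_adjoint_op blinfun.minus_left)

lemma complex_op_diff [simp]:
  assumes "complex_op S" "complex_op T" shows "complex_op (S - T)"
    and "adjoint_op (S - T) = adjoint_op S - adjoint_op T"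
  using complex_op_add[of S "- T"] assms by (simp_all add: adjoint_op_uminus)

text \<open>Cauchy-Schwarz gives the lower bound in the C*-identity. With submultiplicativity it
  yields \<open>norm S \<le> norm (adjoint_op S)\<close>; applied to the adjoint as well, this makes
  the adjoint isometric, and the upper bound follows.\<close>

lemma norm_adjoint_compose:
  assumes "complex_op T" shows "norm (adjoint_op T o\<^sub>L T) = (norm T)\<^sup>2"
    and "norm (adjoint_op T) = norm T"
proof -
  have le: "(norm S)\<^sup>2 \<le> norm (adjoint_op S o\<^sub>L S)" if "complex_op S" for S
  proof -
    have "norm S \<le> sqrt (norm (adjoint_op S o\<^sub>L S))"
    proof (rule norm_blinfun_bound)
      fix u
      have "(norm (S u))\<^sup>2 = inner u ((adjoint_op S o\<^sub>L S) u)"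
        by (simp add: power2_norm_eq_inner inner_adjoint_op[OF that])
      also have "\<dots> \<le> norm u * norm ((adjoint_op S o\<^sub>L S) u)"
        by (rule norm_cauchy_schwarz)
      also have "\<dots> \<le> norm u * (norm (adjoint_op S o\<^sub>L S) * norm u)"
        by (intro mult_left_mono norm_blinfun) simp
      also have "\<dots> = (sqrt (norm (adjoint_op S o\<^sub>L S)) * norm u)\<^sup>2"
        by (simp add: power_mult_distrib power2_eq_square)
      finally show "norm (S u) \<le> sqrt (norm (adjoint_op S o\<^sub>L S)) * norm u"
        by (rule power2_le_imp_le) simp
    qed simp
    then have "(norm S)\<^sup>2 \<le> (sqrt (norm (adjoint_op S o\<^sub>L S)))\<^sup>2"
      by (rule power_mono) simp
    then show ?thesis by simp
  qed
  have norm_le: "norm S \<le> norm (adjoint_op S)" if "complex_op S" for S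
  proof (cases "norm S = 0")
    case False
    have "norm S * norm S \<le> norm (adjoint_op S) * norm S"
      using le[OF that] norm_blinfun_compose[of "adjoint_op S" S] by (simp add: power2_eq_square)
    then show ?thesis using False by (simp add: mult_le_cancel_right)
  qed simp
  show eq: "norm (adjoint_op T) = norm T"
    using norm_le[OF assms] norm_le[OF complex_op_adjoint[OF assms]]
    by (simp add: adjoint_op_adjoint_op assms)
  show "norm (adjoint_op T o\<^sub>L T) = (norm T)\<^sup>2"
    using le[OF assms] norm_blinfun_compose[of "adjoint_op T" T] by (simp add: eq power2_eq_square)
qed

text \<open>Taking adjoints is isometric, so the adjoints of a convergent sequence form a Cauchy
  sequence, and its limit is an adjoint of the limit. This is the substance of the completeness of
  \<open>operator_algebra\<close>.\<close>

lemma complex_op_limit: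
  assumes "\<And>n. complex_op (X n)" "X \<longlonglongrightarrow> T"
  shows "complex_op T"
proof -
  have "Cauchy (\<lambda>n. adjoint_op (X n))"
  proof (rule metric_CauchyI)
    fix e :: real assume "0 < e"
    then obtain N where "\<forall>m\<ge>N. \<forall>n\<ge>N. dist (X m) (X n) < e"
      using LIMSEQ_imp_Cauchy[OF assms(2)] unfolding Cauchy_def by blast
    moreover have "dist (adjoint_op (X m)) (adjoint_op (X n)) = dist (X m) (X n)" for m n
      using norm_adjoint_compose(2)[of "X m - X n"] by (simp add: dist_norm assms(1))
    ultimately show "\<exists>N. \<forall>m\<ge>N. \<forall>n\<ge>N. dist (adjoint_op (X m)) (adjoint_op (X n)) < e" by auto
  qed
  then obtain S where S: "(\<lambda>n. adjoint_op (X n)) \<longlonglongrightarrow> S"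
    by (metis Cauchy_convergent_iff convergent_def)
  have lim: "(\<lambda>n. Y n v) \<longlonglongrightarrow> L v" if "Y \<longlonglongrightarrow> L" for Y and L :: "ell2 \<Rightarrow>\<^sub>L ell2" and v
    using blinfun.tendsto[OF that tendsto_const] .
  have "inner (T u) v = inner u (S v)" for u v
  proof (rule LIMSEQ_unique)
    show "(\<lambda>n. inner (X n u) v) \<longlonglongrightarrow> inner (T u) v"
      by (intro tendsto_inner tendsto_const lim assms)
    show "(\<lambda>n. inner (X n u) v) \<longlonglongrightarrow> inner u (S v)"
      unfolding inner_adjoint_op[OF assms(1)] by (intro tendsto_inner tendsto_const lim S)
  qed
  moreover have "T o\<^sub>L scalar_op c = scalar_op c o\<^sub>L T" for c
  proof (rule blinfun_eqI, rule LIMSEQ_unique)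
    fix u
    show "(\<lambda>n. X n (scalar_op c u)) \<longlonglongrightarrow> (T o\<^sub>L scalar_op c) u"
      using lim[OF assms(2)] by simp
    show "(\<lambda>n. X n (scalar_op c u)) \<longlonglongrightarrow> (scalar_op c o\<^sub>L T) u"
      unfolding complex_op_scalar[OF assms(1)]
      using blinfun.tendsto[OF tendsto_const lim[OF assms(2)]] by simp
  qed
  ultimately show ?thesis unfolding complex_op_def is_adjoint_def by blast
qed

text \<open>Stated for a normed abelian group, because it serves \<open>operator_algebra\<close>
  before that is known to be a C*-algebra.\<close>

lemma Metric_space_cstar_dist:
  fixes A (structure)
  assumes "abelian_group A"
    and nonneg: "\<And>a. a \<in> carrier A \<Longrightarrow> 0 \<le> nrm A a"
    and eq_zero: "\<And>a. a \<in> carrier A \<Longrightarrow> nrm A a = 0 \<longleftrightarrow> a = \<zero>"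
    and triangle: "\<And>a b. a \<in> carrier A \<Longrightarrow> b \<in> carrier A \<Longrightarrow> nrm A (a \<oplus> b) \<le> nrm A a + nrm A b"
    and uminus: "\<And>a. a \<in> carrier A \<Longrightarrow> nrm A (\<ominus> a) = nrm A a"
  shows "Metric_space (carrier A) (cstar_dist A)"
proof -
  interpret abelian_group A by fact
  show ?thesis
  proof
    fix a b
    show "0 \<le> cstar_dist A a b"
      by (simp add: cstar_dist_def nonneg)
    show "cstar_dist A a b = cstar_dist A b a"
    proof (cases "a \<in> carrier A \<and> b \<in> carrier A")
      case True
      then have "\<ominus> (a \<ominus> b) = b \<ominus> a"
        by (simp add: a_minus_def minus_add a_comm)
      then show ?thesis
        using True uminus[of "a \<ominus> b"] by (simp add: cstar_dist_def)
    qed (auto simp: cstar_dist_def)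
  next
    fix a b assume "a \<in> carrier A" "b \<in> carrier A"
    then show "cstar_dist A a b = 0 \<longleftrightarrow> a = b"
      using minus_equality[of a "\<ominus> b"] by (auto simp: cstar_dist_def eq_zero a_minus_def r_neg)
  next
    fix a b c assume c: "a \<in> carrier A" "b \<in> carrier A" "c \<in> carrier A"
    have "(a \<ominus> b) \<oplus> (b \<ominus> c) = a \<ominus> c"
      using c by (simp add: a_minus_def a_assoc r_neg1 flip: a_assoc[of "\<ominus> b" b])
    then show "cstar_dist A a c \<le> cstar_dist A a b + cstar_dist A b c"
      using triangle[of "a \<ominus> b" "b \<ominus> c"] c by (simp add: cstar_dist_def)
  qed
qed

section \<open>Operators coded as sequences of reals\<close>

definition encode_op :: "(ell2 \<Rightarrow>\<^sub>L ell2) \<Rightarrow> nat \<Rightarrow> real" where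
  "encode_op T n = (case from_nat n of (i :: int, j :: int, b :: bool) \<Rightarrow>
     if b then Re (coord (T (unit_vector j)) i) else Im (coord (T (unit_vector j)) i))"

text \<open>Equal codes mean equal values on unit vectors. Moving the operators to the other side of
  the inner product gives equal adjoints on every vector, and moving them back gives equality, so
  comparing coordinates takes the place of a density argument.\<close>

lemma encode_op_inject:
  assumes "encode_op S = encode_op T" "complex_op S" "complex_op T"
  shows "S = T"
proof -
  have "coord (S (unit_vector j)) i = coord (T (unit_vector j)) i" for i j
    using fun_cong[OF assms(1), of "to_nat (i, j, True)"] fun_cong[OF assms(1), of "to_nat (i, j, False)"]
    by (simp add: encode_op_def complex_eq_iff)
  then have unit: "S (unit_vector j) = T (unit_vector j)" for j
    by (rule ell2_eqI)
  have adj: "adjoint_op S v = adjoint_op T v" for v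
  proof (rule ell2_eqI_inner)
    fix c k
    show "inner (adjoint_op S v) (scalar_op c (unit_vector k)) = inner (adjoint_op T v) (scalar_op c (unit_vector k))"
      using inner_adjoint_op[OF assms(2), of "scalar_op c (unit_vector k)" v]
        inner_adjoint_op[OF assms(3), of "scalar_op c (unit_vector k)" v]
      by (simp add: complex_op_scalar assms unit inner_commute)
  qed
  show "S = T"
  proof (rule blinfun_eqI, rule ell2_eqI_inner)
    fix u c k
    show "inner (S u) (scalar_op c (unit_vector k)) = inner (T u) (scalar_op c (unit_vector k))"
      by (simp add: inner_adjoint_op assms adj)
  qed
qed

definition decode_op :: "(nat \<Rightarrow> real) \<Rightarrow> (ell2 \<Rightarrow>\<^sub>L ell2)" where
  "decode_op = inv_into {T. complex_op T} encode_op"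

lemma decode_encode [simp]: "complex_op T \<Longrightarrow> decode_op (encode_op T) = T"
  unfolding decode_op_def by (rule inv_into_f_f) (auto intro!: inj_onI encode_op_inject)

definition operator_algebra :: "(nat \<Rightarrow> real) cstar" where
  "operator_algebra =
     \<lparr>carrier = encode_op ` {T. complex_op T},
      mult = (\<lambda>a b. encode_op (decode_op a o\<^sub>L decode_op b)),
      one = encode_op id_blinfun,
      zero = encode_op 0,
      add = (\<lambda>a b. encode_op (decode_op a + decode_op b)),
      smult = (\<lambda>c a. encode_op (scalar_op c o\<^sub>L decode_op a)),
      star = (\<lambda>a. encode_op (adjoint_op (decode_op a))),
      nrm = (\<lambda>a. norm (decode_op a))\<rparr>"

lemma operator_algebra_simps [simp]:
  "carrier operator_algebra = encode_op ` {T. complex_op T}"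
  "one operator_algebra = encode_op id_blinfun"
  "zero operator_algebra = encode_op 0"
  "complex_op S \<Longrightarrow> complex_op T \<Longrightarrow> mult operator_algebra (encode_op S) (encode_op T) = encode_op (S o\<^sub>L T)"
  "complex_op S \<Longrightarrow> complex_op T \<Longrightarrow> add operator_algebra (encode_op S) (encode_op T) = encode_op (S + T)"
  "complex_op T \<Longrightarrow> smult operator_algebra c (encode_op T) = encode_op (scalar_op c o\<^sub>L T)"
  "complex_op T \<Longrightarrow> star operator_algebra (encode_op T) = encode_op (adjoint_op T)"
  "complex_op T \<Longrightarrow> nrm operator_algebra (encode_op T) = norm T"
  by (simp_all add: operator_algebra_def)

lemma encode_eq_iff: "complex_op S \<Longrightarrow> complex_op T \<Longrightarrow> encode_op S = encode_op T \<longleftrightarrow> S = T"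
  by (auto dest: encode_op_inject)

lemma blinfun_compose_simps:
  fixes S T U :: "ell2 \<Rightarrow>\<^sub>L ell2"
  shows "(S o\<^sub>L T) o\<^sub>L U = S o\<^sub>L (T o\<^sub>L U)" "id_blinfun o\<^sub>L T = T" "T o\<^sub>L id_blinfun = T"
    "(S + T) o\<^sub>L U = (S o\<^sub>L U) + (T o\<^sub>L U)" "S o\<^sub>L (T + U) = (S o\<^sub>L T) + (S o\<^sub>L U)"
  by (rule blinfun_eqI, simp add: blinfun.add_left blinfun.add_right)+

lemma scalar_op_commute: "complex_op T \<Longrightarrow> T o\<^sub>L scalar_op c = scalar_op c o\<^sub>L T"
  unfolding complex_op_def by blast

lemma scalar_op_commute': "complex_op T \<Longrightarrow> T o\<^sub>L (scalar_op c o\<^sub>L S) = scalar_op c o\<^sub>L (T o\<^sub>L S)"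
  by (rule blinfun_eqI) (simp add: complex_op_scalar)

lemma operator_algebra_ring: "ring operator_algebra"
proof (rule ringI)
  show "abelian_group operator_algebra"
  proof (rule abelian_groupI)
    fix a assume "a \<in> carrier operator_algebra"
    then obtain T where T: "complex_op T" "a = encode_op T" by auto
    then show "\<exists>b\<in>carrier operator_algebra. add operator_algebra b a = zero operator_algebra"
      by (intro bexI[of _ "encode_op (- T)"]) auto
  qed (auto simp: ac_simps)
  show "Group.monoid operator_algebra"
    by (rule monoidI) (auto simp: blinfun_compose_simps)
qed (auto simp: blinfun_compose_simps)

lemma complex_field_cring: "cring complex_field"
proof (rule cringI)
  show "abelian_group complex_field"
    by (rule abelian_groupI) (auto simp: complex_field_def intro: exI[of _ "- x" for x] add.left_inverse)
  show "Group.comm_monoid complex_field"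
    by (rule comm_monoidI) (auto simp: complex_field_def)
qed (auto simp: complex_field_def distrib_right)

lemma complex_field_simps [simp]:
  "carrier complex_field = UNIV" "mult complex_field = (*)" "add complex_field = (+)"
  "one complex_field = 1" "zero complex_field = 0"
  by (simp_all add: complex_field_def)

lemma operator_algebra_module: "module complex_field operator_algebra"
  by (rule moduleI)
     (auto simp: complex_field_cring ring.is_abelian_group[OF operator_algebra_ring] scalar_op_simps
        blinfun_compose_simps)

lemma operator_algebra_uminus [simp]:
  assumes "complex_op T" shows "a_inv operator_algebra (encode_op T) = encode_op (- T)"
proof -
  interpret ring operator_algebra by (rule operator_algebra_ring)
  show ?thesis by (rule minus_equality) (use assms in auto)
qed

lemma operator_algebra_minus [simp]:
  "complex_op S \<Longrightarrow> complex_op T \<Longrightarrow> a_minus operator_algebra (encode_op S) (encode_op T) = encode_op (S - T)"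
  by (simp add: a_minus_def)

lemma operator_algebra_metric: "Metric_space (carrier operator_algebra) (cstar_dist operator_algebra)"
  by (rule Metric_space_cstar_dist[OF ring.is_abelian_group[OF operator_algebra_ring]])
     (auto simp: encode_eq_iff norm_triangle_ineq)

lemma operator_algebra_complete:
  "Metric_space.mcomplete (carrier operator_algebra) (cstar_dist operator_algebra)"
proof -
  interpret M: Metric_space "carrier operator_algebra" "cstar_dist operator_algebra"
    by (rule operator_algebra_metric)
  show ?thesis
    unfolding M.mcomplete_def
  proof (intro allI impI)
    fix \<sigma> assume \<sigma>: "M.MCauchy \<sigma>"
    have "\<exists>T. complex_op T \<and> \<sigma> n = encode_op T" for n
    proof -
      have "\<sigma> n \<in> carrier operator_algebra" using \<sigma> unfolding M.MCauchy_def by blast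
      then show ?thesis by auto
    qed
    then obtain T where T: "complex_op (T n)" "\<sigma> n = encode_op (T n)" for n by metis
    have dist: "cstar_dist operator_algebra (encode_op S) (encode_op U) = dist S U"
      if "complex_op S" "complex_op U" for S U
      using that by (simp add: cstar_dist_def dist_norm)
    have "Cauchy T"
      using \<sigma> unfolding M.MCauchy_def Cauchy_def by (simp add: T dist)
    then obtain L where L: "T \<longlonglongrightarrow> L"
      by (auto simp: Cauchy_convergent_iff convergent_def)
    have "complex_op L" by (rule complex_op_limit[OF T(1) L])
    have "limitin M.mtopology \<sigma> (encode_op L) sequentially"
      unfolding M.limit_metric_sequentially using L \<open>complex_op L\<close>
      by (auto simp: T dist lim_sequentially)
    then show "\<exists>a. limitin M.mtopology \<sigma> a sequentially" by blast
  qed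
qed

lemma operator_algebra_cstar: "unital_cstar_algebra operator_algebra"
proof (intro unital_cstar_algebra.intro unital_cstar_algebra_axioms.intro
    operator_algebra_module operator_algebra_ring operator_algebra_complete)
qed (auto simp: complex_op_adjoint adjoint_op_adjoint_op adjoint_scalar_op scalar_op_commute
   scalar_op_commute' blinfun_compose_simps encode_eq_iff norm_triangle_ineq norm_scalar_op_compose
   norm_blinfun_compose norm_adjoint_compose)

section \<open>Representations along an orbit\<close>

context irrational_rotation
begin

definition orbit_diagonal :: "(complex \<Rightarrow> complex) \<Rightarrow> complex \<Rightarrow> (ell2 \<Rightarrow>\<^sub>L ell2)" where
  "orbit_diagonal f \<xi> = weighted_shift 0 (\<lambda>k. f (\<mu> powi k * \<xi>))"

lemma orbit_circle: "\<xi> \<in> unit_circle \<Longrightarrow> \<mu> powi k * \<xi> \<in> unit_circle"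
  by (simp add: norm_mult)

lemma bounded_weights_orbit:
  assumes "continuous_on unit_circle f" "\<xi> \<in> unit_circle"
  shows "bounded_weights (\<lambda>k. f (\<mu> powi k * \<xi>))"
proof -
  have "bounded (f ` unit_circle)"
    by (rule compact_imp_bounded[OF compact_continuous_image[OF assms(1)]]) simp
  then obtain C where "\<forall>z\<in>unit_circle. cmod (f z) \<le> C"
    unfolding bounded_iff by auto
  then show ?thesis
    unfolding bounded_weights_def using orbit_circle[OF assms(2)] by blast
qed

lemma complex_op_orbit_diagonal:
  "continuous_on unit_circle f \<Longrightarrow> \<xi> \<in> unit_circle \<Longrightarrow> complex_op (orbit_diagonal f \<xi>)"
  unfolding orbit_diagonal_def by (intro complex_op_weighted_shift bounded_weights_orbit)

lemma coord_orbit_diagonal: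
  "continuous_on unit_circle f \<Longrightarrow> \<xi> \<in> unit_circle \<Longrightarrow>
    coord (orbit_diagonal f \<xi> u) k = f (\<mu> powi k * \<xi>) * coord u k"
  unfolding orbit_diagonal_def by (simp add: coord_weighted_shift bounded_weights_orbit)

text \<open>A dense orbit makes every point of the circle an approximate eigenvalue: the unit vector
  at \<open>k\<close> is almost an eigenvector for \<open>l\<close> when
  \<open>\<mu> ^ k * \<xi>\<close> is close to \<open>l\<close>.\<close>

lemma circle_subset_spectrum_orbit:
  assumes "\<xi> \<in> unit_circle"
  shows "unit_circle \<subseteq> spectrum operator_algebra (encode_op (orbit_diagonal (\<lambda>z. z) \<xi>))"
proof
  fix l :: complex assume l: "l \<in> unit_circle"
  let ?W = "orbit_diagonal (\<lambda>z. z) \<xi>"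
  have W: "complex_op ?W" by (intro complex_op_orbit_diagonal assms continuous_on_id)
  show "l \<in> spectrum operator_algebra (encode_op ?W)"
    unfolding spectrum_def
  proof safe
    assume "l \<odot>\<^bsub>operator_algebra\<^esub> \<one>\<^bsub>operator_algebra\<^esub> \<ominus>\<^bsub>operator_algebra\<^esub> encode_op ?W \<in> Units operator_algebra"
    then obtain V where V: "complex_op V" "V o\<^sub>L (scalar_op l - ?W) = id_blinfun"
      using W by (auto simp: Units_def encode_eq_iff blinfun_compose_simps)
    \<comment> \<open>An inverse \<open>V\<close> maps a vector of norm below
      \<open>1 / (norm V + 1)\<close> to one of norm below 1, but here it has to return a unit
      vector. Adding 1 keeps the denominator positive.\<close>
    have "0 < 1 / (norm V + 1)" by (simp add: add_nonneg_pos)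
    then obtain k :: nat where k: "cmod (\<mu> ^ k * \<xi> - l) < 1 / (norm V + 1)"
      using forward_orbit_dense[of \<xi> l "1 / (norm V + 1)"] assms l by auto
    let ?e = "unit_vector (int k)"
    have "(scalar_op l - ?W) ?e = scalar_op (l - \<mu> ^ k * \<xi>) ?e"
      by (rule ell2_eqI)
         (simp add: blinfun.diff_left coord_orbit_diagonal[OF continuous_on_id assms] coord_unit_vector algebra_simps)
    then have "norm ((scalar_op l - ?W) ?e) < 1 / (norm V + 1)"
      using k by (simp add: norm_scalar_op_apply norm_minus_commute)
    moreover have "1 = norm (V ((scalar_op l - ?W) ?e))"
      using V(2) by (metis blinfun_apply_id_blinfun blinfun_compose.rep_eq comp_apply id_apply norm_unit_vector)
    ultimately have "1 \<le> norm V * (1 / (norm V + 1))"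
      using norm_blinfun[of V "(scalar_op l - ?W) ?e"]
      by (smt (verit) mult_left_mono norm_ge_zero)
    moreover have "norm V * (1 / (norm V + 1)) < 1"
      by (simp add: divide_less_eq add_nonneg_pos)
    ultimately show False by simp
  qed
qed

text \<open>The homomorphism sends a function to the diagonal operator of its values along the
  orbit. The orbit points must lie in the domain of the functions, which is why the circle had to be
  placed inside the spectrum first.\<close>

lemma orbit_calculus:
  assumes f: "continuous_on unit_circle f" and \<xi>: "\<xi> \<in> unit_circle"
  shows "continuous_calculus operator_algebra (encode_op (orbit_diagonal (\<lambda>z. z) \<xi>)) f
           (encode_op (orbit_diagonal f \<xi>))"
proof -
  define K where "K = spectrum operator_algebra (encode_op (orbit_diagonal (\<lambda>z. z) \<xi>))"
  have K: "unit_circle \<subseteq> K"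
    unfolding K_def by (rule circle_subset_spectrum_orbit[OF \<xi>])
  define \<Phi> where "\<Phi> g = encode_op (orbit_diagonal g \<xi>)" for g
  have cont: "continuous_on unit_circle g" if "continuous_on K g" for g :: "complex \<Rightarrow> complex"
    using that K by (rule continuous_on_subset)
  have eq: "orbit_diagonal g \<xi> = orbit_diagonal h \<xi>" if "\<And>z. z \<in> unit_circle \<Longrightarrow> g z = h z" for g h
    unfolding orbit_diagonal_def by (simp add: that[OF orbit_circle[OF \<xi>]])
  have restrict: "orbit_diagonal (restrict g K) \<xi> = orbit_diagonal g \<xi>" for g
    by (rule eq) (use K in auto)
  have op: "complex_op (orbit_diagonal g \<xi>)" if "continuous_on K g" for g
    by (intro complex_op_orbit_diagonal cont that \<xi>)
  have coord_diag: "coord (orbit_diagonal g \<xi> u) k = g (\<mu> powi k * \<xi>) * coord u k"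
    if "continuous_on K g" for g u k
    by (rule coord_orbit_diagonal[OF cont[OF that] \<xi>])
  have const: "orbit_diagonal (\<lambda>_. c) \<xi> = scalar_op c" for c
    by (simp add: orbit_diagonal_def scalar_op_def)
  have mult: "orbit_diagonal (\<lambda>z. g z * h z) \<xi> = orbit_diagonal g \<xi> o\<^sub>L orbit_diagonal h \<xi>"
    if "continuous_on K g" "continuous_on K h" for g h
    using weighted_shift_compose[OF bounded_weights_orbit bounded_weights_orbit, OF cont[OF that(1)] \<xi> cont[OF that(2)] \<xi>, of 0 0]
    unfolding orbit_diagonal_def by simp
  have add: "orbit_diagonal (\<lambda>z. g z + h z) \<xi> = orbit_diagonal g \<xi> + orbit_diagonal h \<xi>"
    if "continuous_on K g" "continuous_on K h" for g h
    by (rule blinfun_eqI, rule ell2_eqI)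
       (simp add: coord_diag that continuous_on_add blinfun.add_left distrib_right)
  have star: "orbit_diagonal (\<lambda>z. cnj (g z)) \<xi> = adjoint_op (orbit_diagonal g \<xi>)"
    if "continuous_on K g" for g
    using adjoint_weighted_shift[OF bounded_weights_orbit[OF cont[OF that] \<xi>], of 0]
    unfolding orbit_diagonal_def by simp
  have "star_hom (continuous_functions K) operator_algebra \<Phi>"
    unfolding star_hom_def
  proof (intro conjI ring_hom_memI allI ballI)
  qed (auto simp: continuous_functions_def \<Phi>_def restrict op const mult add star scalar_op_simps)
  moreover have "\<Phi> (\<lambda>z\<in>K. z) = encode_op (orbit_diagonal (\<lambda>z. z) \<xi>)"
    "encode_op (orbit_diagonal f \<xi>) = \<Phi> (restrict f K)"
    by (simp_all add: \<Phi>_def restrict)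
  ultimately show ?thesis
    unfolding continuous_calculus_def K_def by blast
qed

text \<open>The weight at the target index \<open>i\<close> is taken at the source index
  \<open>i - 1\<close>. Thus the adjoint times the shift is the diagonal of \<gamma>, and the
  product in the other order is the same diagonal moved by one step.\<close>

definition orbit_shift :: "(complex \<Rightarrow> real) \<Rightarrow> complex \<Rightarrow> (ell2 \<Rightarrow>\<^sub>L ell2)" where
  "orbit_shift \<gamma> \<xi> = weighted_shift 1 (\<lambda>i. complex_of_real (sqrt (\<gamma> (\<mu> powi (i - 1) * \<xi>))))"

lemma exp_eq_mu: "exp (- 2 * pi * \<i> * \<theta>) = inverse \<mu>"
  unfolding \<mu>_def cis_conv_exp exp_minus[symmetric] by (simp add: algebra_simps)

lemma bounded_weights_orbit_shift:
  assumes "continuous_on unit_circle \<gamma>" "\<xi> \<in> unit_circle"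
  shows "bounded_weights (\<lambda>i. complex_of_real (sqrt (\<gamma> (\<mu> powi (i - 1) * \<xi>))))"
proof -
  have "continuous_on unit_circle (\<lambda>z. complex_of_real (sqrt (\<gamma> z)))"
    using assms(1) by (intro continuous_intros)
  from bounded_weights_orbit[OF this assms(2)] show ?thesis
    unfolding bounded_weights_def by blast
qed

text \<open>The shift times its adjoint is the diagonal of \<gamma> along the orbit of
  \<open>inverse \<mu> * \<xi>\<close>. On that orbit the identity function gives
  \<open>inverse \<mu>\<close> times the image of w, so both calculus relations are instances of
  \<open>orbit_calculus\<close>, at two different base points.\<close>

lemma rotation_relations_orbit:
  assumes \<gamma>: "continuous_on unit_circle \<gamma>" "\<forall>z\<in>unit_circle. 0 \<le> \<gamma> z" and \<xi>: "\<xi> \<in> unit_circle"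
  shows "rotation_relations \<theta> \<gamma> operator_algebra
    (encode_op (orbit_shift \<gamma> \<xi>)) (encode_op (orbit_diagonal (\<lambda>z. z) \<xi>))"
proof -
  let ?W = "orbit_diagonal (\<lambda>z. z) \<xi>" and ?X = "orbit_shift \<gamma> \<xi>"
  have W: "complex_op ?W" by (intro complex_op_orbit_diagonal \<xi> continuous_on_id)
  have bX: "bounded_weights (\<lambda>i. complex_of_real (sqrt (\<gamma> (\<mu> powi (i - 1) * \<xi>))))"
    by (rule bounded_weights_orbit_shift[OF \<gamma>(1) \<xi>])
  have X: "complex_op ?X"
    unfolding orbit_shift_def by (rule complex_op_weighted_shift[OF bX])
  have bW: "bounded_weights (\<lambda>k. \<mu> powi k * \<xi>)"
    using bounded_weights_orbit[OF continuous_on_id \<xi>] by simp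
  have g: "continuous_on unit_circle (\<lambda>z. complex_of_real (\<gamma> z))"
    using \<gamma>(1) by (intro continuous_intros)
  have \<gamma>_pos: "0 \<le> \<gamma> (\<mu> powi k * \<xi>)" for k
    using \<gamma>(2) orbit_circle[OF \<xi>] by blast
  have unit: "cnj (\<mu> powi k * \<xi>) * (\<mu> powi k * \<xi>) = 1" for k
    using orbit_circle[OF \<xi>, of k] complex_norm_square[of "\<mu> powi k * \<xi>"]
    by (simp add: mult.commute)
  have unit': "(\<mu> powi k * \<xi>) * cnj (\<mu> powi k * \<xi>) = 1" for k
    using unit[of k] by (simp add: mult.commute)
  have shift: "\<mu> powi (k - 1) * \<xi> = \<mu> powi k * (inverse \<mu> * \<xi>)" for k
    by (simp add: power_int_diff divide_inverse)
  have \<xi>': "inverse \<mu> * \<xi> \<in> unit_circle" using \<xi> by (simp add: norm_mult norm_inverse)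
  note coord_W = coord_orbit_diagonal[OF continuous_on_id \<xi>]
    and coord_W' = coord_orbit_diagonal[OF continuous_on_id \<xi>']
  have "adjoint_op ?W o\<^sub>L ?W = id_blinfun" "?W o\<^sub>L adjoint_op ?W = id_blinfun"
    unfolding orbit_diagonal_def adjoint_weighted_shift[OF bW]
      weighted_shift_compose[OF bounded_weights_cnj[OF bW] bW]
      weighted_shift_compose[OF bW bounded_weights_cnj[OF bW]]
    by (simp_all add: unit unit' weighted_shift_id del: complex_cnj_mult)
  moreover have "adjoint_op ?X o\<^sub>L ?X = orbit_diagonal (\<lambda>z. complex_of_real (\<gamma> z)) \<xi>"
    unfolding orbit_shift_def adjoint_weighted_shift[OF bX] orbit_diagonal_def
      weighted_shift_compose[OF bounded_weights_cnj[OF bX] bX]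
    by (simp add: \<gamma>_pos flip: of_real_mult)
  moreover have "?X o\<^sub>L adjoint_op ?X = orbit_diagonal (\<lambda>z. complex_of_real (\<gamma> z)) (inverse \<mu> * \<xi>)"
    unfolding orbit_shift_def adjoint_weighted_shift[OF bX] orbit_diagonal_def
      weighted_shift_compose[OF bX bounded_weights_cnj[OF bX]]
    by (simp add: \<gamma>_pos flip: of_real_mult shift)
  moreover have "scalar_op (inverse \<mu>) o\<^sub>L ?W = orbit_diagonal (\<lambda>z. z) (inverse \<mu> * \<xi>)"
    by (rule blinfun_eqI, rule ell2_eqI)
       (simp add: coord_W coord_W')
  moreover have coord_X: "coord (?X u) i = complex_of_real (sqrt (\<gamma> (\<mu> powi (i - 1) * \<xi>))) * coord u (i - 1)" for u i
    unfolding orbit_shift_def by (rule coord_weighted_shift[OF bX])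
  moreover have "?X o\<^sub>L ?W = scalar_op (inverse \<mu>) o\<^sub>L (?W o\<^sub>L ?X)"
    by (rule blinfun_eqI, rule ell2_eqI)
       (simp add: coord_W coord_X power_int_diff divide_inverse)
  ultimately show ?thesis
    unfolding rotation_relations_def exp_eq_mu
    using W X orbit_calculus[OF g \<xi>] orbit_calculus[OF g \<xi>'] by (simp add: complex_op_adjoint)
qed

end

text \<open>The values are operators rather than their codes, which keeps the encoding out of all
  later arguments. Norm bounds come from \<open>norm_rep_unit_vector_le\<close>.\<close>

locale representation = unital_cstar_algebra A for A :: "('a, 'm) cstar_scheme" (structure) +
  fixes M :: "'a \<Rightarrow> ell2 \<Rightarrow>\<^sub>L ell2"
  assumes rep_complex_op: "a \<in> carrier A \<Longrightarrow> complex_op (M a)"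
    and rep_add: "a \<in> carrier A \<Longrightarrow> b \<in> carrier A \<Longrightarrow> M (a \<oplus> b) = M a + M b"
    and rep_mult: "a \<in> carrier A \<Longrightarrow> b \<in> carrier A \<Longrightarrow> M (a \<otimes> b) = M a o\<^sub>L M b"
    and rep_smult: "a \<in> carrier A \<Longrightarrow> M (c \<odot> a) = scalar_op c o\<^sub>L M a"
    and rep_one: "M \<one> = id_blinfun"
    and rep_star: "a \<in> carrier A \<Longrightarrow> M (star A a) = adjoint_op (M a)"

lemma (in irrational_rotation) orbit_representation:
  assumes A: "universal_rotation_algebra \<theta> \<gamma> A x w"
    and \<gamma>: "continuous_on unit_circle \<gamma>" "\<forall>z\<in>unit_circle. 0 \<le> \<gamma> z" and \<xi>: "\<xi> \<in> unit_circle"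
  obtains M where "representation A M" "M x = orbit_shift \<gamma> \<xi>" "M w = orbit_diagonal (\<lambda>z. z) \<xi>"
proof -
  let ?x = "encode_op (orbit_shift \<gamma> \<xi>)" and ?w = "encode_op (orbit_diagonal (\<lambda>z. z) \<xi>)"
  obtain h where h: "star_hom A operator_algebra h" "h x = ?x" "h w = ?w"
    using A operator_algebra_cstar rotation_relations_orbit[OF \<gamma> \<xi>]
    unfolding universal_rotation_algebra_def by blast
  interpret unital_cstar_algebra A
    using A unfolding universal_rotation_algebra_def by blast
  have hom: "h \<in> ring_hom A operator_algebra"
    and smult: "\<And>c a. a \<in> carrier A \<Longrightarrow> h (c \<odot>\<^bsub>A\<^esub> a) = c \<odot>\<^bsub>operator_algebra\<^esub> h a"
    and star: "\<And>a. a \<in> carrier A \<Longrightarrow> h (star A a) = star operator_algebra (h a)"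
    using h(1) unfolding star_hom_def by auto
  have dec: "complex_op (decode_op (h a)) \<and> h a = encode_op (decode_op (h a))" if "a \<in> carrier A" for a
    using ring_hom_closed[OF hom that] by auto
  have "representation A (\<lambda>a. decode_op (h a))"
  proof
    fix a assume a: "a \<in> carrier A"
    show "complex_op (decode_op (h a))" using dec[OF a] by blast
    show "decode_op (h (c \<odot>\<^bsub>A\<^esub> a)) = scalar_op c o\<^sub>L decode_op (h a)" for c
      using dec[OF a] smult[OF a, of c]
      by (metis complex_op_compose(1) complex_op_scalar_op decode_encode operator_algebra_simps(6))
    show "decode_op (h (star A a)) = adjoint_op (decode_op (h a))"
      using dec[OF a] star[OF a]
      by (metis complex_op_adjoint decode_encode operator_algebra_simps(7))
    fix b assume b: "b \<in> carrier A"
    show "decode_op (h (a \<oplus>\<^bsub>A\<^esub> b)) = decode_op (h a) + decode_op (h b)"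
      using dec[OF a] dec[OF b] ring_hom_add[OF hom a b]
      by (metis complex_op_add(1) decode_encode operator_algebra_simps(5))
    show "decode_op (h (a \<otimes>\<^bsub>A\<^esub> b)) = decode_op (h a) o\<^sub>L decode_op (h b)"
      using dec[OF a] dec[OF b] ring_hom_mult[OF hom a b]
      by (metis complex_op_compose(1) decode_encode operator_algebra_simps(4))
  next
    show "decode_op (h \<one>\<^bsub>A\<^esub>) = id_blinfun"
      using ring_hom_one[OF hom] by simp
  qed
  moreover have "complex_op (orbit_shift \<gamma> \<xi>)"
    unfolding orbit_shift_def by (intro complex_op_weighted_shift bounded_weights_orbit_shift \<gamma> \<xi>)
  moreover have "complex_op (orbit_diagonal (\<lambda>z. z) \<xi>)"
    by (intro complex_op_orbit_diagonal \<xi> continuous_on_id)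
  ultimately show thesis
    using that[of "\<lambda>a. decode_op (h a)"] by (simp add: h)
qed

section \<open>Unital C*-algebras and positive functionals\<close>

lemma complex_field_uminus [simp]: "a_inv complex_field c = - c"
proof -
  interpret cring complex_field by (rule complex_field_cring)
  show ?thesis by (rule minus_equality) auto
qed

context unital_cstar_algebra
begin

lemma smult_closed' [simp, intro]: "a \<in> carrier A \<Longrightarrow> c \<odot> a \<in> carrier A"
  by (rule smult_closed) auto

lemma smult_add_left: "a \<in> carrier A \<Longrightarrow> (c + d) \<odot> a = c \<odot> a \<oplus> d \<odot> a"
  using smult_l_distr[of c d a] by simp

lemma smult_add_right: "a \<in> carrier A \<Longrightarrow> b \<in> carrier A \<Longrightarrow> c \<odot> (a \<oplus> b) = c \<odot> a \<oplus> c \<odot> b"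
  using smult_r_distr[of c a b] by simp

lemma smult_smult: "a \<in> carrier A \<Longrightarrow> c \<odot> (d \<odot> a) = (c * d) \<odot> a"
  using smult_assoc1[of c d a] by simp

lemma smult_1 [simp]: "a \<in> carrier A \<Longrightarrow> 1 \<odot> a = a"
  using smult_one[of a] by simp

lemma smult_0 [simp]: "a \<in> carrier A \<Longrightarrow> 0 \<odot> a = \<zero>"
  using smult_l_null[of a] by simp

lemma smult_zero [simp]: "c \<odot> \<zero> = \<zero>"
  using smult_r_null[of c] by simp

lemma smult_uminus_left: "a \<in> carrier A \<Longrightarrow> (- c) \<odot> a = \<ominus> (c \<odot> a)"
  using smult_l_minus[of c a] by simp

lemma smult_uminus_right: "a \<in> carrier A \<Longrightarrow> c \<odot> (\<ominus> a) = \<ominus> (c \<odot> a)"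
  using smult_r_minus[of c a] by simp

lemma smult_minus_right: "a \<in> carrier A \<Longrightarrow> b \<in> carrier A \<Longrightarrow> c \<odot> (a \<ominus> b) = c \<odot> a \<ominus> c \<odot> b"
  by (simp add: M.minus_eq smult_add_right smult_uminus_right)

lemma uminus_eq_smult: "a \<in> carrier A \<Longrightarrow> \<ominus> a = (- 1) \<odot> a"
  by (simp add: smult_uminus_left)

declare star_closed [simp, intro]

lemma star_zero [simp]: "star A \<zero> = \<zero>"
  using star_smult[of \<zero> 0] by simp

lemma star_one [simp]: "star A \<one> = \<one>"
proof -
  have "star A (star A \<one> \<otimes> \<one>) = star A \<one> \<otimes> star A (star A \<one>)"
    by (rule star_mult) auto
  then show ?thesis by (simp add: star_star)
qed

lemma star_uminus: "a \<in> carrier A \<Longrightarrow> star A (\<ominus> a) = \<ominus> star A a"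
  by (simp add: uminus_eq_smult star_smult)

lemma star_minus: "a \<in> carrier A \<Longrightarrow> b \<in> carrier A \<Longrightarrow> star A (a \<ominus> b) = star A a \<ominus> star A b"
  by (simp add: M.minus_eq star_add star_uminus)

lemma nrm_zero [simp]: "nrm A \<zero> = 0"
  by (simp add: nrm_eq_zero)

lemma nrm_uminus [simp]: "a \<in> carrier A \<Longrightarrow> nrm A (\<ominus> a) = nrm A a"
  by (simp add: uminus_eq_smult nrm_smult)

lemma nrm_minus_commute: "a \<in> carrier A \<Longrightarrow> b \<in> carrier A \<Longrightarrow> nrm A (a \<ominus> b) = nrm A (b \<ominus> a)"
  using nrm_uminus[of "a \<ominus> b"] by (simp add: M.minus_eq M.minus_add M.a_comm)

lemma minus_telescope:
  assumes "a \<in> carrier A" "b \<in> carrier A" "c \<in> carrier A"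
  shows "a \<ominus> c = (a \<ominus> b) \<oplus> (b \<ominus> c)"
  using assms by algebra

lemma nrm_triangle3:
  assumes "a \<in> carrier A" "b \<in> carrier A" "c \<in> carrier A"
  shows "nrm A (a \<ominus> c) \<le> nrm A (a \<ominus> b) + nrm A (b \<ominus> c)"
  unfolding minus_telescope[OF assms] using nrm_triangle[of "a \<ominus> b" "b \<ominus> c"] assms by simp

lemma minus_zero [simp]: "a \<in> carrier A \<Longrightarrow> a \<ominus> \<zero> = a"
  by (simp add: M.minus_eq)

lemma nrm_le_add_minus:
  assumes "a \<in> carrier A" "b \<in> carrier A" shows "nrm A a \<le> nrm A b + nrm A (a \<ominus> b)"
  using nrm_triangle3[of a b \<zero>] assms by simp

lemma minus_eq_zero_iff:
  assumes ab: "a \<in> carrier A" "b \<in> carrier A" shows "a \<ominus> b = \<zero> \<longleftrightarrow> a = b"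
proof
  assume "a \<ominus> b = \<zero>"
  have "a = (a \<ominus> b) \<oplus> b" using ab by algebra
  then show "a = b" using \<open>a \<ominus> b = \<zero>\<close> ab by simp
qed (simp add: M.minus_eq M.r_neg ab)

lemma eqI_nrm:
  assumes "a \<in> carrier A" "b \<in> carrier A" "\<And>e. 0 < e \<Longrightarrow> nrm A (a \<ominus> b) \<le> e"
  shows "a = b"
proof -
  have "nrm A (a \<ominus> b) \<le> 0" by (rule field_le_epsilon) (simp add: assms(3))
  then have "nrm A (a \<ominus> b) = 0" using nrm_nonneg[of "a \<ominus> b"] assms by simp
  then show ?thesis using assms by (simp add: nrm_eq_zero minus_eq_zero_iff)
qed

lemma nrm_star [simp]:
  assumes "a \<in> carrier A" shows "nrm A (star A a) = nrm A a"
proof -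
  have le: "nrm A b \<le> nrm A (star A b)" if b: "b \<in> carrier A" for b
  proof (cases "nrm A b = 0")
    case False
    have "nrm A b * nrm A b \<le> nrm A (star A b) * nrm A b"
      using nrm_mult[of "star A b" b] b by (simp add: cstar_identity power2_eq_square)
    then show ?thesis using False nrm_nonneg[OF b] by (simp add: mult_le_cancel_right)
  qed (simp add: nrm_nonneg b)
  show ?thesis using le[of a] le[of "star A a"] assms by (simp add: star_star)
qed

lemma nrm_one_le: "nrm A \<one> \<le> 1"
proof -
  have "nrm A \<one> * nrm A \<one> = nrm A \<one>"
    using cstar_identity[of \<one>] by (simp add: power2_eq_square)
  then show ?thesis by auto
qed

lemma nrm_unitary_le:
  assumes "u \<in> carrier A" "star A u \<otimes> u = \<one>" shows "nrm A u \<le> 1"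
proof -
  have "(nrm A u)\<^sup>2 \<le> 1\<^sup>2"
    using cstar_identity[OF assms(1)] assms(2) nrm_one_le by simp
  then show ?thesis by (rule power2_le_imp_le) simp
qed

lemma Metric_space: "Metric_space (carrier A) (cstar_dist A)"
  by (rule Metric_space_cstar_dist) (auto simp: nrm_nonneg nrm_eq_zero nrm_triangle M.abelian_group_axioms)

lemma norm_closed_iff:
  "norm_closed A S \<longleftrightarrow> S \<subseteq> carrier A \<and>
     (\<forall>a\<in>carrier A. (\<forall>e>0. \<exists>s\<in>S. nrm A (a \<ominus> s) < e) \<longrightarrow> a \<in> S)"
proof -
  interpret M: Metric_space "carrier A" "cstar_dist A" by (rule Metric_space)
  show ?thesis
    unfolding norm_closed_def M.closedin_metric
  proof (cases "S \<subseteq> carrier A")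
    case True
    have "disjnt S (M.mball a r) \<longleftrightarrow> \<not> (\<exists>s\<in>S. nrm A (a \<ominus> s) < r)" if "a \<in> carrier A" for a r
      using True that by (auto simp: disjnt_iff cstar_dist_def)
    then show "(S \<subseteq> carrier A \<and> (\<forall>x. x \<in> carrier A - S \<longrightarrow> (\<exists>r>0. disjnt S (M.mball x r)))) \<longleftrightarrow>
      (S \<subseteq> carrier A \<and> (\<forall>a\<in>carrier A. (\<forall>e>0. \<exists>s\<in>S. nrm A (a \<ominus> s) < e) \<longrightarrow> a \<in> S))"
      by simp blast
  qed simp
qed

lemma Cauchy_limit:
  assumes y: "\<And>n. y n \<in> carrier A"
    and Cauchy: "\<And>e. 0 < e \<Longrightarrow> \<exists>N. \<forall>m\<ge>N. \<forall>n\<ge>N. nrm A (y m \<ominus> y n) < e"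
  obtains l where "l \<in> carrier A" "(\<lambda>n. nrm A (y n \<ominus> l)) \<longlonglongrightarrow> 0"
proof -
  interpret M: Metric_space "carrier A" "cstar_dist A" by (rule Metric_space)
  have "M.MCauchy y"
    unfolding M.MCauchy_def using y Cauchy by (auto simp: cstar_dist_def)
  then obtain l where l: "limitin M.mtopology y l sequentially"
    using complete unfolding M.mcomplete_def by blast
  then have lA: "l \<in> carrier A" and
    lim: "\<And>e. 0 < e \<Longrightarrow> \<exists>N. \<forall>n\<ge>N. cstar_dist A (y n) l < e"
    unfolding M.limit_metric_sequentially by blast+
  have "(\<lambda>n. nrm A (y n \<ominus> l)) \<longlonglongrightarrow> 0"
    unfolding lim_sequentially using lim lA y by (simp add: dist_real_def cstar_dist_def nrm_nonneg)
  with lA show thesis by (rule that)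
qed

lemma nrm_smult_minus_smult: "a \<in> carrier A \<Longrightarrow> nrm A (s \<odot> a \<ominus> t \<odot> a) = cmod (s - t) * nrm A a"
proof -
  assume a: "a \<in> carrier A"
  have "s \<odot> a \<ominus> t \<odot> a = (s + - t) \<odot> a"
    unfolding smult_add_left[OF a] smult_uminus_left[OF a] by (simp add: M.minus_eq)
  then show ?thesis using a by (simp add: nrm_smult)
qed

lemma nrm_add_minus_add_le:
  assumes "a \<in> carrier A" "b \<in> carrier A" "c \<in> carrier A" "d \<in> carrier A"
  shows "nrm A ((a \<oplus> b) \<ominus> (c \<oplus> d)) \<le> nrm A (a \<ominus> c) + nrm A (b \<ominus> d)"
proof -
  have "(a \<oplus> b) \<ominus> (c \<oplus> d) = (a \<ominus> c) \<oplus> (b \<ominus> d)"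
    using assms by (simp add: M.minus_eq M.minus_add M.a_ac)
  then show ?thesis using nrm_triangle[of "a \<ominus> c" "b \<ominus> d"] assms by simp
qed

text \<open>A fixed point y of the map \<open>y \<mapsto> (h + y * y) / 2\<close> satisfies
  \<open>(1 - y) * (1 - y) = 1 - h\<close>. On the ball of radius \<open>nrm A h < 1\<close> this
  map is a contraction with that factor, and it preserves self-adjointness. Positivity of
  \<open>\<one> \<ominus> h\<close> in this form is the source of the norm bounds for positive
  functionals.\<close>

lemma selfadjoint_sqrt_one_minus:
  assumes h: "h \<in> carrier A" "star A h = h" "nrm A h < 1"
  obtains s where "s \<in> carrier A" "star A s = s" "s \<otimes> s = \<one> \<ominus> h"
proof -
  define r where "r = nrm A h"
  have r: "0 \<le> r" "r < 1" using h by (simp_all add: r_def nrm_nonneg)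
  define F where "F y = (1 / 2 :: complex) \<odot> (h \<oplus> y \<otimes> y)" for y
  have F [simp]: "y \<in> carrier A \<Longrightarrow> F y \<in> carrier A" for y
    using h(1) by (simp add: F_def)
  have F_diff: "nrm A (F y \<ominus> F z) \<le> (nrm A y + nrm A z) / 2 * nrm A (y \<ominus> z)"
    if yz: "y \<in> carrier A" "z \<in> carrier A" for y z
  proof -
    have "F y \<ominus> F z = (1 / 2 :: complex) \<odot> ((h \<oplus> y \<otimes> y) \<ominus> (h \<oplus> z \<otimes> z))"
      using h(1) yz by (simp add: F_def smult_minus_right)
    also have "(h \<oplus> y \<otimes> y) \<ominus> (h \<oplus> z \<otimes> z) = y \<otimes> (y \<ominus> z) \<oplus> (y \<ominus> z) \<otimes> z"
      using h(1) yz by algebra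
    finally have "nrm A (F y \<ominus> F z) = nrm A (y \<otimes> (y \<ominus> z) \<oplus> (y \<ominus> z) \<otimes> z) / 2"
      using yz by (simp add: nrm_smult)
    also have "nrm A (y \<otimes> (y \<ominus> z) \<oplus> (y \<ominus> z) \<otimes> z)
        \<le> nrm A y * nrm A (y \<ominus> z) + nrm A (y \<ominus> z) * nrm A z"
      using yz by (intro order_trans[OF nrm_triangle] add_mono nrm_mult) auto
    finally show ?thesis by (simp add: field_simps)
  qed
  define y where "y n = (F ^^ n) \<zero>" for n
  have y_0: "y 0 = \<zero>" by (simp add: y_def)
  have y_Suc: "y (Suc n) = F (y n)" for n by (simp add: y_def)
  have yA [simp]: "y n \<in> carrier A" for n
    by (induction n) (simp_all add: y_Suc, simp add: y_def)
  have y_norm: "nrm A (y n) \<le> r" for n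
  proof (induction n)
    case (Suc n)
    have "nrm A (y (Suc n)) = nrm A (h \<oplus> y n \<otimes> y n) / 2"
      using h(1) by (simp add: y_Suc F_def nrm_smult)
    also have "nrm A (h \<oplus> y n \<otimes> y n) \<le> r + nrm A (y n) * nrm A (y n)"
      unfolding r_def using h(1) by (intro order_trans[OF nrm_triangle] add_mono nrm_mult) auto
    also have "nrm A (y n) * nrm A (y n) \<le> r * 1"
      using Suc r nrm_nonneg[OF yA, of n] by (intro mult_mono) auto
    finally show ?case by simp
  qed (simp add: y_def r)
  have star_y: "star A (y n) = y n" for n
  proof (induction n)
    case (Suc n)
    then show ?case using h by (simp add: y_Suc F_def star_smult star_add star_mult)
  qed (simp add: y_def)
  \<comment> \<open>The factor \<open>(nrm A (y (n + k)) + nrm A (y n)) / 2\<close> from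
    \<open>F_diff\<close> is at most \<open>r\<close>. Treating all \<open>k\<close> at once gives
    the Cauchy property directly.\<close>
  have step: "nrm A (y (n + k) \<ominus> y n) \<le> r ^ n" for n k
  proof (induction n)
    case 0
    show ?case using y_norm[of k] r by (simp add: y_0)
  next
    case (Suc n)
    have "nrm A (y (Suc n + k) \<ominus> y (Suc n))
        \<le> (nrm A (y (n + k)) + nrm A (y n)) / 2 * nrm A (y (n + k) \<ominus> y n)"
      unfolding add_Suc y_Suc by (rule F_diff) auto
    also have "\<dots> \<le> r * r ^ n"
      using y_norm[of "n + k"] y_norm[of n] Suc r by (intro mult_mono) (auto simp: nrm_nonneg)
    finally show ?case by simp
  qed
  have tail: "\<exists>N. \<forall>m\<ge>N. \<forall>n\<ge>N. nrm A (y m \<ominus> y n) < e" if e: "0 < e" for e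
  proof -
    obtain N where N: "r ^ N < e"
      using real_arch_pow_inv[OF e r(2)] by blast
    have "nrm A (y m \<ominus> y n) < e" if "N \<le> n" "n \<le> m" for m n
    proof -
      have "nrm A (y m \<ominus> y n) \<le> r ^ n" using step[of n "m - n"] that by simp
      also have "\<dots> \<le> r ^ N" using that r by (intro power_decreasing) auto
      finally show ?thesis using N by simp
    qed
    then show ?thesis
      using nrm_minus_commute[OF yA yA] by (metis nat_le_linear)
  qed
  obtain l where l: "l \<in> carrier A" and lim: "(\<lambda>n. nrm A (y n \<ominus> l)) \<longlonglongrightarrow> 0"
    using Cauchy_limit[of y, OF yA tail] by blast
  have fixed: "l = F l"
  proof -
    have "nrm A (l \<ominus> F l) \<le> nrm A (y (Suc n) \<ominus> l) + (r + nrm A l) / 2 * nrm A (y n \<ominus> l)" for n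
    proof -
      have "nrm A (l \<ominus> F l) \<le> nrm A (l \<ominus> y (Suc n)) + nrm A (y (Suc n) \<ominus> F l)"
        using l by (intro nrm_triangle3) auto
      also have "nrm A (l \<ominus> y (Suc n)) = nrm A (y (Suc n) \<ominus> l)"
        using l by (intro nrm_minus_commute) auto
      also have "nrm A (y (Suc n) \<ominus> F l) \<le> (nrm A (y n) + nrm A l) / 2 * nrm A (y n \<ominus> l)"
        unfolding y_Suc using l by (intro F_diff) auto
      also have "\<dots> \<le> (r + nrm A l) / 2 * nrm A (y n \<ominus> l)"
        using y_norm[of n] l by (intro mult_right_mono) (auto simp: nrm_nonneg)
      finally show ?thesis by simp
    qed
    moreover have "(\<lambda>n. nrm A (y (Suc n) \<ominus> l) + (r + nrm A l) / 2 * nrm A (y n \<ominus> l)) \<longlonglongrightarrow> 0 + (r + nrm A l) / 2 * 0"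
      by (intro tendsto_intros lim LIMSEQ_Suc[OF lim])
    ultimately have "nrm A (l \<ominus> F l) \<le> 0"
      by (intro LIMSEQ_le_const[where X = "\<lambda>n. nrm A (y (Suc n) \<ominus> l) + (r + nrm A l) / 2 * nrm A (y n \<ominus> l)"]) auto
    then show ?thesis using l by (intro eqI_nrm) auto
  qed
  have star_l: "star A l = l"
  proof -
    have "nrm A (star A l \<ominus> l) \<le> nrm A (y n \<ominus> l) + nrm A (y n \<ominus> l)" for n
    proof -
      have "nrm A (star A l \<ominus> l) \<le> nrm A (star A l \<ominus> y n) + nrm A (y n \<ominus> l)"
        using l by (intro nrm_triangle3) auto
      also have "star A l \<ominus> y n = star A (l \<ominus> y n)"
        using l by (simp add: star_minus star_y)
      also have "nrm A (star A (l \<ominus> y n)) = nrm A (y n \<ominus> l)"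
        using l nrm_minus_commute[of l "y n"] by simp
      finally show ?thesis .
    qed
    moreover have "(\<lambda>n. nrm A (y n \<ominus> l) + nrm A (y n \<ominus> l)) \<longlonglongrightarrow> 0 + 0"
      by (intro tendsto_add lim)
    ultimately have "nrm A (star A l \<ominus> l) \<le> 0"
      by (intro LIMSEQ_le_const[where X = "\<lambda>n. nrm A (y n \<ominus> l) + nrm A (y n \<ominus> l)"]) auto
    then show ?thesis using l by (intro eqI_nrm) auto
  qed
  have "l \<oplus> l = 2 \<odot> F l"
    using fixed l smult_add_left[of l 1 1] by simp
  also have "\<dots> = h \<oplus> l \<otimes> l"
    using h(1) l by (simp add: F_def smult_smult)
  finally have double: "l \<oplus> l = h \<oplus> l \<otimes> l" .
  have "(\<one> \<ominus> l) \<otimes> (\<one> \<ominus> l) = \<one> \<ominus> (l \<oplus> l) \<oplus> l \<otimes> l"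
    using l by (simp add: M.minus_eq l_distr r_distr l_minus r_minus M.minus_add M.a_ac)
  also have "\<dots> = \<one> \<ominus> h"
    unfolding double using l h(1) by algebra
  finally show thesis
    using l star_l by (intro that[of "\<one> \<ominus> l"]) (auto simp: star_minus)
qed

end

section \<open>Positive functionals\<close>

locale positive_functional = unital_cstar_algebra A for A :: "('a, 'm) cstar_scheme" (structure) +
  fixes \<tau> :: "'a \<Rightarrow> complex"
  assumes fun_add: "a \<in> carrier A \<Longrightarrow> b \<in> carrier A \<Longrightarrow> \<tau> (a \<oplus> b) = \<tau> a + \<tau> b"
    and fun_smult: "a \<in> carrier A \<Longrightarrow> \<tau> (c \<odot> a) = c * \<tau> a"
    and fun_positive: "a \<in> carrier A \<Longrightarrow> \<tau> (star A a \<otimes> a) \<in> \<real>\<^sub>\<ge>\<^sub>0"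
begin

lemma fun_uminus: "a \<in> carrier A \<Longrightarrow> \<tau> (\<ominus> a) = - \<tau> a"
  by (simp add: uminus_eq_smult fun_smult)

lemma fun_minus: "a \<in> carrier A \<Longrightarrow> b \<in> carrier A \<Longrightarrow> \<tau> (a \<ominus> b) = \<tau> a - \<tau> b"
  by (simp add: M.minus_eq fun_add fun_uminus)

lemma fun_positive_Re: "a \<in> carrier A \<Longrightarrow> 0 \<le> Re (\<tau> (star A a \<otimes> a))"
  and fun_positive_Im: "a \<in> carrier A \<Longrightarrow> Im (\<tau> (star A a \<otimes> a)) = 0"
  using fun_positive[of a] by (auto simp: complex_nonneg_Reals_iff)

lemma fun_one: "0 \<le> Re (\<tau> \<one>)" "Im (\<tau> \<one>) = 0"
  using fun_positive_Re[of \<one>] fun_positive_Im[of \<one>] by auto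

lemma fun_expand:
  assumes "a \<in> carrier A" "b \<in> carrier A"
  shows "\<tau> (star A (a \<oplus> c \<odot> b) \<otimes> (a \<oplus> c \<odot> b)) =
    \<tau> (star A a \<otimes> a) + c * \<tau> (star A a \<otimes> b) + cnj c * \<tau> (star A b \<otimes> a) + cnj c * c * \<tau> (star A b \<otimes> b)"
proof -
  have "star A (a \<oplus> c \<odot> b) \<otimes> (a \<oplus> c \<odot> b) =
     (star A a \<otimes> a \<oplus> c \<odot> (star A a \<otimes> b)) \<oplus> (cnj c \<odot> (star A b \<otimes> a) \<oplus> cnj c \<odot> (c \<odot> (star A b \<otimes> b)))"
    using assms
    by (simp add: star_add star_smult l_distr r_distr smult_mult_left smult_mult_right smult_add_right
        smult_smult mult.commute M.a_ac)
  then show ?thesis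
    using assms by (simp add: fun_add fun_smult)
qed

text \<open>Polarisation: the functional is real at \<open>star A (a \<oplus> c \<odot> b) \<otimes>
  (a \<oplus> c \<odot> b)\<close>, and the choices \<open>c = 1\<close> and \<open>c = \<i>\<close>
  yield the imaginary and the real part of the claim.\<close>

lemma fun_star_mult:
  assumes "a \<in> carrier A" "b \<in> carrier A"
  shows "\<tau> (star A b \<otimes> a) = cnj (\<tau> (star A a \<otimes> b))"
proof -
  have *: "Im (\<tau> (star A (a \<oplus> c \<odot> b) \<otimes> (a \<oplus> c \<odot> b))) = 0" for c
    using assms by (intro fun_positive_Im) auto
  have "Im (\<tau> (star A a \<otimes> b)) + Im (\<tau> (star A b \<otimes> a)) = 0"
    using *[of 1] fun_positive_Im[OF assms(1)] fun_positive_Im[OF assms(2)]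
    unfolding fun_expand[OF assms] by simp
  moreover have "Re (\<tau> (star A a \<otimes> b)) - Re (\<tau> (star A b \<otimes> a)) = 0"
    using *[of \<i>] fun_positive_Im[OF assms(1)] fun_positive_Im[OF assms(2)]
    unfolding fun_expand[OF assms] by simp
  ultimately show ?thesis by (simp add: complex_eq_iff)
qed

lemma fun_star:
  assumes "a \<in> carrier A" shows "\<tau> (star A a) = cnj (\<tau> a)"
  using fun_star_mult[of \<one> a] assms by simp

lemma Cauchy_Schwarz:
  assumes "a \<in> carrier A" "b \<in> carrier A"
  shows "(cmod (\<tau> (star A a \<otimes> b)))\<^sup>2 \<le> Re (\<tau> (star A a \<otimes> a)) * Re (\<tau> (star A b \<otimes> b))"
proof -
  let ?z = "\<tau> (star A a \<otimes> b)"
  define P Q where "P = Re (\<tau> (star A a \<otimes> a))" and "Q = Re (\<tau> (star A b \<otimes> b))"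
  have PQ: "0 \<le> P" "0 \<le> Q" using assms by (simp_all add: P_def Q_def fun_positive_Re)
  \<comment> \<open>With the coefficient \<open>- t * cnj ?z\<close> both mixed terms become the
    real number \<open>- t * (cmod ?z)\<^sup>2\<close>.\<close>
  have quad: "0 \<le> P - 2 * t * (cmod ?z)\<^sup>2 + t\<^sup>2 * (cmod ?z)\<^sup>2 * Q" for t :: real
  proof -
    let ?c = "complex_of_real (- t) * cnj ?z"
    have "0 \<le> Re (\<tau> (star A (a \<oplus> ?c \<odot> b) \<otimes> (a \<oplus> ?c \<odot> b)))"
      using assms by (intro fun_positive_Re) auto
    also have "\<dots> = P - 2 * t * (cmod ?z)\<^sup>2 + t\<^sup>2 * (cmod ?z)\<^sup>2 * Q"
      unfolding fun_expand[OF assms] fun_star_mult[OF assms] P_def Q_def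
      using fun_positive_Im[OF assms(2)]
      by (simp add: cmod_power2) (simp add: power2_eq_square algebra_simps)
    finally show ?thesis .
  qed
  have "(cmod ?z)\<^sup>2 \<le> P * Q"
  proof (cases "Q = 0")
    case True
    have "(cmod ?z)\<^sup>2 = 0"
    proof (rule ccontr)
      assume "(cmod ?z)\<^sup>2 \<noteq> 0"
      \<comment> \<open>This \<open>t\<close> makes the right-hand side of \<open>quad\<close> equal
        to \<open>- P - 2\<close>.\<close>
      then show False using quad[of "(P + 1) / (cmod ?z)\<^sup>2"] True PQ by simp
    qed
    then show ?thesis using True by simp
  next
    case False
    then show ?thesis using quad[of "1 / Q"] PQ by (simp add: power2_eq_square field_simps)
  qed
  then show ?thesis by (simp add: P_def Q_def)
qed

text \<open>For \<open>t\<close> above the norm of \<open>h\<close>, \<one> minus \<open>h\<close>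
  divided by \<open>t\<close> is the square of a self-adjoint element, so the functional is
  non-negative there. Then \<open>t\<close> is lowered to the norm.\<close>

lemma fun_selfadjoint_le:
  assumes h: "h \<in> carrier A" "star A h = h"
  shows "Re (\<tau> h) \<le> nrm A h * Re (\<tau> \<one>)"
proof -
  have bound: "Re (\<tau> h) \<le> t * Re (\<tau> \<one>)" if t: "nrm A h < t" for t
  proof -
    have "0 < t" using t nrm_nonneg[OF h(1)] by simp
    let ?g = "complex_of_real (1 / t) \<odot> h"
    have "nrm A ?g < 1"
      using t \<open>0 < t\<close> h(1) by (simp add: nrm_smult norm_divide)
    then obtain s where s: "s \<in> carrier A" "star A s = s" "s \<otimes> s = \<one> \<ominus> ?g"
      using selfadjoint_sqrt_one_minus[of ?g] h by (auto simp: star_smult)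
    have "0 \<le> Re (\<tau> (\<one> \<ominus> ?g))"
      using fun_positive_Re[OF s(1)] s by simp
    then show ?thesis
      using h(1) \<open>0 < t\<close> by (simp add: fun_minus fun_smult field_simps)
  qed
  show ?thesis
  proof (rule field_le_epsilon)
    fix e :: real assume "0 < e"
    \<comment> \<open>The added 1 guards against a functional that vanishes at \<one>.\<close>
    let ?d = "e / (Re (\<tau> \<one>) + 1)"
    have pos: "0 < Re (\<tau> \<one>) + 1" using fun_one by simp
    have "Re (\<tau> h) \<le> (nrm A h + ?d) * Re (\<tau> \<one>)"
      using \<open>0 < e\<close> pos by (intro bound) simp
    also have "\<dots> = nrm A h * Re (\<tau> \<one>) + e * (Re (\<tau> \<one>) / (Re (\<tau> \<one>) + 1))"
      by (simp add: algebra_simps)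
    also have "\<dots> \<le> nrm A h * Re (\<tau> \<one>) + e * 1"
      using \<open>0 < e\<close> pos by (intro add_left_mono mult_left_mono) (auto simp: divide_le_eq)
    finally show "Re (\<tau> h) \<le> nrm A h * Re (\<tau> \<one>) + e" by simp
  qed
qed

lemma fun_star_mult_le:
  assumes "a \<in> carrier A" shows "Re (\<tau> (star A a \<otimes> a)) \<le> (nrm A a)\<^sup>2 * Re (\<tau> \<one>)"
  using fun_selfadjoint_le[of "star A a \<otimes> a"] assms by (simp add: star_mult star_star cstar_identity)

lemma fun_bounded:
  assumes "a \<in> carrier A" shows "cmod (\<tau> a) \<le> nrm A a * Re (\<tau> \<one>)"
proof (rule power2_le_imp_le)
  have "(cmod (\<tau> a))\<^sup>2 \<le> Re (\<tau> \<one>) * Re (\<tau> (star A a \<otimes> a))"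
    using Cauchy_Schwarz[of \<one> a] assms by simp
  also have "\<dots> \<le> Re (\<tau> \<one>) * ((nrm A a)\<^sup>2 * Re (\<tau> \<one>))"
    using fun_one by (intro mult_left_mono fun_star_mult_le assms)
  also have "\<dots> = (nrm A a * Re (\<tau> \<one>))\<^sup>2" by (simp add: power2_eq_square)
  finally show "(cmod (\<tau> a))\<^sup>2 \<le> (nrm A a * Re (\<tau> \<one>))\<^sup>2" .
qed (use assms fun_one in \<open>simp add: nrm_nonneg\<close>)

end

lemma (in unital_cstar_algebra) tracial_state_iff:
  "tracial_state A \<tau> \<longleftrightarrow> positive_functional A \<tau> \<and> \<tau> \<one> = 1 \<and>
     (\<forall>a\<in>carrier A. \<forall>b\<in>carrier A. \<tau> (a \<otimes> b) = \<tau> (b \<otimes> a))"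
proof -
  have "unital_cstar_algebra A" by unfold_locales
  then show ?thesis
    unfolding tracial_state_def positive_functional_def positive_functional_axioms_def by blast
qed

section \<open>Traces and their null ideals\<close>

locale trace = positive_functional +
  assumes trace_one: "\<tau> \<one> = 1"
    and trace_commute: "a \<in> carrier A \<Longrightarrow> b \<in> carrier A \<Longrightarrow> \<tau> (a \<otimes> b) = \<tau> (b \<otimes> a)"
begin

lemma trace_bounded: "a \<in> carrier A \<Longrightarrow> cmod (\<tau> a) \<le> nrm A a"
  using fun_bounded[of a] by (simp add: trace_one)

text \<open>For fixed \<open>a\<close>, compressing by \<open>a\<close> gives another positive
  functional, whose value at \<one> is \<open>\<tau> (star A a \<otimes> a)\<close>. The general
  bound for positive functionals, applied to it at \<open>b\<close>, is the claim.\<close>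

lemma trace_weighted:
  assumes "a \<in> carrier A" "b \<in> carrier A"
  shows "Re (\<tau> (star A (b \<otimes> a) \<otimes> (b \<otimes> a))) \<le> (nrm A b)\<^sup>2 * Re (\<tau> (star A a \<otimes> a))"
proof -
  interpret a: positive_functional A "\<lambda>c. \<tau> (star A a \<otimes> c \<otimes> a)"
  proof
    fix c d assume cd: "c \<in> carrier A" "d \<in> carrier A"
    show "\<tau> (star A a \<otimes> (c \<oplus> d) \<otimes> a) = \<tau> (star A a \<otimes> c \<otimes> a) + \<tau> (star A a \<otimes> d \<otimes> a)"
      using assms(1) cd by (simp add: l_distr r_distr fun_add)
  next
    fix c assume c: "c \<in> carrier A"
    show "\<tau> (star A a \<otimes> (z \<odot> c) \<otimes> a) = z * \<tau> (star A a \<otimes> c \<otimes> a)" for z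
      using assms(1) c by (simp add: smult_mult_left smult_mult_right fun_smult)
    show "\<tau> (star A a \<otimes> (star A c \<otimes> c) \<otimes> a) \<in> \<real>\<^sub>\<ge>\<^sub>0"
      using fun_positive[of "c \<otimes> a"] assms(1) c by (simp add: star_mult m_assoc)
  qed
  show ?thesis
    using a.fun_star_mult_le[OF assms(2)] assms by (simp add: star_mult m_assoc)
qed

text \<open>The bound \<open>trace_weighted\<close> makes the null space a left ideal,
  Cauchy-Schwarz makes it additive, and the trace property makes it invariant under
  \<open>star A\<close>, hence two-sided.\<close>

lemma trace_kernel_ideal: "ideal {a \<in> carrier A. \<tau> (star A a \<otimes> a) = 0} A" (is "ideal ?I A")
proof -
  have mem: "a \<in> ?I \<longleftrightarrow> a \<in> carrier A \<and> Re (\<tau> (star A a \<otimes> a)) \<le> 0" for a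
    using fun_positive_Re[of a] fun_positive_Im[of a] by (auto simp: complex_eq_iff)
  have left: "b \<otimes> a \<in> ?I" if "a \<in> ?I" "b \<in> carrier A" for a b
    unfolding mem[of "b \<otimes> a"] using trace_weighted[of a b] that by auto
  have star: "star A a \<in> ?I" if "a \<in> ?I" for a
    using that trace_commute[of "star A a" a] by (simp add: star_star)
  show ?thesis
  proof (rule idealI)
    show "subgroup ?I (add_monoid A)"
    proof (rule add.subgroupI)
      show "?I \<noteq> {}" using fun_smult[of \<zero> 0] by (auto intro!: exI[of _ \<zero>])
      show "\<ominus> a \<in> ?I" if "a \<in> ?I" for a
        using left[OF that, of "\<ominus> \<one>"] that by (simp add: l_minus)
      fix a b assume ab: "a \<in> ?I" "b \<in> ?I"
      have "\<tau> (star A a \<otimes> b) = 0"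
        using Cauchy_Schwarz[of a b] ab by simp
      then have "\<tau> (star A (a \<oplus> 1 \<odot> b) \<otimes> (a \<oplus> 1 \<odot> b)) = 0"
        using ab fun_expand[of a b 1] fun_star_mult[of a b] by simp
      then show "a \<oplus> b \<in> ?I" using ab by simp
    qed auto
    show "b \<otimes> a \<in> ?I" if "a \<in> ?I" "b \<in> carrier A" for a b by (rule left[OF that])
    show "a \<otimes> b \<in> ?I" if "a \<in> ?I" "b \<in> carrier A" for a b
      using star[OF left[OF star[OF that(1)], of "star A b"]] that by (simp add: star_mult star_star)
  qed unfold_locales
qed

text \<open>For \<open>s\<close> in the null space Cauchy-Schwarz gives
  \<open>\<tau> (star A a \<otimes> s) = 0\<close>, so \<open>\<tau> (star A a \<otimes> a)\<close>
  equals \<open>\<tau> (star A a \<otimes> (a \<ominus> s))\<close>, which is small with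
  \<open>a \<ominus> s\<close>.\<close>

lemma trace_kernel_closed: "norm_closed A {a \<in> carrier A. \<tau> (star A a \<otimes> a) = 0}"
  unfolding norm_closed_iff
proof (intro conjI ballI impI CollectI)
  fix a assume a: "a \<in> carrier A"
    and approx: "\<forall>e>0. \<exists>s\<in>{a \<in> carrier A. \<tau> (star A a \<otimes> a) = 0}. nrm A (a \<ominus> s) < e"
  have small: "cmod (\<tau> (star A a \<otimes> a)) \<le> e" if "0 < e" for e
  proof -
    have pos: "0 < nrm A a + 1" using nrm_nonneg[OF a] by simp
    then obtain s where s: "s \<in> carrier A" "\<tau> (star A s \<otimes> s) = 0" "nrm A (a \<ominus> s) < e / (nrm A a + 1)"
      using approx[rule_format, of "e / (nrm A a + 1)"] \<open>0 < e\<close> by auto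
    have "\<tau> (star A a \<otimes> s) = 0"
      using Cauchy_Schwarz[of a s] a s by simp
    then have "\<tau> (star A a \<otimes> a) = \<tau> (star A a \<otimes> (a \<ominus> s))"
      using a s by (simp add: M.minus_eq r_distr r_minus fun_add fun_uminus)
    also have "cmod \<dots> \<le> nrm A (star A a \<otimes> (a \<ominus> s))"
      using a s by (intro trace_bounded) auto
    also have "\<dots> \<le> nrm A a * nrm A (a \<ominus> s)"
      using nrm_mult[of "star A a" "a \<ominus> s"] a s by simp
    also have "\<dots> \<le> (nrm A a + 1) * (e / (nrm A a + 1))"
      using a s nrm_nonneg[of a] nrm_nonneg[of "a \<ominus> s"] by (intro mult_mono) auto
    also have "\<dots> = e" using pos by simp
    finally show ?thesis .
  qed
  have "cmod (\<tau> (star A a \<otimes> a)) \<le> 0" by (rule field_le_epsilon) (simp add: small)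
  then show "\<tau> (star A a \<otimes> a) = 0" by simp
qed auto

lemma trace_faithful_if_simple:
  assumes "simple_cstar A" "a \<in> carrier A" "\<tau> (star A a \<otimes> a) = 0"
  shows "a = \<zero>"
proof -
  have "\<one> \<notin> {a \<in> carrier A. \<tau> (star A a \<otimes> a) = 0}" by (simp add: trace_one)
  then show ?thesis
    using assms trace_kernel_ideal trace_kernel_closed unfolding simple_cstar_def by blast
qed

end

lemma (in unital_cstar_algebra) trace_iff: "trace A \<tau> \<longleftrightarrow> tracial_state A \<tau>"
  unfolding tracial_state_iff trace_def trace_axioms_def by blast

section \<open>Vector states of a representation\<close>

context representation
begin

text \<open>Testing against \<open>scalar_op c\<close> of the unit vector with \<open>c = 1\<close>
  gives the real part, which is the squared norm. With \<open>c = \<i>\<close> it gives the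
  imaginary part, which vanishes because multiplication by \<open>\<i>\<close> is
  skew-adjoint.\<close>

lemma coord_rep_star_mult:
  assumes "a \<in> carrier A"
  shows "coord (M (star A a \<otimes> a) (unit_vector k)) k = complex_of_real ((norm (M a (unit_vector k)))\<^sup>2)"
proof -
  let ?u = "M a (unit_vector k)"
  have "inner (M (star A a \<otimes> a) (unit_vector k)) (scalar_op c (unit_vector k)) = inner ?u (scalar_op c ?u)" for c
    using assms
    by (simp add: rep_mult rep_star rep_complex_op complex_op_adjoint inner_adjoint_op[of "adjoint_op (M a)"]
        adjoint_op_adjoint_op complex_op_scalar)
  then have *: "Re (cnj c * coord (M (star A a \<otimes> a) (unit_vector k)) k) = inner ?u (scalar_op c ?u)" for c
    by (simp only: inner_scalar_unit_vector)
  have "inner (scalar_op \<i> ?u) ?u = inner ?u (scalar_op (- 1 * \<i>) ?u)"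
    using inner_scalar_op[of \<i> ?u ?u] by simp
  also have "\<dots> = - inner ?u (scalar_op \<i> ?u)"
    unfolding scalar_op_simps(2) by (simp add: scalar_op_minus_one blinfun.minus_left)
  finally have "inner ?u (scalar_op \<i> ?u) = 0" by (simp add: inner_commute)
  with *[of \<i>] *[of 1] show ?thesis
    by (simp add: complex_eq_iff scalar_op_simps power2_norm_eq_inner)
qed

lemma rep_positive_functional: "positive_functional A (\<lambda>a. coord (M a (unit_vector k)) k)"
proof
  fix a assume a: "a \<in> carrier A"
  show "coord (M (star A a \<otimes> a) (unit_vector k)) k \<in> \<real>\<^sub>\<ge>\<^sub>0"
    unfolding coord_rep_star_mult[OF a] by (auto simp: complex_nonneg_Reals_iff)
qed (simp_all add: rep_add rep_smult blinfun.add_left)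

text \<open>The vector state has value 1 at \<one>, so the bound on positive functionals applies to
  \<open>star A a \<otimes> a\<close>. This ties the norm of \<open>A\<close> to its
  representations.\<close>

lemma norm_rep_unit_vector_le:
  assumes "a \<in> carrier A" shows "norm (M a (unit_vector k)) \<le> nrm A a"
proof -
  interpret k: positive_functional A "\<lambda>a. coord (M a (unit_vector k)) k"
    by (rule rep_positive_functional)
  have "(norm (M a (unit_vector k)))\<^sup>2 \<le> (nrm A a)\<^sup>2"
    using k.fun_star_mult_le[OF assms] unfolding coord_rep_star_mult[OF assms]
    by (simp add: rep_one coord_unit_vector)
  then show ?thesis by (rule power2_le_imp_le) (rule nrm_nonneg[OF assms])
qed

lemma coord_rep_le: "a \<in> carrier A \<Longrightarrow> cmod (coord (M a (unit_vector k)) j) \<le> nrm A a"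
  by (meson norm_coord_le norm_rep_unit_vector_le order_trans)

lemma rep_scalar:
  "a \<in> carrier A \<Longrightarrow> M a (scalar_op c u) = scalar_op c (M a u)"
  by (rule complex_op_scalar[OF rep_complex_op])

lemma rep_minus: "a \<in> carrier A \<Longrightarrow> b \<in> carrier A \<Longrightarrow> M (a \<ominus> b) = M a - M b"
  by (simp add: M.minus_eq uminus_eq_smult rep_add rep_smult scalar_op_minus_one)

end

section \<open>Functional calculus on the circle\<close>

text \<open>The Stone-Weierstrass theorem as an induction rule. Its limit case is also what relates
  functions that agree on the circle and differ elsewhere.\<close>

lemma circle_function_induct [consumes 1, case_names monom add limit]:
  assumes "continuous_on unit_circle f"
    and monom: "\<And>c k. P (\<lambda>z. c * z powi k)"
    and add: "\<And>f g. continuous_on unit_circle f \<Longrightarrow> continuous_on unit_circle g \<Longrightarrow> P f \<Longrightarrow> P g \<Longrightarrow> P (\<lambda>z. f z + g z)"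
    and limit: "\<And>f. continuous_on unit_circle f \<Longrightarrow>
      (\<And>e. 0 < e \<Longrightarrow> \<exists>g. continuous_on unit_circle g \<and> P g \<and> (\<forall>z\<in>unit_circle. cmod (f z - g z) \<le> e)) \<Longrightarrow> P f"
  shows "P f"
proof (rule limit[OF assms(1)])
  fix e :: real assume "0 < e"
  then obtain g where g: "laurent g" "\<And>z. z \<in> unit_circle \<Longrightarrow> cmod (f z - g z) < e"
    using laurent_dense[OF assms(1)] by blast
  have "P g" using g(1) by induction (auto intro: monom add laurent_continuous)
  then show "\<exists>g. continuous_on unit_circle g \<and> P g \<and> (\<forall>z\<in>unit_circle. cmod (f z - g z) \<le> e)"
    using g by (meson laurent_continuous less_imp_le)
qed

text \<open>Monomials are reached by repeated multiplication with z or its conjugate, so a property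
  of the functional calculus has to be checked only against the unitary and its adjoint. The
  conjugate stands for the inverse because it is continuous everywhere.\<close>

lemma circle_function_induct_mult [consumes 1, case_names const mult inverse add limit]:
  assumes "continuous_on unit_circle f"
    and const: "\<And>c. P (\<lambda>z. c)"
    and mult: "\<And>f. continuous_on unit_circle f \<Longrightarrow> P f \<Longrightarrow> P (\<lambda>z. z * f z)"
    and inverse: "\<And>f. continuous_on unit_circle f \<Longrightarrow> P f \<Longrightarrow> P (\<lambda>z. cnj z * f z)"
    and add: "\<And>f g. continuous_on unit_circle f \<Longrightarrow> continuous_on unit_circle g \<Longrightarrow> P f \<Longrightarrow> P g \<Longrightarrow> P (\<lambda>z. f z + g z)"
    and limit: "\<And>f. continuous_on unit_circle f \<Longrightarrow>
      (\<And>e. 0 < e \<Longrightarrow> \<exists>g. continuous_on unit_circle g \<and> P g \<and> (\<forall>z\<in>unit_circle. cmod (f z - g z) \<le> e)) \<Longrightarrow> P f"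
  shows "P f"
  using assms(1)
proof (induction rule: circle_function_induct)
  case (monom c k)
  have ind: "P (\<lambda>z. c * z ^ n)" "P (\<lambda>z. c * cnj z ^ n)" for n
  proof (induction n)
    case (Suc n)
    have "continuous_on unit_circle (\<lambda>z. c * z ^ n)" "continuous_on unit_circle (\<lambda>z. c * cnj z ^ n)"
      by (intro continuous_intros)+
    from mult[OF this(1) Suc(1)] inverse[OF this(2) Suc(2)]
    show "P (\<lambda>z. c * z ^ Suc n)" "P (\<lambda>z. c * cnj z ^ Suc n)" by (simp_all add: mult.left_commute)
  qed (use const in simp_all)
  have "\<exists>g. continuous_on unit_circle g \<and> P g \<and> (\<forall>z\<in>unit_circle. c * z powi k = g z)"
  proof (cases "0 \<le> k")
    case True
    then show ?thesis
      using ind(1)[of "nat k"] by (auto intro!: exI[of _ "\<lambda>z. c * z ^ nat k"] continuous_intros simp: power_int_def)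
  next
    case False
    have "inverse z = cnj z" if "z \<in> unit_circle" for z :: complex
      using that by (simp add: inverse_complex_def complex_eq_iff cmod_power2[symmetric])
    then show ?thesis
      using ind(2)[of "nat (- k)"] False
      by (auto intro!: exI[of _ "\<lambda>z. c * cnj z ^ nat (- k)"] continuous_intros simp: power_int_def)
  qed
  then obtain g where g: "continuous_on unit_circle g" "P g" "\<forall>z\<in>unit_circle. c * z powi k = g z" by blast
  show ?case
    \<comment> \<open>The predicate is not assumed to respect equality on the circle; the limit rule
      with \<open>g\<close> as its only approximation supplies this.\<close>
    by (rule limit) (use g in \<open>auto intro!: exI[of _ g] laurent_continuous laurent.monom\<close>)
qed (fact add limit)+

text \<open>Functions are total and are identified on the circle by \<open>calc_cong\<close>, so
  that plain function expressions can be used instead of extensional ones.\<close>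

locale circle_calculus = unital_cstar_algebra A for A :: "('a, 'm) cstar_scheme" (structure) +
  fixes \<Phi> :: "(complex \<Rightarrow> complex) \<Rightarrow> 'a" and u :: 'a
  assumes calc_cong: "(\<And>z. z \<in> unit_circle \<Longrightarrow> f z = g z) \<Longrightarrow> \<Phi> f = \<Phi> g"
    and calc_closed [simp, intro]: "continuous_on unit_circle f \<Longrightarrow> \<Phi> f \<in> carrier A"
    and calc_add: "continuous_on unit_circle f \<Longrightarrow> continuous_on unit_circle g \<Longrightarrow> \<Phi> (\<lambda>z. f z + g z) = \<Phi> f \<oplus> \<Phi> g"
    and calc_mult: "continuous_on unit_circle f \<Longrightarrow> continuous_on unit_circle g \<Longrightarrow> \<Phi> (\<lambda>z. f z * g z) = \<Phi> f \<otimes> \<Phi> g"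
    and calc_smult: "continuous_on unit_circle f \<Longrightarrow> \<Phi> (\<lambda>z. c * f z) = c \<odot> \<Phi> f"
    and calc_star: "continuous_on unit_circle f \<Longrightarrow> \<Phi> (\<lambda>z. cnj (f z)) = star A (\<Phi> f)"
    and calc_one: "\<Phi> (\<lambda>_. 1) = \<one>"
    and calc_id: "\<Phi> (\<lambda>z. z) = u"
begin

lemma calc_const: "\<Phi> (\<lambda>_. c) = c \<odot> \<one>"
  using calc_smult[of "\<lambda>_. 1" c] by (simp add: calc_one)

lemma calc_zero: "\<Phi> (\<lambda>_. 0) = \<zero>"
  using calc_const[of 0] by simp

lemma calc_minus:
  assumes "continuous_on unit_circle f" "continuous_on unit_circle g"
  shows "\<Phi> (\<lambda>z. f z - g z) = \<Phi> f \<ominus> \<Phi> g"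
proof -
  have "continuous_on unit_circle (\<lambda>z. (- 1) * g z)" by (intro continuous_intros assms)
  from calc_add[OF assms(1) this] calc_smult[OF assms(2), of "- 1"] show ?thesis
    using assms by (simp add: M.minus_eq uminus_eq_smult)
qed

lemma calc_le_1:
  assumes f: "continuous_on unit_circle f" "\<And>z. z \<in> unit_circle \<Longrightarrow> cmod (f z) \<le> 1"
  shows "nrm A (\<Phi> f) \<le> 1"
proof -
  have real: "nrm A (\<Phi> (\<lambda>z. complex_of_real (g z))) \<le> 1"
    if g: "continuous_on unit_circle g" "\<And>z. z \<in> unit_circle \<Longrightarrow> \<bar>g z\<bar> \<le> 1" for g
  proof -
    \<comment> \<open>\<open>g\<close> is the real part of a unimodular function, hence \<open>\<Phi> g\<close> is that of a unitary.\<close>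
    define v where "v z = Complex (g z) (sqrt (1 - (g z)\<^sup>2))" for z
    have v_eq: "v = (\<lambda>z. complex_of_real (g z) + \<i> * complex_of_real (sqrt (1 - (g z)\<^sup>2)))"
      by (auto simp: v_def complex_eq_iff)
    have v: "continuous_on unit_circle v" unfolding v_eq by (intro continuous_intros g)
    have cv: "continuous_on unit_circle (\<lambda>z. cnj (v z))" by (intro continuous_intros v)
    have unimodular: "cnj (v z) * v z = 1" if "z \<in> unit_circle" for z
    proof -
      have "(g z)\<^sup>2 \<le> 1" using g(2)[OF that] by (simp add: abs_square_le_1)
      then show ?thesis by (simp add: v_def complex_eq_iff power2_eq_square)
    qed
    have "star A (\<Phi> v) \<otimes> \<Phi> v = \<Phi> (\<lambda>z. cnj (v z) * v z)"
      by (simp add: calc_mult[OF cv v] calc_star[OF v])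
    also have "\<dots> = \<one>" unfolding calc_one[symmetric] by (rule calc_cong) (rule unimodular)
    finally have le: "nrm A (\<Phi> v) \<le> 1" by (intro nrm_unitary_le calc_closed v)
    have "\<Phi> (\<lambda>z. complex_of_real (g z)) = \<Phi> (\<lambda>z. (1 / 2) * (v z + cnj (v z)))"
      by (rule calc_cong) (simp add: v_def complex_eq_iff)
    also have "\<dots> = (1 / 2) \<odot> (\<Phi> v \<oplus> star A (\<Phi> v))"
      using v cv by (subst calc_smult) (auto intro!: continuous_intros simp: calc_add calc_star)
    also have "nrm A \<dots> \<le> 1 / 2 * (nrm A (\<Phi> v) + nrm A (star A (\<Phi> v)))"
      using v nrm_triangle[of "\<Phi> v" "star A (\<Phi> v)"] by (simp add: nrm_smult)
    also have "\<dots> \<le> 1" using le v by simp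
    finally show ?thesis .
  qed
  have cf: "continuous_on unit_circle (\<lambda>z. cnj (f z))" by (intro continuous_intros f)
  \<comment> \<open>The C*-identity passes from \<open>f\<close> to the real-valued function
    \<open>(cmod (f z))\<^sup>2\<close>.\<close>
  have "(nrm A (\<Phi> f))\<^sup>2 = nrm A (\<Phi> (\<lambda>z. cnj (f z) * f z))"
    using f by (simp add: cstar_identity[symmetric] calc_mult[OF cf f(1)] calc_star)
  also have "\<dots> = nrm A (\<Phi> (\<lambda>z. complex_of_real ((cmod (f z))\<^sup>2)))"
    by (simp add: complex_norm_square mult.commute del: of_real_power)
  also have "\<dots> \<le> 1"
    using f by (intro real continuous_intros) (auto simp: power_le_one)
  finally have "(nrm A (\<Phi> f))\<^sup>2 \<le> 1\<^sup>2" by simp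
  then show ?thesis by (rule power2_le_imp_le) simp
qed

lemma calc_le:
  assumes f: "continuous_on unit_circle f" "\<And>z. z \<in> unit_circle \<Longrightarrow> cmod (f z) \<le> C"
  shows "nrm A (\<Phi> f) \<le> C"
proof -
  have "0 \<le> C" using f(2)[of 1] norm_ge_zero[of "f 1"] by (simp del: norm_ge_zero)
  show ?thesis
  proof (cases "C = 0")
    case True
    then have "\<Phi> f = \<Phi> (\<lambda>_. 0)" using f(2) by (intro calc_cong) auto
    then show ?thesis using True by (simp add: calc_zero)
  next
    case False
    have "nrm A (\<Phi> (\<lambda>z. complex_of_real (1 / C) * f z)) \<le> 1"
      using f False \<open>0 \<le> C\<close> by (intro calc_le_1 continuous_intros) (auto simp: norm_mult norm_divide)
    then show ?thesis
      unfolding calc_smult[OF f(1)] using f False \<open>0 \<le> C\<close> by (simp add: nrm_smult norm_divide)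
  qed
qed

lemma calc_diff_le:
  assumes "continuous_on unit_circle f" "continuous_on unit_circle g"
    and "\<And>z. z \<in> unit_circle \<Longrightarrow> cmod (f z - g z) \<le> e"
  shows "nrm A (\<Phi> f \<ominus> \<Phi> g) \<le> e"
  using calc_le[of "\<lambda>z. f z - g z" e] assms by (simp add: calc_minus continuous_on_diff)

lemma calc_mult_id: "continuous_on unit_circle f \<Longrightarrow> \<Phi> (\<lambda>z. z * f z) = u \<otimes> \<Phi> f"
  by (simp add: calc_mult calc_id)

lemma calc_mult_cnj:
  assumes "continuous_on unit_circle f" shows "\<Phi> (\<lambda>z. cnj z * f z) = star A u \<otimes> \<Phi> f"
proof -
  have "\<Phi> (\<lambda>z. cnj z * f z) = \<Phi> (\<lambda>z. cnj z) \<otimes> \<Phi> f"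
    by (rule calc_mult) (intro continuous_intros assms)+
  then show ?thesis by (simp add: calc_star[of "\<lambda>z. z"] calc_id)
qed

lemma calc_commute:
  "continuous_on unit_circle f \<Longrightarrow> continuous_on unit_circle g \<Longrightarrow> \<Phi> f \<otimes> \<Phi> g = \<Phi> g \<otimes> \<Phi> f"
  by (simp add: calc_mult[symmetric] mult.commute)

end

text \<open>Both maps turn multiplication by z and its conjugate into multiplication by
  \<open>u\<close> and its adjoint, and both are contractive, so the induction rule applies.
  Uniqueness is needed because the two relations that involve functional calculus supply unrelated
  homomorphisms.\<close>

lemma circle_calculus_unique:
  assumes "circle_calculus A \<Phi> u" "circle_calculus A \<Psi> u" "continuous_on unit_circle f"
  shows "\<Phi> f = \<Psi> f"
proof -
  interpret P: circle_calculus A \<Phi> u by fact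
  interpret Q: circle_calculus A \<Psi> u by fact
  from assms(3) show ?thesis
  proof (induction rule: circle_function_induct_mult)
    case (const c)
    then show ?case by (simp add: P.calc_const Q.calc_const)
  next
    case (mult f)
    then show ?case by (simp add: P.calc_mult_id Q.calc_mult_id)
  next
    case (inverse f)
    then show ?case by (simp add: P.calc_mult_cnj Q.calc_mult_cnj)
  next
    case (add f g)
    then show ?case by (simp add: P.calc_add Q.calc_add)
  next
    case (limit f)
    show ?case
    proof (rule P.eqI_nrm)
      fix e :: real assume "0 < e"
      then obtain g where g: "continuous_on unit_circle g" "\<Phi> g = \<Psi> g"
        "\<forall>z\<in>unit_circle. cmod (f z - g z) \<le> e / 2"
        using limit.IH[of "e / 2"] by auto
      have "nrm A (\<Phi> f \<ominus>\<^bsub>A\<^esub> \<Psi> f) \<le> nrm A (\<Phi> f \<ominus>\<^bsub>A\<^esub> \<Phi> g) + nrm A (\<Psi> g \<ominus>\<^bsub>A\<^esub> \<Psi> f)"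
        using P.nrm_triangle3[of "\<Phi> f" "\<Phi> g" "\<Psi> f"] limit.hyps g by simp
      also have "nrm A (\<Psi> g \<ominus>\<^bsub>A\<^esub> \<Psi> f) = nrm A (\<Psi> f \<ominus>\<^bsub>A\<^esub> \<Psi> g)"
        using limit.hyps g by (intro P.nrm_minus_commute) auto
      also have "nrm A (\<Phi> f \<ominus>\<^bsub>A\<^esub> \<Phi> g) + \<dots> \<le> e / 2 + e / 2"
        using limit.hyps g by (intro add_mono P.calc_diff_le Q.calc_diff_le) auto
      finally show "nrm A (\<Phi> f \<ominus>\<^bsub>A\<^esub> \<Psi> f) \<le> e" by simp
    qed (use limit.hyps in auto)
  qed
qed

lemma star_hom_continuous_functions:
  assumes "star_hom (continuous_functions K) A \<Psi>"
  shows "continuous_on K f \<Longrightarrow> \<Psi> (restrict f K) \<in> carrier A"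
    and "continuous_on K f \<Longrightarrow> continuous_on K g \<Longrightarrow>
      \<Psi> (\<lambda>z\<in>K. f z + g z) = \<Psi> (restrict f K) \<oplus>\<^bsub>A\<^esub> \<Psi> (restrict g K)"
    and "continuous_on K f \<Longrightarrow> continuous_on K g \<Longrightarrow>
      \<Psi> (\<lambda>z\<in>K. f z * g z) = \<Psi> (restrict f K) \<otimes>\<^bsub>A\<^esub> \<Psi> (restrict g K)"
    and "continuous_on K f \<Longrightarrow> \<Psi> (\<lambda>z\<in>K. c * f z) = c \<odot>\<^bsub>A\<^esub> \<Psi> (restrict f K)"
    and "continuous_on K f \<Longrightarrow> \<Psi> (\<lambda>z\<in>K. cnj (f z)) = star A (\<Psi> (restrict f K))"
    and "\<Psi> (\<lambda>z\<in>K. 1) = \<one>\<^bsub>A\<^esub>"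
proof -
  have hom: "\<Psi> \<in> ring_hom (continuous_functions K) A"
    and smult: "\<And>c f. f \<in> carrier (continuous_functions K) \<Longrightarrow> \<Psi> (c \<odot>\<^bsub>continuous_functions K\<^esub> f) = c \<odot>\<^bsub>A\<^esub> \<Psi> f"
    and star: "\<And>f. f \<in> carrier (continuous_functions K) \<Longrightarrow> \<Psi> (star (continuous_functions K) f) = star A (\<Psi> f)"
    using assms unfolding star_hom_def by auto
  have mem: "restrict f K \<in> carrier (continuous_functions K)" if "continuous_on K f" for f
    using that by (auto simp: continuous_functions_def)
  show "continuous_on K f \<Longrightarrow> \<Psi> (restrict f K) \<in> carrier A"
    by (rule ring_hom_closed[OF hom mem])
  show "continuous_on K f \<Longrightarrow> continuous_on K g \<Longrightarrow>
      \<Psi> (\<lambda>z\<in>K. f z + g z) = \<Psi> (restrict f K) \<oplus>\<^bsub>A\<^esub> \<Psi> (restrict g K)"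
    using ring_hom_add[OF hom mem mem, of f g] by (simp add: continuous_functions_def cong: restrict_cong)
  show "continuous_on K f \<Longrightarrow> continuous_on K g \<Longrightarrow>
      \<Psi> (\<lambda>z\<in>K. f z * g z) = \<Psi> (restrict f K) \<otimes>\<^bsub>A\<^esub> \<Psi> (restrict g K)"
    using ring_hom_mult[OF hom mem mem, of f g] by (simp add: continuous_functions_def cong: restrict_cong)
  show "continuous_on K f \<Longrightarrow> \<Psi> (\<lambda>z\<in>K. c * f z) = c \<odot>\<^bsub>A\<^esub> \<Psi> (restrict f K)"
    using smult[OF mem, of f c] by (simp add: continuous_functions_def cong: restrict_cong)
  show "continuous_on K f \<Longrightarrow> \<Psi> (\<lambda>z\<in>K. cnj (f z)) = star A (\<Psi> (restrict f K))"
    using star[OF mem, of f] by (simp add: continuous_functions_def cong: restrict_cong)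
  show "\<Psi> (\<lambda>z\<in>K. 1) = \<one>\<^bsub>A\<^esub>"
    using ring_hom_one[OF hom] by (simp add: continuous_functions_def)
qed

context unital_cstar_algebra
begin

text \<open>The homomorphism lives on functions on the spectrum, whose extent is not known
  beforehand. For \<open>l\<close> in the spectrum but off the circle the function
  \<open>l - z\<close> has a zero there, so an inverse can be formed only modulo a function in the
  kernel.\<close>

lemma unitary_spectrum_subset:
  assumes u: "u \<in> carrier A" "star A u \<otimes> u = \<one>"
    and hom: "star_hom (continuous_functions (spectrum A u)) A \<Psi>"
    and id: "\<Psi> (\<lambda>z\<in>spectrum A u. z) = u"
  shows "spectrum A u \<subseteq> unit_circle"
proof
  fix l assume l: "l \<in> spectrum A u"
  define K where "K = spectrum A u"
  define \<Phi> where "\<Phi> f = \<Psi> (restrict f K)" for f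
  note H = star_hom_continuous_functions[OF hom, folded K_def, folded \<Phi>_def]
  show "l \<in> unit_circle"
  proof (rule ccontr)
    assume not: "l \<notin> unit_circle"
    \<comment> \<open>\<open>p\<close> vanishes at \<open>u\<close>, so adding \<open>p\<^sup>2\<close> to \<open>|l - z|\<^sup>2\<close> removes its zero on the spectrum
      without changing its value at \<open>u\<close>.\<close>
    define p where "p z = cnj z * z + (- 1)" for z :: complex
    define g where "g z = (l - z) * cnj (l - z) + p z * p z" for z
    have cp: "continuous_on K p" unfolding p_def by (intro continuous_intros)
    have g_nz: "g z \<noteq> 0" for z
    proof
      assume "g z = 0"
      have "g z = complex_of_real ((cmod (l - z))\<^sup>2 + ((cmod z)\<^sup>2 - 1)\<^sup>2)"
        unfolding g_def p_def complex_norm_square[symmetric] mult.commute[of "cnj z"]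
        by (simp add: power2_eq_square)
      with \<open>g z = 0\<close> have "(cmod (l - z))\<^sup>2 + ((cmod z)\<^sup>2 - 1)\<^sup>2 = 0"
        by (metis of_real_eq_0_iff)
      then have "(cmod (l - z))\<^sup>2 = 0" "((cmod z)\<^sup>2 - 1)\<^sup>2 = 0"
        using zero_le_power2[of "cmod (l - z)"] zero_le_power2[of "(cmod z)\<^sup>2 - 1"] by linarith+
      then have "l = z" "(cmod z)\<^sup>2 = 1" by auto
      then show False using not norm_ge_zero[of z] by (auto simp: power2_eq_1_iff simp del: norm_ge_zero)
    qed
    have cg: "continuous_on K (\<lambda>z. inverse (g z))"
      unfolding g_def using g_nz[unfolded g_def] by (intro continuous_intros cp) auto
    have cl: "continuous_on K (\<lambda>z. l - z)" "continuous_on K (\<lambda>z. cnj (l - z) * inverse (g z))"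
      "continuous_on K (\<lambda>z. p z * inverse (g z))" "continuous_on K (\<lambda>z. cnj z :: complex)"
      by (intro continuous_intros cp cg)+
    have c0: "continuous_on K (\<lambda>z. z :: complex)" "continuous_on K (\<lambda>z. l)" "continuous_on K (\<lambda>z. (- 1) * z)"
      "continuous_on K (\<lambda>z. - 1 :: complex)" "continuous_on K (\<lambda>z. cnj z * z)" "continuous_on K (\<lambda>z. 1 :: complex)"
      by (intro continuous_intros)+
    have \<Phi>_id: "\<Phi> (\<lambda>z. z) = u" using id by (simp add: \<Phi>_def K_def)
    have \<Phi>_one: "\<Phi> (\<lambda>_. 1) = \<one>" using H(6) by (simp add: \<Phi>_def)
    have \<Phi>_const: "\<Phi> (\<lambda>_. c) = c \<odot> \<one>" for c
      using H(4)[of "\<lambda>_. 1" c] \<Phi>_one by (simp add: \<Phi>_def)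
    have \<Phi>_diff: "\<Phi> (\<lambda>z. l - z) = l \<odot> \<one> \<ominus> u"
    proof -
      have "\<Phi> (\<lambda>z. l + (- 1) * z) = \<Phi> (\<lambda>_. l) \<oplus> \<Phi> (\<lambda>z. (- 1) * z)"
        using H(2)[OF c0(2,3)] by (simp add: \<Phi>_def)
      also have "\<Phi> (\<lambda>z. (- 1) * z) = \<ominus> u"
        using H(4)[OF c0(1), of "- 1"] \<Phi>_id u(1) by (simp add: \<Phi>_def uminus_eq_smult)
      finally show ?thesis by (simp add: \<Phi>_const M.minus_eq)
    qed
    have "\<Phi> p = \<Phi> (\<lambda>z. cnj z * z) \<oplus> \<Phi> (\<lambda>_. - 1)"
      using H(2)[OF c0(5,4)] by (simp add: \<Phi>_def p_def[abs_def])
    also have "\<Phi> (\<lambda>z. cnj z * z) = \<one>"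
      using H(3)[OF cl(4) c0(1)] H(5)[OF c0(1)] u(2) \<Phi>_id by (simp add: \<Phi>_def)
    finally have \<Phi>_p: "\<Phi> p = \<zero>"
      by (simp add: \<Phi>_const smult_uminus_left M.r_neg)
    have "\<Phi> (\<lambda>z. p z * (p z * inverse (g z))) = \<Phi> p \<otimes> \<Phi> (\<lambda>z. p z * inverse (g z))"
      using H(3)[OF cp cl(3)] by (simp add: \<Phi>_def)
    then have zero: "\<Phi> (\<lambda>z. p z * (p z * inverse (g z))) = \<zero>"
      using H(1)[OF cl(3)] by (simp add: \<Phi>_p)
    let ?v = "\<Phi> (\<lambda>z. cnj (l - z) * inverse (g z))"
    have v: "?v \<in> carrier A" using H(1)[OF cl(2)] by (simp add: \<Phi>_def)
    have cc: "continuous_on K (\<lambda>z. (l - z) * (cnj (l - z) * inverse (g z)))"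
      "continuous_on K (\<lambda>z. p z * (p z * inverse (g z)))"
      by (intro continuous_intros cl cp cg)+
    have right: "(l \<odot> \<one> \<ominus> u) \<otimes> ?v = \<one>"
    proof -
      have "(l \<odot> \<one> \<ominus> u) \<otimes> ?v = \<Phi> (\<lambda>z. (l - z) * (cnj (l - z) * inverse (g z)))"
        unfolding \<Phi>_diff[symmetric] using H(3)[OF cl(1,2)] by (simp add: \<Phi>_def)
      also have "\<dots> = \<dots> \<oplus> \<Phi> (\<lambda>z. p z * (p z * inverse (g z)))"
        unfolding zero using H(1)[OF cc(1)] by (simp add: \<Phi>_def)
      also have "\<dots> = \<Phi> (\<lambda>z. (l - z) * (cnj (l - z) * inverse (g z)) + p z * (p z * inverse (g z)))"
        using H(2)[OF cc] by (simp add: \<Phi>_def)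
      also have "(\<lambda>z. (l - z) * (cnj (l - z) * inverse (g z)) + p z * (p z * inverse (g z))) = (\<lambda>z. g z * inverse (g z))"
        by (auto simp: g_def algebra_simps)
      also have "\<Phi> \<dots> = \<one>" using \<Phi>_one by (simp add: g_nz)
      finally show ?thesis .
    qed
    have left: "?v \<otimes> (l \<odot> \<one> \<ominus> u) = \<one>"
      using right H(3)[OF cl(1,2)] H(3)[OF cl(2,1)] unfolding \<Phi>_diff[symmetric]
      by (simp add: \<Phi>_def mult.commute)
    have "l \<odot> \<one> \<ominus> u \<in> Units A"
      unfolding Units_def using left right v u(1) by auto
    then show False using l unfolding spectrum_def by simp
  qed
qed

lemma circle_calculus_of_star_hom:
  assumes "star_hom (continuous_functions unit_circle) A \<Psi>" "\<Psi> (\<lambda>z\<in>unit_circle. z) = u"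
  shows "circle_calculus A (\<lambda>f. \<Psi> (restrict f unit_circle)) u"
proof
  note H = star_hom_continuous_functions[OF assms(1)]
  fix f g :: "complex \<Rightarrow> complex" and c
  show "\<Psi> (restrict f unit_circle) = \<Psi> (restrict g unit_circle)" if "\<And>z. z \<in> unit_circle \<Longrightarrow> f z = g z"
    using that by (metis restrict_ext)
  show "\<Psi> (\<lambda>z\<in>unit_circle. 1) = \<one>" "\<Psi> (\<lambda>z\<in>unit_circle. z) = u" by (fact H(6) assms(2))+
  assume f: "continuous_on unit_circle f"
  show "\<Psi> (restrict f unit_circle) \<in> carrier A"
    "\<Psi> (\<lambda>z\<in>unit_circle. c * f z) = c \<odot> \<Psi> (restrict f unit_circle)"
    "\<Psi> (\<lambda>z\<in>unit_circle. cnj (f z)) = star A (\<Psi> (restrict f unit_circle))" by (fact H(1)[OF f] H(4)[OF f] H(5)[OF f])+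
  assume g: "continuous_on unit_circle g"
  show "\<Psi> (\<lambda>z\<in>unit_circle. f z + g z) = \<Psi> (restrict f unit_circle) \<oplus> \<Psi> (restrict g unit_circle)"
    "\<Psi> (\<lambda>z\<in>unit_circle. f z * g z) = \<Psi> (restrict f unit_circle) \<otimes> \<Psi> (restrict g unit_circle)"
    by (fact H(2)[OF f g] H(3)[OF f g])+
qed

lemma continuous_calculus_circle:
  assumes "u \<in> carrier A" "star A u \<otimes> u = \<one>" "unit_circle \<subseteq> spectrum A u"
    and "continuous_calculus A u f a"
  obtains \<Phi> where "circle_calculus A \<Phi> u" "a = \<Phi> f"
proof -
  obtain \<Psi> where \<Psi>: "star_hom (continuous_functions (spectrum A u)) A \<Psi>"
    "\<Psi> (\<lambda>z\<in>spectrum A u. z) = u" "a = \<Psi> (restrict f (spectrum A u))"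
    using assms(4) unfolding continuous_calculus_def by blast
  have "spectrum A u = unit_circle"
    using unitary_spectrum_subset[OF assms(1,2) \<Psi>(1,2)] assms(3) by blast
  with \<Psi> circle_calculus_of_star_hom[of \<Psi> u] show thesis
    using that[of "\<lambda>f. \<Psi> (restrict f unit_circle)"] by simp
qed

end

section \<open>The structure of the universal rotation algebra\<close>

text \<open>Divided by \<open>N\<close>, these counts of pairs with a given difference are the Fejer
  coefficients. The subtraction on the right is truncated, which gives 0 when
  \<open>\<bar>n\<bar>\<close> exceeds \<open>N\<close>.\<close>

lemma sum_indicator_difference:
  "(\<Sum>j<N. \<Sum>l<N. if n = int l - int j then 1 else (0::complex)) = of_nat (N - nat \<bar>n\<bar>)"
proof -
  have pos: "(\<Sum>j<N. \<Sum>l<N. if int m = int l - int j then 1 else (0::complex)) = of_nat (N - m)" for m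
  proof -
    have "(\<Sum>l<N. if int m = int l - int j then 1 else (0::complex)) = (if j + m < N then 1 else 0)" for j
    proof -
      have "int m = int l - int j \<longleftrightarrow> l = j + m" for l by auto
      then show ?thesis by (simp add: sum.delta)
    qed
    then have "(\<Sum>j<N. \<Sum>l<N. if int m = int l - int j then 1 else (0::complex)) = (\<Sum>j<N. if j + m < N then 1 else 0)"
      by simp
    also have "\<dots> = of_nat (card ({..<N} \<inter> {j. j + m < N}))"
      by (simp add: sum.If_cases)
    also have "{..<N} \<inter> {j. j + m < N} = {..<N - m}" by auto
    finally show ?thesis by simp
  qed
  show ?thesis
  proof (cases "0 \<le> n")
    case True
    then show ?thesis using pos[of "nat n"] by simp
  next
    case False
    have "(\<Sum>j<N. \<Sum>l<N. if n = int l - int j then 1 else (0::complex))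
        = (\<Sum>l<N. \<Sum>j<N. if int (nat (- n)) = int j - int l then 1 else 0)"
      using False by (subst sum.swap) (auto intro!: sum.cong)
    then show ?thesis using pos[of "nat (- n)"] False by simp
  qed
qed

section \<open>Fourier and Fejer weights\<close>

context irrational_rotation
begin

definition rotated :: "int \<Rightarrow> (complex \<Rightarrow> complex) \<Rightarrow> complex \<Rightarrow> complex" where
  "rotated k f z = f (\<mu> powi k * z)"

lemma continuous_on_rotated [intro]:
  "continuous_on unit_circle f \<Longrightarrow> continuous_on unit_circle (rotated k f)"
  unfolding rotated_def
  by (rule continuous_on_compose2[of unit_circle f]) (auto intro!: continuous_intros simp: norm_mult)

lemma rotated_rotated: "rotated k (rotated l f) = rotated (k + l) f"
  by (rule ext) (simp add: rotated_def power_int_add mult_ac)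

lemma rotated_0 [simp]: "rotated 0 f = f"
  by (rule ext) (simp add: rotated_def)

text \<open>Conjugation by the k-th power of w multiplies degree m by
  \<open>\<mu> powi (m * int k)\<close>. A mean over k below M with these weights isolates degree n
  as M grows.\<close>

definition fourier_weight :: "int \<Rightarrow> nat \<Rightarrow> nat \<Rightarrow> complex" where
  "fourier_weight n M k = \<mu> powi (- (n * int k)) / of_nat M"

lemma fourier_weight_tendsto:
  "(\<lambda>M. \<Sum>k<M. fourier_weight n M k * \<mu> powi (m * int k)) \<longlonglongrightarrow> (if m = n then 1 else 0)"
proof -
  have "fourier_weight n M k * \<mu> powi (m * int k) = \<mu> powi ((m - n) * int k) / of_nat M" for M k
  proof -
    have "\<mu> powi (- (n * int k)) * \<mu> powi (m * int k) = \<mu> powi ((m - n) * int k)"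
      by (subst power_int_add[symmetric]) (auto simp: algebra_simps)
    then show ?thesis by (simp add: fourier_weight_def)
  qed
  then show ?thesis
    using average_mu_powi_tendsto[of "m - n"] by (simp add: sum_divide_distrib)
qed

text \<open>The Fejer kernel of order N at the point \<open>\<mu> powi int k\<close>, divided by
  M.\<close>

definition fejer_weight :: "nat \<Rightarrow> nat \<Rightarrow> nat \<Rightarrow> complex" where
  "fejer_weight N M k = complex_of_real ((cmod (\<Sum>j<N. \<mu> powi (int j * int k)))\<^sup>2 / (real N * real M))"

text \<open>The weights have two readings. The squared modulus shows that they are non-negative,
  which controls their mass; expanding it shows that a Fejer mean is a combination of
  \<open>N * N\<close> Fourier means, each with coefficient \<open>1 / N\<close>.\<close>

lemma fejer_weight_eq:
  "fejer_weight N M k =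
    (\<Sum>p\<in>{..<N} \<times> {..<N}. (1 / of_nat N) * fourier_weight (int (snd p) - int (fst p)) M k)"
proof -
  have cnj: "cnj (\<mu> powi a) = \<mu> powi (- a)" for a
    using complex_norm_square[of "\<mu> powi a"] by (simp add: power_int_minus field_simps)
  have "complex_of_real ((cmod (\<Sum>j<N. \<mu> powi (int j * int k)))\<^sup>2)
      = (\<Sum>j<N. \<Sum>l<N. \<mu> powi (int j * int k) * cnj (\<mu> powi (int l * int k)))"
    unfolding complex_norm_square cnj_sum sum_product ..
  also have "\<dots> = (\<Sum>j<N. \<Sum>l<N. \<mu> powi (- ((int l - int j) * int k)))"
  proof (intro sum.cong refl)
    fix j l
    have "- ((int l - int j) * int k) = int j * int k + - (int l * int k)"
      by (simp add: algebra_simps)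
    then show "\<mu> powi (int j * int k) * cnj (\<mu> powi (int l * int k)) = \<mu> powi (- ((int l - int j) * int k))"
      unfolding cnj by (simp only: power_int_add[OF disjI1[OF mu_nonzero]])
  qed
  finally show ?thesis
    by (simp add: fejer_weight_def fourier_weight_def sum.cartesian_product sum_divide_distrib
        split_beta mult.commute)
qed

lemma fejer_weight_tendsto:
  assumes "0 < N"
  shows "(\<lambda>M. \<Sum>k<M. fejer_weight N M k * \<mu> powi (n * int k)) \<longlonglongrightarrow> of_nat (N - nat \<bar>n\<bar>) / of_nat N"
proof -
  have "(\<Sum>k<M. fejer_weight N M k * \<mu> powi (n * int k)) = (\<Sum>p\<in>{..<N} \<times> {..<N}. (1 / of_nat N) *
      (\<Sum>k<M. fourier_weight (int (snd p) - int (fst p)) M k * \<mu> powi (n * int k)))" for M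
    unfolding fejer_weight_eq sum_distrib_right sum_distrib_left by (subst sum.swap) (simp add: mult.assoc)
  moreover have "(\<lambda>M. \<Sum>p\<in>{..<N} \<times> {..<N}. (1 / of_nat N) *
      (\<Sum>k<M. fourier_weight (int (snd p) - int (fst p)) M k * \<mu> powi (n * int k)))
      \<longlonglongrightarrow> (\<Sum>p\<in>{..<N} \<times> {..<N}. (1 / of_nat N) * (if n = int (snd p) - int (fst p) then 1 else 0))"
    by (intro tendsto_sum tendsto_mult tendsto_const fourier_weight_tendsto)
  moreover have "(\<Sum>p\<in>{..<N} \<times> {..<N}. (1 / of_nat N) * (if n = int (snd p) - int (fst p) then 1 else 0))
      = of_nat (N - nat \<bar>n\<bar>) / (of_nat N :: complex)"
    using sum_indicator_difference[of n N]
    by (simp add: sum.cartesian_product split_beta flip: sum_distrib_left sum_divide_distrib)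
  ultimately show ?thesis by simp
qed

text \<open>By non-negativity the mass is the modulus of the sum, which tends to the Fejer
  coefficient 1 of degree 0. The bound does not depend on \<open>N\<close>.\<close>

lemma fejer_weight_mass:
  assumes "0 < N" shows "\<forall>\<^sub>F M in sequentially. (\<Sum>k<M. cmod (fejer_weight N M k)) < 2"
proof -
  have "(\<lambda>M. cmod (\<Sum>k<M. fejer_weight N M k)) \<longlonglongrightarrow> cmod 1"
    using tendsto_norm[OF fejer_weight_tendsto[OF assms, of 0]] assms by simp
  then have "\<forall>\<^sub>F M in sequentially. cmod (\<Sum>k<M. fejer_weight N M k) < 2"
    by (rule order_tendstoD(2)) simp
  moreover have "cmod (\<Sum>k<M. fejer_weight N M k) = (\<Sum>k<M. cmod (fejer_weight N M k))" for M
    unfolding fejer_weight_def of_real_sum[symmetric] norm_of_real by (auto intro!: abs_of_nonneg sum_nonneg)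
  ultimately show ?thesis by simp
qed

lemma fejer_coefficient_tendsto: "(\<lambda>N. of_nat (N - nat \<bar>n\<bar>) / of_nat N :: complex) \<longlonglongrightarrow> 1"
proof -
  have "(\<lambda>N. 1 - of_int \<bar>n\<bar> / of_nat N :: complex) \<longlonglongrightarrow> 1 - 0"
    by (intro tendsto_intros lim_const_over_n)
  moreover have "\<forall>\<^sub>F N in sequentially. 1 - of_int \<bar>n\<bar> / of_nat N = (of_nat (N - nat \<bar>n\<bar>) / of_nat N :: complex)"
    using eventually_gt_at_top[of "nat \<bar>n\<bar>"]
  proof eventually_elim
    case (elim N)
    have "complex_of_nat (nat \<bar>n\<bar>) = of_int \<bar>n\<bar>" by simp
    then show ?case using elim by (simp add: of_nat_diff diff_divide_distrib del: of_int_abs of_nat_nat)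
  qed
  ultimately show ?thesis by (simp add: Lim_transform_eventually)
qed

end

section \<open>Covariance of the generators\<close>

locale rotation_algebra = irrational_rotation \<theta> \<mu> + unital_cstar_algebra A
  for \<theta> :: real and \<mu> :: complex and A :: "'a cstar" (structure) +
  fixes \<gamma> :: "complex \<Rightarrow> real" and x w :: 'a
  assumes gamma_continuous: "continuous_on unit_circle \<gamma>"
    and gamma_nonneg: "\<forall>z\<in>unit_circle. 0 \<le> \<gamma> z"
    and universal: "universal_rotation_algebra \<theta> \<gamma> A x w"
begin

lemma relations:
  shows x_closed [simp, intro]: "x \<in> carrier A" and w_closed [simp, intro]: "w \<in> carrier A"
    and w_unitary: "star A w \<otimes> w = \<one>" "w \<otimes> star A w = \<one>"
    and calculus_star_x_x: "continuous_calculus A w (\<lambda>z. complex_of_real (\<gamma> z)) (star A x \<otimes> x)"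
    and calculus_x_star_x: "continuous_calculus A (inverse \<mu> \<odot> w) (\<lambda>z. complex_of_real (\<gamma> z)) (x \<otimes> star A x)"
    and x_w: "x \<otimes> w = inverse \<mu> \<odot> (w \<otimes> x)"
  using universal unfolding universal_rotation_algebra_def rotation_relations_def exp_eq_mu by blast+

lemma generated: "carrier A = cstar_generated A {x, w}"
  using universal unfolding universal_rotation_algebra_def by simp

definition orbit_rep :: "complex \<Rightarrow> 'a \<Rightarrow> ell2 \<Rightarrow>\<^sub>L ell2" where
  "orbit_rep \<xi> = (SOME M. representation A M \<and> M x = orbit_shift \<gamma> \<xi> \<and> M w = orbit_diagonal (\<lambda>z. z) \<xi>)"

lemma orbit_rep:
  assumes "\<xi> \<in> unit_circle"
  shows "representation A (orbit_rep \<xi>)" "orbit_rep \<xi> x = orbit_shift \<gamma> \<xi>"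
    "orbit_rep \<xi> w = orbit_diagonal (\<lambda>z. z) \<xi>"
proof -
  have "\<exists>M. representation A M \<and> M x = orbit_shift \<gamma> \<xi> \<and> M w = orbit_diagonal (\<lambda>z. z) \<xi>"
    using orbit_representation[OF universal gamma_continuous gamma_nonneg assms] by blast
  from someI_ex[OF this] show "representation A (orbit_rep \<xi>)" "orbit_rep \<xi> x = orbit_shift \<gamma> \<xi>"
    "orbit_rep \<xi> w = orbit_diagonal (\<lambda>z. z) \<xi>"
    unfolding orbit_rep_def by blast+
qed

lemma orbit_rep_w:
  assumes "\<xi> \<in> unit_circle"
  shows "orbit_rep \<xi> w (unit_vector k) = scalar_op (\<mu> powi k * \<xi>) (unit_vector k)"
  unfolding orbit_rep[OF assms] orbit_diagonal_def
  using weighted_shift_unit_vector[OF bounded_weights_orbit[OF continuous_on_id assms], of 0 k] by simp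

lemma orbit_rep_star_w:
  assumes "\<xi> \<in> unit_circle"
  shows "orbit_rep \<xi> (star A w) (unit_vector k) = scalar_op (cnj (\<mu> powi k * \<xi>)) (unit_vector k)"
proof -
  interpret representation A "orbit_rep \<xi>" by (rule orbit_rep[OF assms])
  note b = bounded_weights_orbit[OF continuous_on_id assms]
  show ?thesis
    unfolding rep_star[OF w_closed] orbit_rep(3)[OF assms] orbit_diagonal_def adjoint_weighted_shift[OF b]
    using weighted_shift_unit_vector[OF bounded_weights_cnj[OF b, where s = 0], of 0 k] by simp
qed

lemma orbit_rep_x:
  assumes "\<xi> \<in> unit_circle"
  shows "orbit_rep \<xi> x (unit_vector k) = scalar_op (complex_of_real (sqrt (\<gamma> (\<mu> powi k * \<xi>)))) (unit_vector (k + 1))"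
  unfolding orbit_rep[OF assms] orbit_shift_def
  using weighted_shift_unit_vector[OF bounded_weights_orbit_shift[OF gamma_continuous assms], of 1 k] by simp

lemma orbit_rep_star_x:
  assumes "\<xi> \<in> unit_circle"
  shows "orbit_rep \<xi> (star A x) (unit_vector k) =
    scalar_op (complex_of_real (sqrt (\<gamma> (\<mu> powi (k - 1) * \<xi>)))) (unit_vector (k - 1))"
proof -
  interpret representation A "orbit_rep \<xi>" by (rule orbit_rep[OF assms])
  note b = bounded_weights_orbit_shift[OF gamma_continuous assms]
  show ?thesis
    unfolding rep_star[OF x_closed] orbit_rep(2)[OF assms] orbit_shift_def adjoint_weighted_shift[OF b]
    using weighted_shift_unit_vector[OF bounded_weights_cnj[OF b, where s = 1], of "- 1" k] by simp
qed

text \<open>The point \<open>l\<close> is an eigenvalue of \<open>c \<odot> w\<close> in the orbit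
  representation at \<open>l / c\<close>, with eigenvector \<open>unit_vector 0\<close>, so
  \<open>l \<odot> \<one> \<ominus> c \<odot> w\<close> has no left inverse. The factor
  \<open>c\<close> covers \<open>inverse \<mu> \<odot> w\<close>, whose calculus appears in the
  relations.\<close>

lemma circle_subset_spectrum:
  assumes "c \<in> unit_circle" shows "unit_circle \<subseteq> spectrum A (c \<odot> w)"
proof
  fix l :: complex assume l: "l \<in> unit_circle"
  show "l \<in> spectrum A (c \<odot> w)"
    unfolding spectrum_def
  proof safe
    assume "l \<odot> \<one> \<ominus> c \<odot> w \<in> Units A"
    then obtain v where v: "v \<in> carrier A" "v \<otimes> (l \<odot> \<one> \<ominus> c \<odot> w) = \<one>"
      unfolding Units_def by blast
    have \<xi>: "l / c \<in> unit_circle" using l assms by (simp add: norm_divide)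
    interpret representation A "orbit_rep (l / c)" by (rule orbit_rep[OF \<xi>])
    have zero: "orbit_rep (l / c) (l \<odot> \<one> \<ominus> c \<odot> w) (unit_vector 0) = 0"
    proof -
      have "c \<noteq> 0" using assms by auto
      then show ?thesis
        by (intro ell2_eqI)
           (simp add: rep_minus rep_smult rep_one blinfun.diff_left orbit_rep_w[OF \<xi>] coord_unit_vector)
    qed
    have "unit_vector 0 = orbit_rep (l / c) (v \<otimes> (l \<odot> \<one> \<ominus> c \<odot> w)) (unit_vector 0)"
      unfolding v(2) rep_one by simp
    also have "\<dots> = orbit_rep (l / c) v (orbit_rep (l / c) (l \<odot> \<one> \<ominus> c \<odot> w) (unit_vector 0))"
      using v(1) by (subst rep_mult) auto
    also have "\<dots> = 0" unfolding zero by (rule blinfun.zero_right)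
    finally have "unit_vector 0 = 0" .
    then show False using norm_unit_vector[of 0] by simp
  qed
qed

text \<open>The choice is made among homomorphisms that witness the relation for
  \<open>star A x \<otimes> x\<close>, so the value at \<gamma> comes with it.\<close>

definition calc :: "(complex \<Rightarrow> complex) \<Rightarrow> 'a" where
  "calc = (SOME \<Phi>. circle_calculus A \<Phi> w \<and> star A x \<otimes> x = \<Phi> (\<lambda>z. complex_of_real (\<gamma> z)))"

lemma calc: "circle_calculus A calc w" "star A x \<otimes> x = calc (\<lambda>z. complex_of_real (\<gamma> z))"
proof -
  have "unit_circle \<subseteq> spectrum A w"
    using circle_subset_spectrum[of 1] by simp
  then have "\<exists>\<Phi>. circle_calculus A \<Phi> w \<and> star A x \<otimes> x = \<Phi> (\<lambda>z. complex_of_real (\<gamma> z))"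
    using continuous_calculus_circle[OF w_closed w_unitary(1) _ calculus_star_x_x] by metis
  from someI_ex[OF this] show "circle_calculus A calc w" "star A x \<otimes> x = calc (\<lambda>z. complex_of_real (\<gamma> z))"
    unfolding calc_def by blast+
qed

end

sublocale rotation_algebra \<subseteq> circle_calculus A calc w
  by (rule calc)

context rotation_algebra
begin

definition gam :: "complex \<Rightarrow> complex" where
  "gam z = complex_of_real (\<gamma> z)"

lemma continuous_on_gam [simp, intro]: "continuous_on unit_circle gam"
  unfolding gam_def by (intro continuous_intros gamma_continuous)

lemma star_x_x: "star A x \<otimes> x = calc gam"
  unfolding gam_def using calc(2) .

text \<open>Rotating the argument turns \<open>calc\<close> into a calculus for
  \<open>inverse \<mu> \<odot> w\<close>. By uniqueness it agrees with the one in the relation for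
  \<open>x \<otimes> star A x\<close>.\<close>

lemma x_star_x: "x \<otimes> star A x = calc (rotated (- 1) gam)"
proof -
  have u: "inverse \<mu> \<odot> w \<in> carrier A" "star A (inverse \<mu> \<odot> w) \<otimes> (inverse \<mu> \<odot> w) = \<one>"
  proof -
    have "inverse \<mu> * inverse (cnj \<mu>) = 1"
      using complex_norm_square[of "inverse \<mu>"] by (simp add: norm_inverse)
    then show "star A (inverse \<mu> \<odot> w) \<otimes> (inverse \<mu> \<odot> w) = \<one>"
      by (simp add: star_smult smult_mult_left smult_mult_right smult_smult w_unitary)
  qed simp
  have "unit_circle \<subseteq> spectrum A (inverse \<mu> \<odot> w)"
    by (rule circle_subset_spectrum) (simp add: norm_inverse)
  then obtain \<Psi> where \<Psi>: "circle_calculus A \<Psi> (inverse \<mu> \<odot> w)"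
    "x \<otimes> star A x = \<Psi> (\<lambda>z. complex_of_real (\<gamma> z))"
    using continuous_calculus_circle[OF u _ calculus_x_star_x] by metis
  have "circle_calculus A (\<lambda>f. calc (rotated (- 1) f)) (inverse \<mu> \<odot> w)"
  proof
    fix f g :: "complex \<Rightarrow> complex" and c
    show "calc (rotated (- 1) f) = calc (rotated (- 1) g)" if "\<And>z. z \<in> unit_circle \<Longrightarrow> f z = g z"
      by (rule calc_cong) (simp add: rotated_def that norm_mult norm_inverse)
    show "calc (rotated (- 1) (\<lambda>_. 1)) = \<one>"
      by (simp add: rotated_def[abs_def] calc_one)
    show "calc (rotated (- 1) (\<lambda>z. z)) = inverse \<mu> \<odot> w"
      using calc_smult[of "\<lambda>z. z" "inverse \<mu>"] by (simp add: rotated_def[abs_def] calc_id)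
    assume f: "continuous_on unit_circle f"
    then have f': "continuous_on unit_circle (rotated (- 1) f)" ..
    then show "calc (rotated (- 1) f) \<in> carrier A" ..
    show "calc (rotated (- 1) (\<lambda>z. c * f z)) = c \<odot> calc (rotated (- 1) f)"
      using calc_smult[OF f'] by (simp add: rotated_def[abs_def])
    show "calc (rotated (- 1) (\<lambda>z. cnj (f z))) = star A (calc (rotated (- 1) f))"
      using calc_star[OF f'] by (simp add: rotated_def[abs_def])
    assume "continuous_on unit_circle g"
    then have g': "continuous_on unit_circle (rotated (- 1) g)" ..
    show "calc (rotated (- 1) (\<lambda>z. f z + g z)) = calc (rotated (- 1) f) \<oplus> calc (rotated (- 1) g)"
      using calc_add[OF f' g'] by (simp add: rotated_def[abs_def])
    show "calc (rotated (- 1) (\<lambda>z. f z * g z)) = calc (rotated (- 1) f) \<otimes> calc (rotated (- 1) g)"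
      using calc_mult[OF f' g'] by (simp add: rotated_def[abs_def])
  qed
  from circle_calculus_unique[OF \<Psi>(1) this continuous_on_gam] \<Psi>(2) show ?thesis
    by (simp add: gam_def[abs_def])
qed

text \<open>The covariance relation. It holds for w by the relations and for its adjoint by
  unitarity; contractivity of \<open>calc\<close> on both sides carries it to uniform
  limits.\<close>

lemma x_calc:
  assumes "continuous_on unit_circle f" shows "x \<otimes> calc f = calc (rotated (- 1) f) \<otimes> x"
  using assms
proof (induction rule: circle_function_induct_mult)
  case (const c)
  then show ?case
    by (simp add: rotated_def[abs_def] calc_const smult_mult_left smult_mult_right)
next
  case (mult f)
  have r: "rotated (- 1) (\<lambda>z. z * f z) = (\<lambda>z. inverse \<mu> * (z * rotated (- 1) f z))"
    by (auto simp: rotated_def)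
  have c: "continuous_on unit_circle (rotated (- 1) f)" "continuous_on unit_circle (\<lambda>z. z * rotated (- 1) f z)"
    using mult.hyps by (auto intro!: continuous_intros)
  have "x \<otimes> (w \<otimes> calc f) = inverse \<mu> \<odot> (w \<otimes> x) \<otimes> calc f"
    using mult.hyps by (simp add: x_w flip: m_assoc)
  also have "\<dots> = inverse \<mu> \<odot> (w \<otimes> calc (rotated (- 1) f)) \<otimes> x"
    using mult c by (simp add: smult_mult_left m_assoc)
  finally show ?case
    using mult.hyps c by (simp add: calc_mult_id r calc_smult)
next
  case (inverse f)
  have cnj_mu: "cnj (inverse \<mu>) = \<mu>"
    using complex_norm_square[of \<mu>] by (simp add: field_simps)
  have r: "rotated (- 1) (\<lambda>z. cnj z * f z) = (\<lambda>z. \<mu> * (cnj z * rotated (- 1) f z))"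
    by (rule ext) (use cnj_mu in \<open>simp add: rotated_def\<close>)
  have c: "continuous_on unit_circle (rotated (- 1) f)" "continuous_on unit_circle (\<lambda>z. cnj z * rotated (- 1) f z)"
    using inverse.hyps by (auto intro!: continuous_intros)
  \<comment> \<open>Inserting \<open>w \<otimes> star A w\<close> turns the relation for
    \<open>x \<otimes> w\<close> into one for \<open>x \<otimes> star A w\<close>.\<close>
  have "\<mu> \<odot> (star A w \<otimes> x) = \<mu> \<odot> (star A w \<otimes> (x \<otimes> w) \<otimes> star A w)"
    by (simp add: m_assoc w_unitary)
  also have "\<dots> = (star A w \<otimes> w) \<otimes> (x \<otimes> star A w)"
    unfolding x_w by (simp add: smult_mult_left smult_mult_right smult_smult m_assoc)
  finally have x_star_w: "x \<otimes> star A w = \<mu> \<odot> (star A w \<otimes> x)" by (simp add: w_unitary)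
  have "x \<otimes> (star A w \<otimes> calc f) = \<mu> \<odot> (star A w \<otimes> x) \<otimes> calc f"
    using inverse.hyps by (simp add: x_star_w flip: m_assoc)
  also have "\<dots> = \<mu> \<odot> (star A w \<otimes> calc (rotated (- 1) f)) \<otimes> x"
    using inverse c by (simp add: smult_mult_left m_assoc)
  finally show ?case
    using inverse.hyps c by (simp add: calc_mult_cnj r calc_smult)
next
  case (add f g)
  have r: "rotated (- 1) (\<lambda>z. f z + g z) = (\<lambda>z. rotated (- 1) f z + rotated (- 1) g z)"
    by (auto simp: rotated_def)
  have c: "continuous_on unit_circle (rotated (- 1) f)" "continuous_on unit_circle (rotated (- 1) g)"
    using add.hyps by auto
  show ?case unfolding r calc_add[OF c] calc_add[OF add.hyps(1,2)]
    using add c by (simp add: l_distr r_distr)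
next
  case (limit f)
  have cf: "continuous_on unit_circle (rotated (- 1) f)" using limit.hyps by auto
  show ?case
  proof (rule eqI_nrm)
    fix e :: real assume "0 < e"
    have pos: "0 < 2 * (nrm A x + 1)" using nrm_nonneg[OF x_closed] by simp
    \<comment> \<open>Each of the two error terms below is at most
      \<open>(nrm A x + 1) * d\<close>.\<close>
    define d where "d = e / (2 * (nrm A x + 1))"
    have "0 < d" using \<open>0 < e\<close> pos by (simp add: d_def)
    then obtain g where g: "continuous_on unit_circle g" "x \<otimes> calc g = calc (rotated (- 1) g) \<otimes> x"
      "\<forall>z\<in>unit_circle. cmod (f z - g z) \<le> d"
      using limit.IH[of d] by auto
    have cg: "continuous_on unit_circle (rotated (- 1) g)" using g by auto
    have bound: "n * U + V * n \<le> (n + 1) * d + d * (n + 1)"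
      if "U \<le> d" "V \<le> d" "0 \<le> U" "0 \<le> n" for n U V :: real
      using that \<open>0 < d\<close> by (intro add_mono mult_mono) auto
    have 1: "nrm A (calc f \<ominus> calc g) \<le> d"
      using limit.hyps g by (intro calc_diff_le) auto
    have 2: "nrm A (calc (rotated (- 1) g) \<ominus> calc (rotated (- 1) f)) \<le> d"
      using cf cg g by (intro calc_diff_le) (auto simp: rotated_def norm_mult norm_inverse norm_minus_commute)
    have eq: "x \<otimes> calc f \<ominus> calc (rotated (- 1) f) \<otimes> x
        = x \<otimes> (calc f \<ominus> calc g) \<oplus> (calc (rotated (- 1) g) \<ominus> calc (rotated (- 1) f)) \<otimes> x"
    proof -
      have "x \<otimes> calc f \<ominus> calc (rotated (- 1) f) \<otimes> x
          = (x \<otimes> calc f \<ominus> x \<otimes> calc g) \<oplus> (x \<otimes> calc g \<ominus> calc (rotated (- 1) f) \<otimes> x)"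
        using limit.hyps g(1) cf by (intro minus_telescope) auto
      also have "x \<otimes> calc f \<ominus> x \<otimes> calc g = x \<otimes> (calc f \<ominus> calc g)"
        using limit.hyps g(1) by (simp add: M.minus_eq r_distr r_minus)
      also have "x \<otimes> calc g \<ominus> calc (rotated (- 1) f) \<otimes> x = (calc (rotated (- 1) g) \<ominus> calc (rotated (- 1) f)) \<otimes> x"
        unfolding g(2) using cf cg by (simp add: M.minus_eq l_distr l_minus)
      finally show ?thesis .
    qed
    have "nrm A (x \<otimes> calc f \<ominus> calc (rotated (- 1) f) \<otimes> x) \<le> nrm A x * nrm A (calc f \<ominus> calc g)
        + nrm A (calc (rotated (- 1) g) \<ominus> calc (rotated (- 1) f)) * nrm A x"
      unfolding eq using limit.hyps g(1) cf cg
      by (intro order_trans[OF nrm_triangle] add_mono nrm_mult) auto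
    also have "\<dots> \<le> (nrm A x + 1) * d + d * (nrm A x + 1)"
      by (rule bound[OF 1 2 _ nrm_nonneg[OF x_closed]]) (intro nrm_nonneg M.minus_closed calc_closed limit.hyps g(1))
    also have "\<dots> = 2 * (nrm A x + 1) * d" by (simp add: algebra_simps)
    also have "\<dots> = e" using pos by (simp add: d_def)
    finally show "nrm A (x \<otimes> calc f \<ominus> calc (rotated (- 1) f) \<otimes> x) \<le> e" .
  qed (use limit.hyps cf in auto)
qed

text \<open>Take adjoints in \<open>x_calc\<close> for the conjugate of \<open>rotated 1 f\<close>,
  which the rotation there brings back to the conjugate of \<open>f\<close>.\<close>

lemma star_x_calc:
  assumes f: "continuous_on unit_circle f" shows "star A x \<otimes> calc f = calc (rotated 1 f) \<otimes> star A x"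
proof -
  let ?g = "\<lambda>z. cnj (rotated 1 f z)"
  have r: "continuous_on unit_circle (rotated 1 f)" using f by auto
  have g: "continuous_on unit_circle ?g" by (intro continuous_intros r)
  have "rotated (- 1) ?g = (\<lambda>z. cnj (f z))"
    by (rule ext) (simp add: rotated_def flip: mult.assoc)
  then have "x \<otimes> star A (calc (rotated 1 f)) = star A (calc f) \<otimes> x"
    using x_calc[OF g] by (simp add: calc_star r f)
  then have "star A (x \<otimes> star A (calc (rotated 1 f))) = star A (star A (calc f) \<otimes> x)" by simp
  then show ?thesis using f r by (simp add: star_mult star_star)
qed

lemma orbit_rep_calc:
  assumes \<xi>: "\<xi> \<in> unit_circle" and f: "continuous_on unit_circle f"
  shows "orbit_rep \<xi> (calc f) (unit_vector k) = scalar_op (f (\<mu> powi k * \<xi>)) (unit_vector k)"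
proof -
  interpret representation A "orbit_rep \<xi>" by (rule orbit_rep[OF \<xi>])
  from f show ?thesis
  proof (induction rule: circle_function_induct_mult)
    case (const c)
    then show ?case by (simp add: calc_const rep_smult rep_one)
  next
    case (mult f)
    then show ?case
      by (intro ell2_eqI)
        (simp add: calc_mult_id rep_mult orbit_rep_w[OF \<xi>] rep_scalar)
  next
    case (inverse f)
    then show ?case
      by (intro ell2_eqI)
        (simp add: calc_mult_cnj rep_mult orbit_rep_star_w[OF \<xi>] rep_scalar)
  next
    case (add f g)
    then show ?case by (simp add: calc_add rep_add blinfun.add_left scalar_op_simps)
  next
    case (limit f)
    let ?z = "\<mu> powi k * \<xi>" and ?e = "unit_vector k"
    have "norm (orbit_rep \<xi> (calc f) ?e - scalar_op (f ?z) ?e) \<le> 0"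
    proof (rule field_le_epsilon)
      fix e :: real assume "0 < e"
      then obtain g where g: "continuous_on unit_circle g"
        "orbit_rep \<xi> (calc g) ?e = scalar_op (g ?z) ?e" "\<forall>z\<in>unit_circle. cmod (f z - g z) \<le> e / 2"
        using limit.IH[of "e / 2"] by auto
      have "orbit_rep \<xi> (calc f) ?e - scalar_op (f ?z) ?e
          = orbit_rep \<xi> (calc f \<ominus> calc g) ?e - scalar_op (f ?z - g ?z) ?e"
        using limit.hyps g
        by (intro ell2_eqI) (simp add: rep_minus blinfun.diff_left algebra_simps)
      also have "norm \<dots> \<le> norm (orbit_rep \<xi> (calc f \<ominus> calc g) ?e) + norm (scalar_op (f ?z - g ?z) ?e)"
        by (rule norm_triangle_ineq4)
      also have "norm (orbit_rep \<xi> (calc f \<ominus> calc g) ?e) \<le> nrm A (calc f \<ominus> calc g)"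
        using limit.hyps g by (intro norm_rep_unit_vector_le) auto
      also have "\<dots> \<le> e / 2"
        using limit.hyps g by (intro calc_diff_le) auto
      also have "norm (scalar_op (f ?z - g ?z) ?e) \<le> e / 2"
        using g(3) orbit_circle[OF \<xi>] by (simp add: norm_scalar_op_apply)
      finally show "norm (orbit_rep \<xi> (calc f) ?e - scalar_op (f ?z) ?e) \<le> 0 + e" by simp
    qed
    then show ?case by simp
  qed
qed

end

text \<open>Applied to the polynomial elements, this turns the fact that x and w generate
  \<open>A\<close> into a density statement.\<close>

lemma (in unital_cstar_algebra) closure_cstar_subalgebra:
  assumes S: "S \<subseteq> carrier A" "\<one> \<in> S"
    and add: "\<And>a b. a \<in> S \<Longrightarrow> b \<in> S \<Longrightarrow> a \<oplus> b \<in> S"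
    and mult: "\<And>a b. a \<in> S \<Longrightarrow> b \<in> S \<Longrightarrow> a \<otimes> b \<in> S"
    and smult: "\<And>c a. a \<in> S \<Longrightarrow> c \<odot> a \<in> S"
    and star: "\<And>a. a \<in> S \<Longrightarrow> star A a \<in> S"
  shows "cstar_subalgebra {a \<in> carrier A. \<forall>e>0. \<exists>s\<in>S. nrm A (a \<ominus> s) < e} A" (is "cstar_subalgebra ?D A")
proof -
  have SA: "a \<in> S \<Longrightarrow> a \<in> carrier A" for a using S by blast
  have approx: "\<exists>s\<in>S. nrm A (a \<ominus> s) < e" if "a \<in> ?D" "0 < e" for a and e :: real
    using that by blast
  have smult_D: "c \<odot> a \<in> ?D" if a: "a \<in> ?D" for c a
  proof (intro CollectI conjI allI impI)
    fix e :: real assume "0 < e"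
    have pos: "0 < cmod c + 1" by (simp add: add_nonneg_pos)
    then obtain s where s: "s \<in> S" "nrm A (a \<ominus> s) < e / (cmod c + 1)"
      using approx[OF a, of "e / (cmod c + 1)"] \<open>0 < e\<close> by auto
    have "nrm A (c \<odot> a \<ominus> c \<odot> s) = cmod c * nrm A (a \<ominus> s)"
      using that SA[OF s(1)] by (simp add: nrm_smult flip: smult_minus_right)
    also have "\<dots> \<le> (cmod c + 1) * nrm A (a \<ominus> s)"
      using that SA[OF s(1)] by (intro mult_right_mono nrm_nonneg) auto
    also have "\<dots> < e" using s(2) pos by (simp add: field_simps)
    finally show "\<exists>s\<in>S. nrm A (c \<odot> a \<ominus> s) < e" using smult[OF s(1)] by blast
  qed (use that in auto)
  have "subring ?D A"
  proof (rule subringI)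
    have "nrm A (\<one> \<ominus> \<one>) = 0" by (simp add: M.minus_eq M.r_neg)
    then show "\<one> \<in> ?D" using S(2) by (auto intro!: bexI[of _ \<one>])
    show "\<ominus> a \<in> ?D" if "a \<in> ?D" for a
      using smult_D[OF that, of "- 1"] that by (simp add: smult_uminus_left)
  next
    fix a b assume a: "a \<in> ?D" and b: "b \<in> ?D"
    show "a \<oplus> b \<in> ?D"
    proof (intro CollectI conjI allI impI)
      fix e :: real assume "0 < e"
      then obtain s t where s: "s \<in> S" "nrm A (a \<ominus> s) < e / 2" and t: "t \<in> S" "nrm A (b \<ominus> t) < e / 2"
        using approx[OF a, of "e / 2"] approx[OF b, of "e / 2"] by auto
      have "(a \<oplus> b) \<ominus> (s \<oplus> t) = (a \<ominus> s) \<oplus> (b \<ominus> t)"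
        using a b SA[OF s(1)] SA[OF t(1)] by (simp add: M.minus_eq M.minus_add M.a_ac)
      also have "nrm A \<dots> < e"
        using nrm_triangle[of "a \<ominus> s" "b \<ominus> t"] s t a b SA[OF s(1)] SA[OF t(1)] by simp
      finally show "\<exists>u\<in>S. nrm A (a \<oplus> b \<ominus> u) < e" using add[OF s(1) t(1)] by blast
    qed (use a b in auto)
    show "a \<otimes> b \<in> ?D"
    proof (intro CollectI conjI allI impI)
      fix e :: real assume "0 < e"
      \<comment> \<open>The bound 1 keeps \<open>nrm A t\<close> at most \<open>nrm A b + 1\<close>;
        the other bound makes the two errors in the product add up to at most
        \<open>e / 2\<close>.\<close>
      define d where "d = min 1 (e / (2 * (nrm A a + nrm A b + 1)))"
      have ab: "a \<in> carrier A" "b \<in> carrier A" using a b by auto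
      have pos: "0 < nrm A a + nrm A b + 1" using nrm_nonneg[OF ab(1)] nrm_nonneg[OF ab(2)] by simp
      have d: "0 < d" "d \<le> 1" "d \<le> e / (2 * (nrm A a + nrm A b + 1))"
        using \<open>0 < e\<close> pos by (auto simp: d_def)
      have half: "e / (2 * K) * K < e" if "0 < K" for K :: real
        using that \<open>0 < e\<close> by simp
      obtain s t where s: "s \<in> S" "nrm A (a \<ominus> s) < d" and t: "t \<in> S" "nrm A (b \<ominus> t) < d"
        using approx[OF a d(1)] approx[OF b d(1)] by auto
      have st: "s \<in> carrier A" "t \<in> carrier A" using SA s t by auto
      have "nrm A t \<le> nrm A b + nrm A (t \<ominus> b)"
        using ab st by (intro nrm_le_add_minus)
      then have t_le: "nrm A t \<le> nrm A b + 1"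
        using t(2) d(2) nrm_minus_commute[OF ab(2) st(2)] by simp
      have "nrm A (a \<otimes> b \<ominus> s \<otimes> t) \<le> nrm A (a \<otimes> b \<ominus> a \<otimes> t) + nrm A (a \<otimes> t \<ominus> s \<otimes> t)"
        using ab st by (intro nrm_triangle3) auto
      also have "a \<otimes> b \<ominus> a \<otimes> t = a \<otimes> (b \<ominus> t)"
        using ab st by (simp add: M.minus_eq r_distr r_minus)
      also have "a \<otimes> t \<ominus> s \<otimes> t = (a \<ominus> s) \<otimes> t"
        using ab st by (simp add: M.minus_eq l_distr l_minus)
      also have "nrm A (a \<otimes> (b \<ominus> t)) \<le> nrm A a * d"
        using ab st t(2) by (intro order_trans[OF nrm_mult] mult_left_mono nrm_nonneg) auto
      also have "nrm A ((a \<ominus> s) \<otimes> t) \<le> d * (nrm A b + 1)"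
        using ab st s(2) d(1) t_le by (intro order_trans[OF nrm_mult] mult_mono nrm_nonneg) auto
      also have "nrm A a * d + d * (nrm A b + 1) = d * (nrm A a + nrm A b + 1)" by (simp add: algebra_simps)
      also have "\<dots> \<le> e / (2 * (nrm A a + nrm A b + 1)) * (nrm A a + nrm A b + 1)"
        using d(3) pos by (intro mult_right_mono) auto
      also have "\<dots> < e" by (rule half[OF pos])
      finally have "nrm A (a \<otimes> b \<ominus> s \<otimes> t) < e" by simp
      then show "\<exists>u\<in>S. nrm A (a \<otimes> b \<ominus> u) < e" using mult[OF s(1) t(1)] by blast
    qed (use a b in auto)
  qed auto
  moreover have "norm_closed A ?D"
    unfolding norm_closed_iff
  proof (intro conjI ballI impI CollectI allI)
    fix a and e :: real
    assume a: "a \<in> carrier A" "\<forall>e>0. \<exists>s\<in>?D. nrm A (a \<ominus> s) < e" and "0 < e"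
    then obtain s where s: "s \<in> ?D" "nrm A (a \<ominus> s) < e / 2"
      by (meson half_gt_zero)
    then obtain t where t: "t \<in> S" "nrm A (s \<ominus> t) < e / 2"
      using approx[OF s(1), of "e / 2"] \<open>0 < e\<close> by auto
    have "nrm A (a \<ominus> t) \<le> nrm A (a \<ominus> s) + nrm A (s \<ominus> t)"
      using a s SA[OF t(1)] by (intro nrm_triangle3) auto
    then show "\<exists>t\<in>S. nrm A (a \<ominus> t) < e" using s t by (intro bexI[of _ t]) auto
  qed auto
  moreover have "star A a \<in> ?D" if a: "a \<in> ?D" for a
  proof (intro CollectI conjI allI impI)
    fix e :: real assume "0 < e"
    then obtain s where s: "s \<in> S" "nrm A (a \<ominus> s) < e" using approx[OF a] by blast
    have "nrm A (star A a \<ominus> star A s) = nrm A (a \<ominus> s)"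
      using that SA[OF s(1)] by (simp flip: star_minus)
    then show "\<exists>s\<in>S. nrm A (star A a \<ominus> s) < e" using s star by (intro bexI[of _ "star A s"]) auto
  qed (use that in auto)
  ultimately show ?thesis
    unfolding cstar_subalgebra_def using smult_D by blast
qed

section \<open>The grading by powers of x\<close>

context rotation_algebra
begin

text \<open>The generator x need not be invertible, so powers of its adjoint take the place of
  negative powers. Products then obey the exponent law only up to a function of w.\<close>

definition gen_power :: "int \<Rightarrow> 'a" where
  "gen_power n = (if 0 \<le> n then x [^] nat n else star A x [^] nat (- n))"

lemma gen_power_closed [simp, intro]: "gen_power n \<in> carrier A"
  unfolding gen_power_def by (auto simp del: pow_nat)

lemma gen_power_0 [simp]: "gen_power 0 = \<one>"
  by (simp add: gen_power_def)

lemma x_gen_power: "0 \<le> n \<Longrightarrow> x \<otimes> gen_power n = gen_power (n + 1)"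
  using nat_pow_Suc2[OF x_closed, of "nat n"] by (simp add: gen_power_def nat_add_distrib del: pow_nat)

lemma star_x_gen_power: "n \<le> 0 \<Longrightarrow> star A x \<otimes> gen_power n = gen_power (n - 1)"
proof -
  assume "n \<le> 0"
  then have "nat (- (n - 1)) = Suc (nat (- n))" by simp
  moreover have "gen_power n = star A x [^] nat (- n)"
    using \<open>n \<le> 0\<close> by (cases "n = 0") (auto simp: gen_power_def simp del: pow_nat)
  ultimately show ?thesis
    using \<open>n \<le> 0\<close> nat_pow_Suc2[of "star A x" "nat (- n)"] by (simp add: gen_power_def del: nat_pow_Suc pow_nat)
qed

lemma gen_power_induct [case_names zero up down]:
  assumes "P 0" "\<And>n. 0 \<le> n \<Longrightarrow> P n \<Longrightarrow> P (n + 1)" "\<And>n. n \<le> 0 \<Longrightarrow> P n \<Longrightarrow> P (n - 1)"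
  shows "P (n :: int)"
  by (induction n rule: int_induct[where k = 0]) (use assms in auto)

lemma gen_power_calc:
  assumes "continuous_on unit_circle f"
  shows "gen_power n \<otimes> calc f = calc (rotated (- n) f) \<otimes> gen_power n"
proof (induction n rule: gen_power_induct)
  case zero
  then show ?case using assms by simp
next
  case (up n)
  have c: "continuous_on unit_circle (rotated (- n) f)" "continuous_on unit_circle (rotated (- 1 - n) f)"
    using assms by auto
  have "gen_power (n + 1) \<otimes> calc f = x \<otimes> (gen_power n \<otimes> calc f)"
    using up.hyps assms by (simp add: m_assoc flip: x_gen_power)
  also have "\<dots> = (x \<otimes> calc (rotated (- n) f)) \<otimes> gen_power n"
    unfolding up.IH using c by (simp add: m_assoc)
  also have "\<dots> = calc (rotated (- 1 - n) f) \<otimes> (x \<otimes> gen_power n)"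
    unfolding x_calc[OF c(1)] rotated_rotated using c by (simp add: m_assoc)
  finally show ?case using up.hyps by (simp add: x_gen_power algebra_simps)
next
  case (down n)
  have c: "continuous_on unit_circle (rotated (- n) f)" "continuous_on unit_circle (rotated (1 - n) f)"
    using assms by auto
  have "gen_power (n - 1) \<otimes> calc f = star A x \<otimes> (gen_power n \<otimes> calc f)"
    using down.hyps assms by (simp add: m_assoc flip: star_x_gen_power)
  also have "\<dots> = (star A x \<otimes> calc (rotated (- n) f)) \<otimes> gen_power n"
    unfolding down.IH using c by (simp add: m_assoc)
  also have "\<dots> = calc (rotated (1 - n) f) \<otimes> (star A x \<otimes> gen_power n)"
    unfolding star_x_calc[OF c(1)] rotated_rotated using c by (simp add: m_assoc)
  finally show ?case using down.hyps by (simp add: star_x_gen_power)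
qed

lemma star_gen_power: "star A (gen_power n) = gen_power (- n)"
proof -
  have "star A (y [^] k) = star A y [^] k" if "y \<in> carrier A" for y and k :: nat
  proof (induction k)
    case (Suc k)
    have "star A (y [^] Suc k) = star A y \<otimes> star A y [^] k"
      using that Suc by (simp add: star_mult)
    also have "\<dots> = star A y [^] Suc k"
      using that by (intro nat_pow_Suc2[symmetric]) auto
    finally show ?case .
  qed simp
  from this[of x] this[of "star A x"] show ?thesis
    by (cases "n = 0") (auto simp: gen_power_def star_star simp del: pow_nat)
qed

definition homogeneous :: "int \<Rightarrow> 'a set" where
  "homogeneous n = {calc f \<otimes> gen_power n | f. continuous_on unit_circle f}"

lemma homogeneousE:
  assumes "c \<in> homogeneous n"
  obtains f where "continuous_on unit_circle f" "c = calc f \<otimes> gen_power n"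
  using assms unfolding homogeneous_def by blast

lemma homogeneousI: "continuous_on unit_circle f \<Longrightarrow> calc f \<otimes> gen_power n \<in> homogeneous n"
  unfolding homogeneous_def by blast

lemma homogeneous_carrier: "c \<in> homogeneous n \<Longrightarrow> c \<in> carrier A"
  by (erule homogeneousE) simp

lemma homogeneous_calc_mult:
  assumes "continuous_on unit_circle f" "c \<in> homogeneous n"
  shows "calc f \<otimes> c \<in> homogeneous n"
proof -
  obtain g where g: "continuous_on unit_circle g" "c = calc g \<otimes> gen_power n"
    using assms(2) by (rule homogeneousE)
  have "calc f \<otimes> c = calc (\<lambda>z. f z * g z) \<otimes> gen_power n"
    using assms(1) g by (simp add: calc_mult m_assoc)
  then show ?thesis using homogeneousI[of "\<lambda>z. f z * g z" n] assms(1) g(1) by (simp add: continuous_on_mult)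
qed

lemma homogeneous_smult:
  assumes "c \<in> homogeneous n" shows "l \<odot> c \<in> homogeneous n"
  using homogeneous_calc_mult[of "\<lambda>_. l" c n] assms homogeneous_carrier[OF assms]
  by (simp add: calc_const smult_mult_left)

lemma homogeneous_add:
  assumes "c \<in> homogeneous n" "d \<in> homogeneous n" shows "c \<oplus> d \<in> homogeneous n"
proof -
  obtain f g where f: "continuous_on unit_circle f" "c = calc f \<otimes> gen_power n"
    and g: "continuous_on unit_circle g" "d = calc g \<otimes> gen_power n"
    using assms by (meson homogeneousE)
  have "c \<oplus> d = calc (\<lambda>z. f z + g z) \<otimes> gen_power n"
    using f g by (simp add: calc_add l_distr)
  then show ?thesis using homogeneousI[of "\<lambda>z. f z + g z" n] f(1) g(1) by (simp add: continuous_on_add)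
qed

text \<open>In negative degree x meets its adjoint, and the product
  \<open>x \<otimes> star A x\<close> is absorbed into the coefficient function. This is what makes
  the sums of homogeneous elements an algebra.\<close>

lemma x_homogeneous:
  assumes "c \<in> homogeneous n" shows "x \<otimes> c \<in> homogeneous (n + 1)"
proof -
  obtain f where f: "continuous_on unit_circle f" "c = calc f \<otimes> gen_power n"
    using assms by (rule homogeneousE)
  have r: "continuous_on unit_circle (rotated (- 1) f)" "continuous_on unit_circle (rotated (- 1) gam)"
    using f by auto
  have "x \<otimes> c = calc (rotated (- 1) f) \<otimes> (x \<otimes> gen_power n)"
    using f r by (simp add: x_calc flip: m_assoc)
  moreover have "x \<otimes> gen_power n \<in> homogeneous (n + 1)"
  proof (cases "0 \<le> n")
    case True
    then show ?thesis using homogeneousI[of "\<lambda>_. 1" "n + 1"] by (simp add: x_gen_power calc_one)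
  next
    case False
    then have "gen_power n = star A x \<otimes> gen_power (n + 1)"
      using star_x_gen_power[of "n + 1"] by simp
    then have "x \<otimes> gen_power n = calc (rotated (- 1) gam) \<otimes> gen_power (n + 1)"
      by (simp add: x_star_x flip: m_assoc)
    then show ?thesis using homogeneousI[OF r(2)] by simp
  qed
  ultimately show ?thesis using homogeneous_calc_mult[OF r(1)] by simp
qed

lemma star_x_homogeneous:
  assumes "c \<in> homogeneous n" shows "star A x \<otimes> c \<in> homogeneous (n - 1)"
proof -
  obtain f where f: "continuous_on unit_circle f" "c = calc f \<otimes> gen_power n"
    using assms by (rule homogeneousE)
  have r: "continuous_on unit_circle (rotated 1 f)"
    using f by auto
  have "star A x \<otimes> c = calc (rotated 1 f) \<otimes> (star A x \<otimes> gen_power n)"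
    using f r by (simp add: star_x_calc flip: m_assoc)
  moreover have "star A x \<otimes> gen_power n \<in> homogeneous (n - 1)"
  proof (cases "n \<le> 0")
    case True
    then show ?thesis using homogeneousI[of "\<lambda>_. 1" "n - 1"] by (simp add: star_x_gen_power calc_one)
  next
    case False
    then have "gen_power n = x \<otimes> gen_power (n - 1)"
      using x_gen_power[of "n - 1"] by simp
    then have "star A x \<otimes> gen_power n = calc gam \<otimes> gen_power (n - 1)"
      by (simp add: star_x_x flip: m_assoc)
    then show ?thesis using homogeneousI[OF continuous_on_gam] by simp
  qed
  ultimately show ?thesis using homogeneous_calc_mult[OF r(1)] by simp
qed

lemma gen_power_homogeneous:
  assumes "c \<in> homogeneous n" shows "gen_power m \<otimes> c \<in> homogeneous (m + n)"
proof (induction m rule: gen_power_induct)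
  case zero
  then show ?case using assms homogeneous_carrier by simp
next
  case (up m)
  have "gen_power (m + 1) \<otimes> c = x \<otimes> (gen_power m \<otimes> c)"
    using up.hyps homogeneous_carrier[OF assms] by (simp add: m_assoc flip: x_gen_power)
  then show ?case using x_homogeneous[OF up.IH] by (simp add: ac_simps)
next
  case (down m)
  have "gen_power (m - 1) \<otimes> c = star A x \<otimes> (gen_power m \<otimes> c)"
    using down.hyps homogeneous_carrier[OF assms] by (simp add: m_assoc flip: star_x_gen_power)
  then show ?case using star_x_homogeneous[OF down.IH] by (simp add: algebra_simps)
qed

lemma homogeneous_mult:
  assumes "c \<in> homogeneous m" "d \<in> homogeneous n" shows "c \<otimes> d \<in> homogeneous (m + n)"
proof -
  obtain f where f: "continuous_on unit_circle f" "c = calc f \<otimes> gen_power m"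
    using assms(1) by (rule homogeneousE)
  then have "c \<otimes> d = calc f \<otimes> (gen_power m \<otimes> d)"
    using homogeneous_carrier[OF assms(2)] by (simp add: m_assoc)
  then show ?thesis
    using homogeneous_calc_mult[OF f(1) gen_power_homogeneous[OF assms(2)]] by simp
qed

lemma homogeneous_star:
  assumes "c \<in> homogeneous n" shows "star A c \<in> homogeneous (- n)"
proof -
  obtain f where f: "continuous_on unit_circle f" "c = calc f \<otimes> gen_power n"
    using assms by (rule homogeneousE)
  have "continuous_on unit_circle (\<lambda>z. cnj (f z))" by (intro continuous_intros f)
  moreover have "star A c = gen_power (- n) \<otimes> calc (\<lambda>z. cnj (f z))"
    using f by (simp add: star_mult star_gen_power calc_star)
  ultimately show ?thesis
    using homogeneousI[of "rotated n (\<lambda>z. cnj (f z))" "- n"] by (auto simp: gen_power_calc)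
qed

lemma calc_homogeneous: "continuous_on unit_circle f \<Longrightarrow> calc f \<in> homogeneous 0"
  using homogeneousI[of f 0] by simp

lemma homogeneous_0E:
  assumes "c \<in> homogeneous 0"
  obtains f where "continuous_on unit_circle f" "c = calc f"
  using assms by (rule homogeneousE) simp

inductive_set poly_elements :: "'a set" where
  homogeneous: "c \<in> homogeneous n \<Longrightarrow> c \<in> poly_elements"
| add: "p \<in> poly_elements \<Longrightarrow> q \<in> poly_elements \<Longrightarrow> p \<oplus> q \<in> poly_elements"

lemma poly_elements_carrier: "p \<in> poly_elements \<Longrightarrow> p \<in> carrier A"
  by (induction rule: poly_elements.induct) (auto intro: homogeneous_carrier)

lemma poly_elements_smult: "p \<in> poly_elements \<Longrightarrow> l \<odot> p \<in> poly_elements"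
  by (induction rule: poly_elements.induct)
     (auto simp: smult_add_right poly_elements_carrier intro: poly_elements.intros homogeneous_smult)

lemma poly_elements_star: "p \<in> poly_elements \<Longrightarrow> star A p \<in> poly_elements"
  by (induction rule: poly_elements.induct)
     (auto simp: star_add poly_elements_carrier intro: poly_elements.intros homogeneous_star)

lemma poly_elements_mult:
  assumes "p \<in> poly_elements" "q \<in> poly_elements" shows "p \<otimes> q \<in> poly_elements"
  using assms(1)
proof induction
  case (homogeneous c n)
  from assms(2) show ?case
  proof induction
    case (homogeneous d m)
    then show ?case using homogeneous_mult[OF \<open>c \<in> homogeneous n\<close>] by (blast intro: poly_elements.homogeneous)
  next
    case (add p q)
    then show ?case
      using homogeneous_carrier[OF homogeneous] by (simp add: r_distr poly_elements_carrier poly_elements.add)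
  qed
next
  case (add p p')
  then show ?case
    using poly_elements_carrier[OF assms(2)] by (simp add: l_distr poly_elements_carrier poly_elements.add)
qed

lemma poly_elements_dense:
  assumes "a \<in> carrier A" "0 < e"
  obtains p where "p \<in> poly_elements" "nrm A (a \<ominus> p) < e"
proof -
  let ?D = "{a \<in> carrier A. \<forall>e>0. \<exists>p\<in>poly_elements. nrm A (a \<ominus> p) < e}"
  have one: "\<one> \<in> poly_elements"
    using poly_elements.homogeneous[OF calc_homogeneous[of "\<lambda>_. 1"]] by (simp add: calc_one)
  have w: "w \<in> poly_elements"
    using poly_elements.homogeneous[OF calc_homogeneous[of "\<lambda>z. z"]] by (simp add: calc_id)
  have x: "x \<in> poly_elements"
    using poly_elements.homogeneous[OF homogeneousI[of "\<lambda>_. 1" 1]] x_gen_power[of 0] by (simp add: calc_one)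
  have "cstar_subalgebra ?D A"
    by (rule closure_cstar_subalgebra)
       (use one in \<open>auto intro: poly_elements_carrier poly_elements.add poly_elements_mult poly_elements_smult poly_elements_star\<close>)
  moreover have "{x, w} \<subseteq> ?D"
    using bexI[of "\<lambda>p. nrm A (w \<ominus> p) < e" w for e, OF _ w] bexI[of "\<lambda>p. nrm A (x \<ominus> p) < e" x for e, OF _ x]
    by (auto simp: M.minus_eq M.r_neg)
  ultimately have "cstar_generated A {x, w} \<subseteq> ?D"
    unfolding cstar_generated_def by blast
  then show thesis using that assms generated by blast
qed

lemma orbit_rep_gen_power:
  assumes "\<xi> \<in> unit_circle"
  shows "\<exists>t. orbit_rep \<xi> (gen_power n) (unit_vector k) = scalar_op t (unit_vector (k + n))"
proof (induction n rule: gen_power_induct)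
  interpret representation A "orbit_rep \<xi>" by (rule orbit_rep[OF assms])
  {
    case zero
    then show ?case by (auto simp: rep_one scalar_op_simps intro!: exI[of _ 1])
  next
    case (up n)
    then obtain t where "orbit_rep \<xi> (gen_power n) (unit_vector k) = scalar_op t (unit_vector (k + n))" by blast
    then have "orbit_rep \<xi> (gen_power (n + 1)) (unit_vector k) = scalar_op t (orbit_rep \<xi> x (unit_vector (k + n)))"
      using up.hyps by (simp add: rep_mult rep_scalar flip: x_gen_power)
    then show ?case
      unfolding orbit_rep_x[OF assms] by (metis add.assoc blinfun_compose.rep_eq comp_apply scalar_op_simps(2))
  next
    case (down n)
    then obtain t where "orbit_rep \<xi> (gen_power n) (unit_vector k) = scalar_op t (unit_vector (k + n))" by blast
    then have "orbit_rep \<xi> (gen_power (n - 1)) (unit_vector k) = scalar_op t (orbit_rep \<xi> (star A x) (unit_vector (k + n)))"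
      using down.hyps by (simp add: rep_mult rep_scalar flip: star_x_gen_power)
    then show ?case
      unfolding orbit_rep_star_x[OF assms] by (metis add_diff_eq blinfun_compose.rep_eq comp_apply scalar_op_simps(2))
  }
qed

lemma orbit_rep_homogeneous:
  assumes \<xi>: "\<xi> \<in> unit_circle" and c: "c \<in> homogeneous n" and "j \<noteq> k + n"
  shows "coord (orbit_rep \<xi> c (unit_vector k)) j = 0"
proof -
  interpret representation A "orbit_rep \<xi>" by (rule orbit_rep[OF \<xi>])
  obtain f where f: "continuous_on unit_circle f" "c = calc f \<otimes> gen_power n"
    using c by (rule homogeneousE)
  obtain t where t: "orbit_rep \<xi> (gen_power n) (unit_vector k) = scalar_op t (unit_vector (k + n))"
    using orbit_rep_gen_power[OF \<xi>] by blast
  show ?thesis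
    using f \<open>j \<noteq> k + n\<close> by (simp add: rep_mult t rep_scalar orbit_rep_calc[OF \<xi> f(1)] coord_unit_vector)
qed

text \<open>The element \<open>star A c \<otimes> c\<close> has degree 0 and is therefore
  \<open>calc g\<close>, where \<open>g \<xi>\<close> is the squared norm of the image of the base
  vector in the orbit representation at \<xi>; only the coordinate \<open>n\<close> of this image
  can be nonzero. The C*-identity and the contractivity of \<open>calc\<close> then bound the norm
  in \<open>A\<close> itself, so the orbit representations already control homogeneous
  elements.\<close>

lemma homogeneous_nrm_le:
  assumes c: "c \<in> homogeneous n"
    and le: "\<And>\<xi>. \<xi> \<in> unit_circle \<Longrightarrow> cmod (coord (orbit_rep \<xi> c (unit_vector 0)) n) \<le> d"
  shows "nrm A c \<le> d"
proof -
  have cA: "c \<in> carrier A" by (rule homogeneous_carrier[OF c])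
  have "0 \<le> d" using order_trans[OF norm_ge_zero le[of 1]] by simp
  obtain g where g: "continuous_on unit_circle g" "star A c \<otimes> c = calc g"
    using homogeneous_mult[OF homogeneous_star[OF c] c] by (auto elim: homogeneous_0E)
  have "cmod (g \<xi>) \<le> d\<^sup>2" if \<xi>: "\<xi> \<in> unit_circle" for \<xi>
  proof -
    interpret representation A "orbit_rep \<xi>" by (rule orbit_rep[OF \<xi>])
    let ?u = "orbit_rep \<xi> c (unit_vector 0)"
    have "g \<xi> = complex_of_real ((norm ?u)\<^sup>2)"
      using coord_rep_star_mult[OF cA, of 0] orbit_rep_calc[OF \<xi> g(1), of 0] by (simp add: g coord_unit_vector)
    moreover have "?u = scalar_op (coord ?u n) (unit_vector n)"
      by (rule ell2_eqI) (use orbit_rep_homogeneous[OF \<xi> c, of _ 0] in \<open>auto simp: coord_unit_vector\<close>)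
    then have "norm ?u = cmod (coord ?u n)"
      by (metis mult.right_neutral norm_scalar_op_apply norm_unit_vector)
    ultimately show ?thesis using le[OF \<xi>] by (simp add: norm_power power_mono)
  qed
  then have "(nrm A c)\<^sup>2 \<le> d\<^sup>2"
    using calc_le[OF g(1)] g(2) cstar_identity[OF cA] by simp
  then show ?thesis using \<open>0 \<le> d\<close> by (rule power2_le_imp_le)
qed

end

section \<open>Fourier coefficients and faithfulness\<close>

lemma continuous_on_power_int_circle [simp, intro]: "continuous_on unit_circle (\<lambda>z. z powi k)"
  using laurent_continuous[OF laurent.monom[of 1 k]] by simp

context rotation_algebra
begin

definition w_power :: "int \<Rightarrow> 'a" where
  "w_power k = calc (\<lambda>z. z powi k)"

lemma w_power_closed [simp, intro]: "w_power k \<in> carrier A"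
  unfolding w_power_def by (rule calc_closed[OF continuous_on_power_int_circle])

definition conj_w :: "nat \<Rightarrow> 'a \<Rightarrow> 'a" where
  "conj_w k a = w_power (int k) \<otimes> a \<otimes> w_power (- int k)"

lemma conj_w_closed [simp, intro]: "a \<in> carrier A \<Longrightarrow> conj_w k a \<in> carrier A"
  by (simp add: conj_w_def)

lemma conj_w_add: "a \<in> carrier A \<Longrightarrow> b \<in> carrier A \<Longrightarrow> conj_w k (a \<oplus> b) = conj_w k a \<oplus> conj_w k b"
  by (simp add: conj_w_def l_distr r_distr)

lemma conj_w_nrm_le:
  assumes "a \<in> carrier A" shows "nrm A (conj_w k a) \<le> nrm A a"
proof -
  have le: "nrm A (w_power l) \<le> 1" for l
    unfolding w_power_def by (rule calc_le) (auto simp: norm_power_int)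
  have "nrm A (conj_w k a) \<le> nrm A (w_power (int k) \<otimes> a) * nrm A (w_power (- int k))"
    unfolding conj_w_def using assms by (intro nrm_mult) auto
  also have "\<dots> \<le> nrm A (w_power (int k) \<otimes> a) * 1"
    using assms by (intro mult_left_mono le nrm_nonneg) auto
  also have "nrm A (w_power (int k) \<otimes> a) \<le> nrm A (w_power (int k)) * nrm A a"
    using assms by (intro nrm_mult) auto
  also have "\<dots> \<le> 1 * nrm A a"
    using assms by (intro mult_right_mono le nrm_nonneg) auto
  finally show ?thesis by simp
qed

text \<open>Moving \<open>w_power (- int k)\<close> to the left across \<open>gen_power n\<close>
  rotates its argument and so produces the factor \<open>\<mu> powi (n * int k)\<close>; the powers
  of w then cancel.\<close>

lemma conj_w_homogeneous:
  assumes "c \<in> homogeneous n" shows "conj_w k c = \<mu> powi (n * int k) \<odot> c"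
proof -
  obtain f where f: "continuous_on unit_circle f" "c = calc f \<otimes> gen_power n"
    using assms by (rule homogeneousE)
  let ?k = "int k"
  have r: "rotated (- n) (\<lambda>z. z powi (- ?k)) = (\<lambda>z. \<mu> powi (n * ?k) * z powi (- ?k))"
    by (rule ext) (simp add: rotated_def power_int_mult_distrib flip: power_int_mult)
  have c1: "continuous_on unit_circle (\<lambda>z. \<mu> powi (n * ?k) * z powi (- ?k))"
    by (intro continuous_intros) auto
  have "conj_w k c = w_power ?k \<otimes> (calc f \<otimes> (gen_power n \<otimes> w_power (- ?k)))"
    unfolding conj_w_def f(2) using f(1) by (simp add: m_assoc)
  also have "\<dots> = w_power ?k \<otimes> (calc f \<otimes> calc (\<lambda>z. \<mu> powi (n * ?k) * z powi (- ?k))) \<otimes> gen_power n"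
    unfolding w_power_def[of "- ?k"] gen_power_calc[OF continuous_on_power_int_circle] r
    using f(1) calc_closed[OF c1] by (simp add: m_assoc)
  also have "calc f \<otimes> calc (\<lambda>z. \<mu> powi (n * ?k) * z powi (- ?k)) = calc (\<lambda>z. f z * (\<mu> powi (n * ?k) * z powi (- ?k)))"
    by (rule calc_mult[OF f(1) c1, symmetric])
  also have "w_power ?k \<otimes> \<dots> = calc (\<lambda>z. z powi ?k * (f z * (\<mu> powi (n * ?k) * z powi (- ?k))))"
    unfolding w_power_def by (rule calc_mult[symmetric]) (intro continuous_on_mult f(1) c1 continuous_on_power_int_circle)+
  also have "\<dots> = calc (\<lambda>z. \<mu> powi (n * ?k) * f z)"
  proof (rule calc_cong)
    fix z :: complex assume "z \<in> unit_circle"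
    then have "z \<noteq> 0" by auto
    then show "z powi ?k * (f z * (\<mu> powi (n * ?k) * z powi (- ?k))) = \<mu> powi (n * ?k) * f z"
      by (simp add: power_int_minus)
  qed
  also have "\<dots> \<otimes> gen_power n = \<mu> powi (n * ?k) \<odot> c"
    using f by (simp add: calc_smult smult_mult_left)
  finally show ?thesis .
qed

section \<open>Weighted averages of conjugates\<close>

primrec average :: "(nat \<Rightarrow> complex) \<Rightarrow> 'a \<Rightarrow> nat \<Rightarrow> 'a" where
  "average c a 0 = \<zero>"
| "average c a (Suc M) = average c a M \<oplus> c M \<odot> conj_w M a"

lemma average_closed [simp, intro]: "a \<in> carrier A \<Longrightarrow> average c a M \<in> carrier A"
  by (induction M) auto

lemma average_add:
  assumes "a \<in> carrier A" "b \<in> carrier A"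
  shows "average c (a \<oplus> b) M = average c a M \<oplus> average c b M"
  by (induction M) (use assms in \<open>simp_all add: conj_w_add smult_add_right M.a_ac\<close>)

lemma average_nrm_le:
  assumes "a \<in> carrier A" shows "nrm A (average c a M) \<le> (\<Sum>k<M. cmod (c k)) * nrm A a"
proof (induction M)
  case (Suc M)
  have "nrm A (average c a (Suc M)) \<le> nrm A (average c a M) + cmod (c M) * nrm A (conj_w M a)"
    using nrm_triangle[of "average c a M" "c M \<odot> conj_w M a"] assms by (simp add: nrm_smult)
  also have "\<dots> \<le> (\<Sum>k<M. cmod (c k)) * nrm A a + cmod (c M) * nrm A a"
    by (intro add_mono Suc mult_left_mono conj_w_nrm_le assms) simp
  finally show ?case by (simp add: distrib_right)
qed simp

lemma average_minus:
  assumes "a \<in> carrier A" "b \<in> carrier A"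
  shows "average c (a \<ominus> b) M = average c a M \<ominus> average c b M"
proof -
  have "a = (a \<ominus> b) \<oplus> b" using assms by algebra
  then have "average c a M = average c (a \<ominus> b) M \<oplus> average c b M"
    using average_add[of "a \<ominus> b" b c M] assms by simp
  moreover have "(u \<oplus> v) \<ominus> v = u" if "u \<in> carrier A" "v \<in> carrier A" for u v
    using that by algebra
  ultimately show ?thesis using assms by simp
qed

lemma average_homogeneous:
  assumes "a \<in> homogeneous n"
  shows "average c a M = (\<Sum>k<M. c k * \<mu> powi (n * int k)) \<odot> a"
  by (induction M)
     (use homogeneous_carrier[OF assms] in \<open>simp_all add: conj_w_homogeneous[OF assms] smult_smult smult_add_left\<close>)

text \<open>With the expansion \<open>fejer_weight_eq\<close> this bounds a Fejer mean by Fourier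
  means.\<close>

lemma average_weights_sum_nrm_le:
  assumes "finite J" "a \<in> carrier A"
  shows "nrm A (average (\<lambda>k. \<Sum>p\<in>J. l * c p k) a M) \<le> (\<Sum>p\<in>J. cmod l * nrm A (average (c p) a M))"
  using assms(1)
proof induction
  case empty
  have "average (\<lambda>k. 0) a M = \<zero>" by (induction M) (use assms(2) in auto)
  then show ?case by simp
next
  case (insert p J)
  have lin: "average (\<lambda>k. l * c k + d k) a M = l \<odot> average c a M \<oplus> average d a M" for c d
    by (induction M) (use assms(2) in \<open>simp_all add: smult_add_left smult_add_right smult_smult M.a_ac\<close>)
  have "nrm A (average (\<lambda>k. \<Sum>p\<in>insert p J. l * c p k) a M)
      \<le> cmod l * nrm A (average (c p) a M) + nrm A (average (\<lambda>k. \<Sum>p\<in>J. l * c p k) a M)"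
    using insert.hyps nrm_triangle[of "l \<odot> average (c p) a M" "average (\<lambda>k. \<Sum>p\<in>J. l * c p k) a M"] assms(2)
    by (simp add: lin nrm_smult)
  then show ?case using insert by simp
qed

text \<open>A homogeneous element of degree m is an eigenvector of all conjugations, so its means
  converge to itself if m is n and to 0 otherwise; sums follow. The second half says that the limit
  carries the n-th off-diagonal of \<open>p\<close> in every orbit representation, so the
  coefficients can be measured there.\<close>

lemma fourier_coefficient:
  assumes "p \<in> poly_elements"
  shows "\<exists>c\<in>homogeneous n. (\<lambda>M. nrm A (average (fourier_weight n M) p M \<ominus> c)) \<longlonglongrightarrow> 0 \<and>
    (\<forall>\<xi>\<in>unit_circle. \<forall>k. coord (orbit_rep \<xi> c (unit_vector k)) (k + n) = coord (orbit_rep \<xi> p (unit_vector k)) (k + n))"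
  using assms
proof induction
  case (homogeneous p m)
  have pA: "p \<in> carrier A" by (rule homogeneous_carrier[OF homogeneous])
  define t where "t = (if m = n then 1 else 0 :: complex)"
  have "(\<lambda>M. cmod ((\<Sum>k<M. fourier_weight n M k * \<mu> powi (m * int k)) - t) * nrm A p) \<longlonglongrightarrow> cmod (t - t) * nrm A p"
    unfolding t_def by (intro tendsto_intros fourier_weight_tendsto)
  then have lim: "(\<lambda>M. nrm A (average (fourier_weight n M) p M \<ominus> t \<odot> p)) \<longlonglongrightarrow> 0"
    by (simp add: average_homogeneous[OF homogeneous] nrm_smult_minus_smult[OF pA])
  have "t \<odot> p \<in> homogeneous n"
  proof (cases "m = n")
    case True
    then show ?thesis using homogeneous homogeneous_smult by blast
  next
    case False
    have "calc (\<lambda>_. 0) \<otimes> gen_power n \<in> homogeneous n" by (rule homogeneousI) simp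
    then show ?thesis using False pA by (simp add: t_def calc_zero)
  qed
  moreover have "coord (orbit_rep \<xi> (t \<odot> p) (unit_vector k)) (k + n) = coord (orbit_rep \<xi> p (unit_vector k)) (k + n)"
    if \<xi>: "\<xi> \<in> unit_circle" for \<xi> k
  proof -
    interpret representation A "orbit_rep \<xi>" by (rule orbit_rep[OF \<xi>])
    show ?thesis
      using orbit_rep_homogeneous[OF \<xi> homogeneous, of "k + n" k] pA by (auto simp: t_def rep_smult)
  qed
  ultimately show ?case using lim by blast
next
  case (add p q)
  obtain c where c: "c \<in> homogeneous n" "(\<lambda>M. nrm A (average (fourier_weight n M) p M \<ominus> c)) \<longlonglongrightarrow> 0"
    "\<forall>\<xi>\<in>unit_circle. \<forall>k. coord (orbit_rep \<xi> c (unit_vector k)) (k + n) = coord (orbit_rep \<xi> p (unit_vector k)) (k + n)"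
    using add.IH(1) by blast
  obtain d where d: "d \<in> homogeneous n" "(\<lambda>M. nrm A (average (fourier_weight n M) q M \<ominus> d)) \<longlonglongrightarrow> 0"
    "\<forall>\<xi>\<in>unit_circle. \<forall>k. coord (orbit_rep \<xi> d (unit_vector k)) (k + n) = coord (orbit_rep \<xi> q (unit_vector k)) (k + n)"
    using add.IH(2) by blast
  have carr: "p \<in> carrier A" "q \<in> carrier A" "c \<in> carrier A" "d \<in> carrier A"
    using add.hyps c(1) d(1) by (auto intro: poly_elements_carrier homogeneous_carrier)
  have "(\<lambda>M. nrm A (average (fourier_weight n M) (p \<oplus> q) M \<ominus> (c \<oplus> d))) \<longlonglongrightarrow> 0"
  proof (rule tendsto_sandwich[OF _ _ tendsto_const])
    show "\<forall>\<^sub>F M in sequentially. 0 \<le> nrm A (average (fourier_weight n M) (p \<oplus> q) M \<ominus> (c \<oplus> d))"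
      using carr by (simp add: nrm_nonneg)
    show "\<forall>\<^sub>F M in sequentially. nrm A (average (fourier_weight n M) (p \<oplus> q) M \<ominus> (c \<oplus> d))
      \<le> nrm A (average (fourier_weight n M) p M \<ominus> c) + nrm A (average (fourier_weight n M) q M \<ominus> d)"
      using carr by (simp add: average_add nrm_add_minus_add_le)
    show "(\<lambda>M. nrm A (average (fourier_weight n M) p M \<ominus> c) + nrm A (average (fourier_weight n M) q M \<ominus> d)) \<longlonglongrightarrow> 0"
      using tendsto_add[OF c(2) d(2)] by simp
  qed
  moreover have "coord (orbit_rep \<xi> (c \<oplus> d) (unit_vector k)) (k + n) = coord (orbit_rep \<xi> (p \<oplus> q) (unit_vector k)) (k + n)"
    if \<xi>: "\<xi> \<in> unit_circle" for \<xi> k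
  proof -
    interpret representation A "orbit_rep \<xi>" by (rule orbit_rep[OF \<xi>])
    show ?thesis using c(3) d(3) \<xi> carr by (simp add: rep_add blinfun.add_left)
  qed
  ultimately show ?case using homogeneous_add[OF c(1) d(1)] by blast
qed

text \<open>The limit in M multiplies degree n by its Fejer coefficient, and only the limit in N
  restores the element; hence the nested quantifiers.\<close>

lemma fejer_average:
  assumes "p \<in> poly_elements" "0 < e"
  shows "\<forall>\<^sub>F N in sequentially. \<forall>\<^sub>F M in sequentially. nrm A (average (fejer_weight N M) p M \<ominus> p) < e"
  using assms
proof (induction arbitrary: e)
  case (homogeneous p n)
  have pA: "p \<in> carrier A" by (rule homogeneous_carrier[OF homogeneous.hyps])
  have "(\<lambda>N. cmod (of_nat (N - nat \<bar>n\<bar>) / of_nat N - 1) * nrm A p) \<longlonglongrightarrow> cmod (1 - 1) * nrm A p"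
    by (intro tendsto_intros fejer_coefficient_tendsto)
  then have "\<forall>\<^sub>F N in sequentially. cmod (of_nat (N - nat \<bar>n\<bar>) / of_nat N - 1) * nrm A p < e"
    by (rule order_tendstoD(2)) (use \<open>0 < e\<close> in simp)
  then show ?case
    using eventually_gt_at_top[of 0]
  proof eventually_elim
    case (elim N)
    have "(\<lambda>M. cmod ((\<Sum>k<M. fejer_weight N M k * \<mu> powi (n * int k)) - 1) * nrm A p)
        \<longlonglongrightarrow> cmod (of_nat (N - nat \<bar>n\<bar>) / of_nat N - 1) * nrm A p"
      by (intro tendsto_intros fejer_weight_tendsto elim)
    then have "\<forall>\<^sub>F M in sequentially. cmod ((\<Sum>k<M. fejer_weight N M k * \<mu> powi (n * int k)) - 1) * nrm A p < e"
      by (rule order_tendstoD(2)) (use elim in simp)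
    then show ?case
    proof eventually_elim
      case (elim M)
      then show ?case
        using nrm_smult_minus_smult[OF pA, of _ 1] pA by (simp add: average_homogeneous[OF homogeneous.hyps])
    qed
  qed
next
  case (add p q)
  have "0 < e / 2" using add.prems by simp
  from add.IH(1)[OF this] add.IH(2)[OF this] show ?case
  proof eventually_elim
    case (elim N)
    from elim show ?case
    proof eventually_elim
      case (elim M)
      have carr: "p \<in> carrier A" "q \<in> carrier A" using add.hyps by (auto intro: poly_elements_carrier)
      then have "nrm A (average (fejer_weight N M) (p \<oplus> q) M \<ominus> (p \<oplus> q))
          \<le> nrm A (average (fejer_weight N M) p M \<ominus> p) + nrm A (average (fejer_weight N M) q M \<ominus> q)"
        by (simp add: average_add nrm_add_minus_add_le)
      then show ?case using elim by simp
    qed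
  qed
qed

text \<open>If all orbit representations kill \<open>a\<close> at the base vector, then polynomial elements \<open>q\<close> close to
  \<open>a\<close> have uniformly small Fourier coefficients.  The Fejer means of \<open>a\<close> only involve finitely many of
  them, so they vanish, whereas they converge to \<open>a\<close>.\<close>

lemma faithful:
  assumes a: "a \<in> carrier A" and zero: "\<And>\<xi>. \<xi> \<in> unit_circle \<Longrightarrow> orbit_rep \<xi> a (unit_vector 0) = 0"
  shows "a = \<zero>"
proof (rule eqI_nrm)
  fix e' :: real assume "0 < e'"
  \<comment> \<open>The Fejer mean of \<open>p\<close> will have norm at most \<open>5 * e\<close>,
    hence \<open>p\<close> at most \<open>6 * e\<close> and \<open>a\<close> at most
    \<open>7 * e\<close>.\<close>
  define e where "e = e' / 7"
  have "0 < e" using \<open>0 < e'\<close> by (simp add: e_def)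
  obtain p where p: "p \<in> poly_elements" "nrm A (a \<ominus> p) < e"
    using poly_elements_dense[OF a \<open>0 < e\<close>] by blast
  have pA: "p \<in> carrier A" by (rule poly_elements_carrier[OF p(1)])
  obtain N where N: "0 < N" "\<forall>\<^sub>F M in sequentially. nrm A (average (fejer_weight N M) p M \<ominus> p) < e"
    using eventually_happens'[OF sequentially_bot
      eventually_conj[OF eventually_gt_at_top[of "0::nat"] fejer_average[OF p(1) \<open>0 < e\<close>]]] by blast
  \<comment> \<open>\<open>N\<close> is fixed by \<open>p\<close>, while the accuracy demanded of
    the second approximation \<open>q\<close> depends on \<open>N\<close>; hence two approximations.
    Each Fourier mean of \<open>q\<close> will be at most \<open>e / N\<close>, and
    \<open>N * N\<close> of them with coefficient \<open>1 / N\<close> add up to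
    \<open>e\<close>.\<close>
  define d where "d = min e (e / (2 * real N))"
  have "0 < d" using \<open>0 < e\<close> N(1) by (simp add: d_def)
  obtain q where q: "q \<in> poly_elements" "nrm A (a \<ominus> q) < d"
    using poly_elements_dense[OF a \<open>0 < d\<close>] by blast
  have qA: "q \<in> carrier A" by (rule poly_elements_carrier[OF q(1)])
  have coeff: "\<forall>\<^sub>F M in sequentially. nrm A (average (fourier_weight n M) q M) \<le> e / real N" for n
  proof -
    obtain c where c: "c \<in> homogeneous n" "(\<lambda>M. nrm A (average (fourier_weight n M) q M \<ominus> c)) \<longlonglongrightarrow> 0"
      "\<forall>\<xi>\<in>unit_circle. \<forall>k. coord (orbit_rep \<xi> c (unit_vector k)) (k + n) = coord (orbit_rep \<xi> q (unit_vector k)) (k + n)"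
      using fourier_coefficient[OF q(1)] by blast
    have cA: "c \<in> carrier A" by (rule homogeneous_carrier[OF c(1)])
    have "nrm A c \<le> d"
    proof (rule homogeneous_nrm_le[OF c(1)])
      fix \<xi> :: complex assume \<xi>: "\<xi> \<in> unit_circle"
      interpret representation A "orbit_rep \<xi>" by (rule orbit_rep[OF \<xi>])
      have "coord (orbit_rep \<xi> c (unit_vector 0)) n = coord (orbit_rep \<xi> (q \<ominus> a) (unit_vector 0)) n"
        using c(3)[rule_format, OF \<xi>, of 0] zero[OF \<xi>] a qA by (simp add: rep_minus blinfun.diff_left)
      also have "cmod \<dots> \<le> nrm A (q \<ominus> a)"
        using a qA by (intro coord_rep_le) auto
      also have "\<dots> \<le> d" using q(2) nrm_minus_commute[OF a qA] by simp
      finally show "cmod (coord (orbit_rep \<xi> c (unit_vector 0)) n) \<le> d" .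
    qed
    have "0 < e / (2 * real N)" using \<open>0 < e\<close> N(1) by simp
    with c(2) have "\<forall>\<^sub>F M in sequentially. nrm A (average (fourier_weight n M) q M \<ominus> c) < e / (2 * real N)"
      by (rule order_tendstoD(2))
    then show ?thesis
    proof eventually_elim
      case (elim M)
      have "nrm A (average (fourier_weight n M) q M) \<le> nrm A c + nrm A (average (fourier_weight n M) q M \<ominus> c)"
        using cA qA by (intro nrm_le_add_minus) auto
      also have "\<dots> \<le> e / (2 * real N) + e / (2 * real N)"
        using elim \<open>nrm A c \<le> d\<close> by (intro add_mono) (auto simp: d_def)
      finally show ?case by simp
    qed
  qed
  let ?J = "{..<N} \<times> {..<N}"
  have "\<forall>\<^sub>F M in sequentially. \<forall>r\<in>?J. nrm A (average (fourier_weight (int (snd r) - int (fst r)) M) q M) \<le> e / real N"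
    by (rule eventually_ball_finite) (auto intro: coeff)
  from eventually_conj[OF this eventually_conj[OF N(2) fejer_weight_mass[OF N(1)]]]
  obtain M where coeff_M: "\<forall>r\<in>?J. nrm A (average (fourier_weight (int (snd r) - int (fst r)) M) q M) \<le> e / real N"
    and p_M: "nrm A (average (fejer_weight N M) p M \<ominus> p) < e"
    and mass: "(\<Sum>k<M. cmod (fejer_weight N M k)) < 2"
    using eventually_happens'[OF sequentially_bot] by blast
  have "nrm A (average (fejer_weight N M) q M)
      \<le> (\<Sum>r\<in>?J. cmod (1 / of_nat N) * nrm A (average (fourier_weight (int (snd r) - int (fst r)) M) q M))"
    unfolding fejer_weight_eq by (rule average_weights_sum_nrm_le) (use qA in auto)
  also have "\<dots> \<le> (\<Sum>r\<in>?J. cmod (1 / of_nat N) * (e / real N))"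
    using coeff_M by (intro sum_mono mult_left_mono) auto
  also have "\<dots> = e" using N(1) by (simp add: norm_divide)
  finally have q_M: "nrm A (average (fejer_weight N M) q M) \<le> e" .
  have pq: "nrm A (p \<ominus> q) \<le> 2 * e"
    using nrm_triangle3[OF pA a qA] p(2) q(2) nrm_minus_commute[OF a pA] by (simp add: d_def)
  have "nrm A (average (fejer_weight N M) p M)
      \<le> nrm A (average (fejer_weight N M) q M) + nrm A (average (fejer_weight N M) (p \<ominus> q) M)"
    unfolding average_minus[OF pA qA] using pA qA by (intro nrm_le_add_minus) auto
  \<comment> \<open>The mass is below 2 and the distance between \<open>p\<close> and
    \<open>q\<close> is at most \<open>2 * e\<close>.\<close>
  also have "nrm A (average (fejer_weight N M) (p \<ominus> q) M) \<le> 2 * (2 * e)"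
    using pA qA mass pq \<open>0 < e\<close>
    by (intro order_trans[OF average_nrm_le] mult_mono) (auto intro: sum_nonneg nrm_nonneg)
  finally have "nrm A (average (fejer_weight N M) p M) \<le> 5 * e" using q_M by simp
  moreover have "nrm A p \<le> nrm A (average (fejer_weight N M) p M) + nrm A (p \<ominus> average (fejer_weight N M) p M)"
    using pA by (intro nrm_le_add_minus) auto
  ultimately have "nrm A p \<le> 6 * e"
    using p_M nrm_minus_commute[of p "average (fejer_weight N M) p M"] pA by simp
  then show "nrm A (a \<ominus> \<zero>) \<le> e'"
    using nrm_le_add_minus[OF a pA] p(2) a by (simp add: e_def)
qed (use a in auto)

text \<open>The conditional expectation onto the functions of w, read off at the base vector of each
  orbit representation.\<close>

definition diagonal :: "'a \<Rightarrow> complex \<Rightarrow> complex" where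
  "diagonal a \<xi> = coord (orbit_rep \<xi> a (unit_vector 0)) 0"

lemma diagonal_diff_le:
  assumes "a \<in> carrier A" "b \<in> carrier A" "\<xi> \<in> unit_circle"
  shows "cmod (diagonal a \<xi> - diagonal b \<xi>) \<le> nrm A (a \<ominus> b)"
proof -
  interpret representation A "orbit_rep \<xi>" by (rule orbit_rep[OF assms(3)])
  show ?thesis
    using coord_rep_le[of "a \<ominus> b" 0 0] assms(1,2) by (simp add: diagonal_def rep_minus blinfun.diff_left)
qed

text \<open>One function serves all base points and all positions on the diagonal, so averages of
  diagonal entries along one orbit become orbit averages of this function.\<close>

lemma poly_elements_diagonal:
  assumes "p \<in> poly_elements"
  obtains f where "continuous_on unit_circle f" "\<And>\<xi>. \<xi> \<in> unit_circle \<Longrightarrow> diagonal p \<xi> = f \<xi>"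
    "\<And>\<xi> k. \<xi> \<in> unit_circle \<Longrightarrow> coord (orbit_rep \<xi> p (unit_vector k)) k = f (\<mu> powi k * \<xi>)"
    "(\<lambda>M. nrm A (average (fourier_weight 0 M) p M \<ominus> calc f)) \<longlonglongrightarrow> 0"
proof -
  obtain c where c: "c \<in> homogeneous 0" "(\<lambda>M. nrm A (average (fourier_weight 0 M) p M \<ominus> c)) \<longlonglongrightarrow> 0"
    "\<forall>\<xi>\<in>unit_circle. \<forall>k. coord (orbit_rep \<xi> c (unit_vector k)) (k + 0) = coord (orbit_rep \<xi> p (unit_vector k)) (k + 0)"
    using fourier_coefficient[OF assms] by blast
  obtain f where f: "continuous_on unit_circle f" "c = calc f" using c(1) by (rule homogeneous_0E)
  have k: "coord (orbit_rep \<xi> p (unit_vector k)) k = f (\<mu> powi k * \<xi>)" if "\<xi> \<in> unit_circle" for \<xi> k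
    using c(3)[rule_format, OF that, of k] orbit_rep_calc[OF that f(1), of k] by (simp add: f(2) coord_unit_vector)
  then have "diagonal p \<xi> = f \<xi>" if "\<xi> \<in> unit_circle" for \<xi>
    using that k[of \<xi> 0] by (simp add: diagonal_def)
  then show thesis using that[OF f(1) _ k] c(2) f(2) by blast
qed

lemma continuous_on_diagonal [simp, intro]:
  assumes "a \<in> carrier A" shows "continuous_on unit_circle (diagonal a)"
proof -
  have "\<exists>p. p \<in> poly_elements \<and> nrm A (a \<ominus> p) < 1 / real (Suc n)" for n
    using poly_elements_dense[OF assms, of "1 / real (Suc n)"] by (metis of_nat_0_less_iff zero_less_Suc zero_less_divide_1_iff)
  then obtain p where p: "p n \<in> poly_elements" "nrm A (a \<ominus> p n) < 1 / real (Suc n)" for n by metis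
  have "continuous_on unit_circle (diagonal (p n))" for n
  proof -
    obtain f where "continuous_on unit_circle f" "\<And>\<xi>. \<xi> \<in> unit_circle \<Longrightarrow> diagonal (p n) \<xi> = f \<xi>"
      by (rule poly_elements_diagonal[OF p(1)[of n]]) blast
    then show ?thesis by (subst continuous_on_cong[OF refl, of _ _ f]) auto
  qed
  moreover have "uniform_limit unit_circle (\<lambda>n. diagonal (p n)) (diagonal a) sequentially"
  proof (rule uniform_limitI)
    fix e :: real assume "0 < e"
    have "\<forall>\<^sub>F n in sequentially. 1 / real (Suc n) < e"
      using LIMSEQ_inverse_real_of_nat \<open>0 < e\<close> by (auto simp: inverse_eq_divide dest: order_tendstoD(2))
    then show "\<forall>\<^sub>F n in sequentially. \<forall>\<xi>\<in>unit_circle. dist (diagonal (p n) \<xi>) (diagonal a \<xi>) < e"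
    proof eventually_elim
      case (elim n)
      show ?case
        using elim p(2)[of n] diagonal_diff_le[OF assms poly_elements_carrier[OF p(1)[of n]]]
        by (fastforce simp: dist_norm norm_minus_commute)
    qed
  qed
  ultimately show ?thesis
    by (intro uniform_limit_theorem[where F = sequentially and f = "\<lambda>n. diagonal (p n)"]) auto
qed

text \<open>Averages of conjugates of \<open>a\<close> stay in the ideal. For a nearby polynomial
  element \<open>p\<close> they converge to \<open>calc\<close> of its diagonal. Passing from
  \<open>a\<close> to \<open>p\<close> costs at most \<open>nrm A (a \<ominus> p)\<close> in the
  averages, as the Fourier weights have mass at most 1, and as much in the diagonals, as
  \<open>calc\<close> is contractive.\<close>

lemma expectation_in_ideal:
  assumes I: "ideal I A" "norm_closed A I" and a: "a \<in> I"
  shows "calc (diagonal a) \<in> I"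
proof -
  interpret I: ideal I A by (rule I(1))
  have aA: "a \<in> carrier A" using a I.a_subset by blast
  have avg: "average c a M \<in> I" for c M
  proof (induction M)
    case (Suc M)
    have "conj_w M a \<in> I"
      unfolding conj_w_def
      by (rule I.I_r_closed[OF I.I_l_closed[OF a w_power_closed] w_power_closed])
    then have "c M \<odot> \<one> \<otimes> conj_w M a \<in> I" by (intro I.I_l_closed) auto
    then have "c M \<odot> conj_w M a \<in> I" using aA by (simp add: smult_mult_left)
    then show ?case using Suc by (simp add: I.a_closed)
  qed (simp add: I.zero_closed)
  have "\<exists>s\<in>I. nrm A (calc (diagonal a) \<ominus> s) < e" if "0 < e" for e
  proof -
    obtain p where p: "p \<in> poly_elements" "nrm A (a \<ominus> p) < e / 3"
      using poly_elements_dense[OF aA, of "e / 3"] \<open>0 < e\<close> by auto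
    have pA: "p \<in> carrier A" by (rule poly_elements_carrier[OF p(1)])
    obtain f where f: "continuous_on unit_circle f" "\<And>\<xi>. \<xi> \<in> unit_circle \<Longrightarrow> diagonal p \<xi> = f \<xi>"
      "(\<lambda>M. nrm A (average (fourier_weight 0 M) p M \<ominus> calc f)) \<longlonglongrightarrow> 0"
      by (rule poly_elements_diagonal[OF p(1)]) blast
    have "\<forall>\<^sub>F M in sequentially. nrm A (average (fourier_weight 0 M) p M \<ominus> calc f) < e / 3"
      using f(3) by (rule order_tendstoD(2)) (use \<open>0 < e\<close> in simp)
    then obtain M where M: "nrm A (average (fourier_weight 0 M) p M \<ominus> calc f) < e / 3"
      using eventually_happens'[OF sequentially_bot] by blast
    have "nrm A (calc (diagonal a) \<ominus> calc f) \<le> nrm A (a \<ominus> p)"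
      using diagonal_diff_le[OF aA pA] aA f(1) by (intro calc_diff_le) (auto simp flip: f(2))
    moreover have "nrm A (average (fourier_weight 0 M) p M \<ominus> average (fourier_weight 0 M) a M) \<le> 1 * nrm A (a \<ominus> p)"
    proof -
      have "(\<Sum>k<M. cmod (fourier_weight 0 M k)) \<le> 1"
        by (simp add: fourier_weight_def norm_divide)
      then have "nrm A (average (fourier_weight 0 M) (p \<ominus> a) M) \<le> 1 * nrm A (p \<ominus> a)"
        using aA pA by (intro order_trans[OF average_nrm_le] mult_right_mono nrm_nonneg) auto
      then show ?thesis using aA pA nrm_minus_commute[OF aA pA] by (simp add: average_minus)
    qed
    moreover have "nrm A (calc (diagonal a) \<ominus> average (fourier_weight 0 M) a M)
        \<le> nrm A (calc (diagonal a) \<ominus> calc f) + nrm A (calc f \<ominus> average (fourier_weight 0 M) a M)"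
      using aA f(1) by (intro nrm_triangle3) auto
    moreover have "nrm A (calc f \<ominus> average (fourier_weight 0 M) a M)
        \<le> nrm A (calc f \<ominus> average (fourier_weight 0 M) p M) + nrm A (average (fourier_weight 0 M) p M \<ominus> average (fourier_weight 0 M) a M)"
      using aA pA f(1) by (intro nrm_triangle3) auto
    moreover have "nrm A (calc f \<ominus> average (fourier_weight 0 M) p M) = nrm A (average (fourier_weight 0 M) p M \<ominus> calc f)"
      using pA f(1) by (intro nrm_minus_commute) auto
    ultimately show ?thesis using M p(2) avg by (intro bexI[of _ "average (fourier_weight 0 M) a M"]) auto
  qed
  then show ?thesis using I(2) aA unfolding norm_closed_iff by blast
qed

end

section \<open>Simplicity\<close>

context rotation_algebra
begin

text \<open>The common form of the two conditions on orbits, through which simplicity and uniqueness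
  of the trace are linked as well.\<close>

definition zeros_separated :: bool where
  "zeros_separated \<longleftrightarrow> (\<forall>z\<in>unit_circle. \<forall>k. k \<noteq> 0 \<longrightarrow> \<gamma> z = 0 \<longrightarrow> \<gamma> (\<mu> powi k * z) \<noteq> 0)"

lemma one_not_zero: "\<one> \<noteq> \<zero>"
proof
  assume "\<one> = \<zero>"
  interpret representation A "orbit_rep 1" by (rule orbit_rep) simp
  have "orbit_rep 1 \<zero> = id_blinfun" using rep_one \<open>\<one> = \<zero>\<close> by simp
  then show False using norm_rep_unit_vector_le[of \<zero> 0] by simp
qed

lemma ideal_calc_mult:
  assumes "ideal I A" "calc f \<in> I" "continuous_on unit_circle f" "continuous_on unit_circle g"
  shows "calc (\<lambda>z. g z * f z) \<in> I"
  using ideal.I_l_closed[OF assms(1,2), of "calc g"] assms(3,4) by (simp add: calc_mult)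

text \<open>By compactness finitely many of the functions have no common zero. The sum of their
  squared moduli then lies in the ideal and is invertible in C(T).\<close>

lemma ideal_no_common_zero:
  assumes I: "ideal I A"
    and nz: "\<And>z. z \<in> unit_circle \<Longrightarrow> \<exists>f. continuous_on unit_circle f \<and> calc f \<in> I \<and> f z \<noteq> 0"
  shows "I = carrier A"
proof -
  interpret I: ideal I A by fact
  obtain f where f: "\<And>z. z \<in> unit_circle \<Longrightarrow> continuous_on unit_circle (f z) \<and> calc (f z) \<in> I \<and> f z z \<noteq> 0"
    using nz by metis
  have "\<exists>V. open V \<and> z \<in> V \<and> (\<forall>y\<in>V \<inter> unit_circle. f z y \<noteq> 0)" if z: "z \<in> unit_circle" for z
  proof -
    have "\<exists>V. open V \<and> V \<inter> unit_circle = f z -` (- {0}) \<inter> unit_circle"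
      using f[OF z] continuous_on_open_invariant[of unit_circle "f z"] by (meson open_Compl closed_singleton)
    then obtain V where V: "open V" "V \<inter> unit_circle = f z -` (- {0}) \<inter> unit_circle" by blast
    then have "z \<in> V" using z f[OF z] by blast
    then show ?thesis using V by blast
  qed
  then obtain V where V: "\<And>z. z \<in> unit_circle \<Longrightarrow> open (V z) \<and> z \<in> V z \<and> (\<forall>y\<in>V z \<inter> unit_circle. f z y \<noteq> 0)"
    by metis
  obtain D where D: "D \<subseteq> unit_circle" "finite D" "unit_circle \<subseteq> (\<Union>z\<in>D. V z)"
    by (rule compactE_image[of unit_circle unit_circle V]) (use V in auto)
  have "\<exists>g. continuous_on unit_circle g \<and> calc g \<in> I \<and> (\<forall>y\<in>unit_circle. g y = complex_of_real (\<Sum>z\<in>D. (cmod (f z y))\<^sup>2))"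
    using D(2,1)
  proof induction
    case empty
    have "calc (\<lambda>_. 0) \<in> I" by (simp add: calc_zero I.zero_closed)
    then show ?case by (intro exI[of _ "\<lambda>_. 0"]) simp
  next
    case (insert z D)
    then obtain g where g: "continuous_on unit_circle g" "calc g \<in> I"
      "\<forall>y\<in>unit_circle. g y = complex_of_real (\<Sum>z\<in>D. (cmod (f z y))\<^sup>2)" by auto
    have fz: "continuous_on unit_circle (f z)" "calc (f z) \<in> I" using f insert.prems by auto
    have cf: "continuous_on unit_circle (\<lambda>y. cnj (f z y))" by (intro continuous_intros fz)
    have cc: "continuous_on unit_circle (\<lambda>y. cnj (f z y) * f z y)" by (intro continuous_intros fz)
    have "calc (\<lambda>y. cnj (f z y) * f z y + g y) \<in> I"
      unfolding calc_add[OF cc g(1)] by (intro I.a_closed g ideal_calc_mult[OF I] fz cf)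
    moreover have "cnj (f z y) * f z y = complex_of_real ((cmod (f z y))\<^sup>2)" for y
      unfolding complex_norm_square by (rule mult.commute)
    ultimately show ?case
      using insert.hyps g cc by (intro exI[of _ "\<lambda>y. cnj (f z y) * f z y + g y"]) (auto intro: continuous_on_add)
  qed
  then obtain g where g: "continuous_on unit_circle g" "calc g \<in> I"
    "\<And>y. y \<in> unit_circle \<Longrightarrow> g y = complex_of_real (\<Sum>z\<in>D. (cmod (f z y))\<^sup>2)" by blast
  have g_nz: "g y \<noteq> 0" if y: "y \<in> unit_circle" for y
  proof -
    obtain z where z: "z \<in> D" "y \<in> V z" using D(3) y by blast
    then have "0 < (cmod (f z y))\<^sup>2" using V[of z] D(1) y by auto
    also have "\<dots> \<le> (\<Sum>z\<in>D. (cmod (f z y))\<^sup>2)"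
      using z(1) D(2) by (intro member_le_sum) auto
    finally show ?thesis unfolding g(3)[OF y] of_real_eq_0_iff by simp
  qed
  have "continuous_on unit_circle (\<lambda>y. inverse (g y))"
    using g_nz by (intro continuous_on_inverse g) auto
  from ideal_calc_mult[OF I g(2,1) this] have "calc (\<lambda>y. inverse (g y) * g y) \<in> I" .
  also have "calc (\<lambda>y. inverse (g y) * g y) = \<one>"
    unfolding calc_one[symmetric] by (rule calc_cong) (use g_nz in simp)
  finally show ?thesis by (rule I.one_imp_carrier)
qed

lemma simple_if_zeros_separated:
  assumes sep: zeros_separated
  shows "simple_cstar A"
  unfolding simple_cstar_def
proof (intro conjI allI impI)
  show "carrier A \<noteq> {\<zero>}" using one_not_zero by blast
  fix I assume I: "ideal I A \<and> norm_closed A I"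
  interpret I: ideal I A using I by blast
  show "I = {\<zero>} \<or> I = carrier A"
  proof (rule disjCI)
    assume "I \<noteq> carrier A"
    define J where "J = {f. continuous_on unit_circle f \<and> calc f \<in> I}"
    obtain z where z: "z \<in> unit_circle" "\<forall>f\<in>J. f z = 0"
      using ideal_no_common_zero[of I] I \<open>I \<noteq> carrier A\<close> unfolding J_def by blast
    define F where "F = {z \<in> unit_circle. \<forall>f\<in>J. f z = 0}"
    \<comment> \<open>The element \<open>star A x \<otimes> calc f \<otimes> x\<close> of the ideal
      is \<open>calc\<close> of \<gamma> times \<open>f\<close> one step ahead, so its vanishing at
      a point with \<open>\<gamma> y \<noteq> 0\<close> makes \<open>f\<close> vanish at the next
      point.\<close>
    have forward: "\<mu> * y \<in> F" if y: "y \<in> F" "\<gamma> y \<noteq> 0" for y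
      unfolding F_def
    proof (intro CollectI conjI ballI)
      show "\<mu> * y \<in> unit_circle" using y by (simp add: F_def norm_mult)
      fix f assume "f \<in> J"
      then have f: "continuous_on unit_circle f" "calc f \<in> I" by (auto simp: J_def)
      have r: "continuous_on unit_circle (rotated 1 f)" using f by auto
      have "star A x \<otimes> calc f \<otimes> x \<in> I" by (intro I.I_r_closed I.I_l_closed f) auto
      also have "star A x \<otimes> calc f \<otimes> x = calc (\<lambda>z. rotated 1 f z * gam z)"
        unfolding star_x_calc[OF f(1)] calc_mult[OF r continuous_on_gam] using r by (simp add: m_assoc star_x_x)
      finally have "(\<lambda>z. rotated 1 f z * gam z) \<in> J" using r by (simp add: J_def continuous_on_mult)
      then show "f (\<mu> * y) = 0" using y by (auto simp: F_def rotated_def gam_def)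
    qed
    \<comment> \<open>The same with \<open>x \<otimes> calc f \<otimes> star A x\<close>, where
      \<gamma> is evaluated one step back.\<close>
    have backward: "inverse \<mu> * y \<in> F" if y: "y \<in> F" "\<gamma> (inverse \<mu> * y) \<noteq> 0" for y
      unfolding F_def
    proof (intro CollectI conjI ballI)
      show "inverse \<mu> * y \<in> unit_circle" using y by (simp add: F_def norm_mult norm_inverse)
      fix f assume "f \<in> J"
      then have f: "continuous_on unit_circle f" "calc f \<in> I" by (auto simp: J_def)
      have r: "continuous_on unit_circle (rotated (- 1) f)" "continuous_on unit_circle (rotated (- 1) gam)"
        using f by auto
      have "x \<otimes> calc f \<otimes> star A x \<in> I" by (intro I.I_r_closed I.I_l_closed f) auto
      also have "x \<otimes> calc f \<otimes> star A x = calc (\<lambda>z. rotated (- 1) f z * rotated (- 1) gam z)"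
        unfolding x_calc[OF f(1)] calc_mult[OF r] using r by (simp add: m_assoc x_star_x)
      finally have "(\<lambda>z. rotated (- 1) f z * rotated (- 1) gam z) \<in> J" using r by (simp add: J_def continuous_on_mult)
      then show "f (inverse \<mu> * y) = 0" using y by (auto simp: F_def rotated_def gam_def)
    qed
    have dense: "f \<zeta> = 0" if orbit: "\<And>k::nat. t ^ k * z \<in> F"
      and approx: "\<And>e. 0 < e \<Longrightarrow> \<exists>k::nat. cmod (t ^ k * z - \<zeta>) < e" and "\<zeta> \<in> unit_circle" "f \<in> J" for t \<zeta> f
    proof (rule ccontr)
      assume "f \<zeta> \<noteq> 0"
      have "continuous_on unit_circle f" using \<open>f \<in> J\<close> by (simp add: J_def)
      then obtain d where d: "0 < d" "\<forall>y\<in>unit_circle. dist y \<zeta> < d \<longrightarrow> dist (f y) (f \<zeta>) < cmod (f \<zeta>)"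
        using \<open>\<zeta> \<in> unit_circle\<close> \<open>f \<zeta> \<noteq> 0\<close> unfolding continuous_on_iff by (meson zero_less_norm_iff)
      obtain k where "cmod (t ^ k * z - \<zeta>) < d" using approx[OF d(1)] by blast
      moreover have "t ^ k * z \<in> unit_circle" "f (t ^ k * z) = 0"
        using orbit[of k] \<open>f \<in> J\<close> by (auto simp: F_def)
      ultimately show False using d(2)[rule_format, of "t ^ k * z"] by (simp add: dist_norm)
    qed
    have zF: "z \<in> F" using z by (simp add: F_def)
    have vanish: "f \<zeta> = 0" if "\<zeta> \<in> unit_circle" "f \<in> J" for \<zeta> f
    \<comment> \<open>If the forward half-orbit meets no zero of \<gamma>, one moves forward. If it
      meets one, that is the only zero on the whole orbit, and the way back is free.\<close>
    proof (cases "\<exists>k::nat. \<gamma> (\<mu> ^ k * z) = 0")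
      case False
      have "\<mu> ^ k * z \<in> F" for k
      proof (induction k)
        case (Suc k)
        then show ?case using forward[of "\<mu> ^ k * z"] False by (simp add: mult.assoc)
      qed (use zF in simp)
      moreover have "\<exists>k::nat. cmod (\<mu> ^ k * z - \<zeta>) < e" if "0 < e" for e
        using forward_orbit_dense[of z \<zeta> e] that z \<open>\<zeta> \<in> unit_circle\<close> by auto
      ultimately show ?thesis using dense[of \<mu> \<zeta> f] that by blast
    next
      case True
      then obtain k :: nat where k: "\<gamma> (\<mu> ^ k * z) = 0" by blast
      have nz: "\<gamma> (inverse \<mu> ^ Suc j * z) \<noteq> 0" for j
      proof -
        have "\<mu> powi (- int (Suc j + k)) * \<mu> powi int k = \<mu> powi (- int (Suc j))"
          by (subst power_int_add[symmetric]) (auto simp: algebra_simps)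
        then have "\<mu> powi (- int (Suc j + k)) * \<mu> ^ k = inverse \<mu> ^ Suc j"
          by (simp only: power_int_minus power_int_of_nat power_inverse)
        then have eq: "\<mu> powi (- int (Suc j + k)) * (\<mu> ^ k * z) = inverse \<mu> ^ Suc j * z"
          by (simp only: mult.assoc[symmetric])
        have "\<mu> ^ k * z \<in> unit_circle" using z by (simp add: norm_mult norm_power)
        then have "\<gamma> (\<mu> powi (- int (Suc j + k)) * (\<mu> ^ k * z)) \<noteq> 0"
          using sep k unfolding zeros_separated_def by (metis neg_equal_0_iff_equal of_nat_eq_0_iff add_is_0 nat.distinct(1))
        then show ?thesis unfolding eq .
      qed
      have "inverse \<mu> ^ j * z \<in> F" for j
      proof (induction j)
        case (Suc j)
        then show ?case using backward[of "inverse \<mu> ^ j * z"] nz[of j] by (simp add: mult.assoc)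
      qed (use zF in simp)
      moreover have "\<exists>k::nat. cmod (inverse \<mu> ^ k * z - \<zeta>) < e" if "0 < e" for e
        using backward_orbit_dense[of z \<zeta> e] that z \<open>\<zeta> \<in> unit_circle\<close> by auto
      ultimately show ?thesis using dense[of "inverse \<mu>" \<zeta> f] that by blast
    qed
    have "a = \<zero>" if a: "a \<in> I" for a
    proof (rule faithful)
      show aA: "a \<in> carrier A" using a I.a_subset by blast
      fix \<xi> :: complex assume \<xi>: "\<xi> \<in> unit_circle"
      interpret representation A "orbit_rep \<xi>" by (rule orbit_rep[OF \<xi>])
      \<comment> \<open>The expectation of \<open>star A a \<otimes> a\<close> at \<xi> is the
        squared norm of the image of the base vector, so its vanishing is exactly what
        \<open>faithful\<close> asks for.\<close>
      have "star A a \<otimes> a \<in> I" using a aA by (intro I.I_l_closed) auto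
      then have "diagonal (star A a \<otimes> a) \<in> J"
        using expectation_in_ideal[of I "star A a \<otimes> a"] I aA by (auto simp: J_def)
      then have "diagonal (star A a \<otimes> a) \<xi> = 0" by (rule vanish[OF \<xi>])
      then show "orbit_rep \<xi> a (unit_vector 0) = 0"
        using coord_rep_star_mult[OF aA, of 0] by (simp add: diagonal_def)
    qed
    then show "I = {\<zero>}" using I.zero_closed by blast
  qed
qed

end

section \<open>Tracial states\<close>

context positive_functional
begin

text \<open>Reduces the trace property to generators. Products are handled by two cyclic moves,
  adjoints by Hermitian symmetry of the functional, and limits by its boundedness.\<close>

lemma commutant_cstar_subalgebra:
  "cstar_subalgebra {a \<in> carrier A. \<forall>b\<in>carrier A. \<tau> (a \<otimes> b) = \<tau> (b \<otimes> a)} A" (is "cstar_subalgebra ?D A")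
proof -
  have smult_D: "c \<odot> a \<in> ?D" if "a \<in> ?D" for c a
    using that by (simp add: smult_mult_left smult_mult_right fun_smult)
  have "subring ?D A"
  proof (rule subringI)
    show "\<ominus> a \<in> ?D" if "a \<in> ?D" for a
      using that by (simp add: l_minus r_minus fun_uminus)
    fix a b assume a: "a \<in> ?D" and b: "b \<in> ?D"
    show "a \<oplus> b \<in> ?D" using a b by (simp add: l_distr r_distr fun_add)
    show "a \<otimes> b \<in> ?D"
    proof (intro CollectI conjI ballI)
      fix c assume c: "c \<in> carrier A"
      have "\<tau> (a \<otimes> b \<otimes> c) = \<tau> (a \<otimes> (b \<otimes> c))" using a b c by (simp add: m_assoc)
      also have "\<dots> = \<tau> (b \<otimes> (c \<otimes> a))" using a b c by (simp add: m_assoc)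
      also have "\<dots> = \<tau> (c \<otimes> (a \<otimes> b))" using a b c by (simp add: m_assoc)
      finally show "\<tau> (a \<otimes> b \<otimes> c) = \<tau> (c \<otimes> (a \<otimes> b))" .
    qed (use a b in auto)
  qed auto
  moreover have "norm_closed A ?D"
    unfolding norm_closed_iff
  proof (intro conjI ballI impI CollectI)
    fix a b assume a: "a \<in> carrier A" and approx: "\<forall>e>0. \<exists>s\<in>?D. nrm A (a \<ominus> s) < e" and b: "b \<in> carrier A"
    have "cmod (\<tau> (a \<otimes> b) - \<tau> (b \<otimes> a)) \<le> 0"
    proof (rule field_le_epsilon)
      fix e :: real assume "0 < e"
      \<comment> \<open>Twice the norm of \<open>b\<close> times the mass of the functional, with 1
        added to make it positive.\<close>
      define K where "K = 2 * (nrm A b * Re (\<tau> \<one>)) + 1"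
      have "0 < K" using nrm_nonneg[OF b] fun_one by (simp add: K_def add_nonneg_pos)
      then obtain s where s: "s \<in> ?D" "nrm A (a \<ominus> s) < e / K"
        using approx \<open>0 < e\<close> by (meson divide_pos_pos)
      have sA: "s \<in> carrier A" "\<tau> (s \<otimes> b) = \<tau> (b \<otimes> s)" using s b by auto
      have "\<tau> (a \<otimes> b) - \<tau> (b \<otimes> a) = \<tau> ((a \<ominus> s) \<otimes> b) - \<tau> (b \<otimes> (a \<ominus> s))"
        using a b sA by (simp add: M.minus_eq l_distr r_distr l_minus r_minus fun_add fun_uminus)
      also have "cmod \<dots> \<le> cmod (\<tau> ((a \<ominus> s) \<otimes> b)) + cmod (\<tau> (b \<otimes> (a \<ominus> s)))"
        by (rule norm_triangle_ineq4)
      also have "\<dots> \<le> nrm A (a \<ominus> s) * nrm A b * Re (\<tau> \<one>) + nrm A b * nrm A (a \<ominus> s) * Re (\<tau> \<one>)"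
        using a b sA fun_one
        by (intro add_mono order_trans[OF fun_bounded] mult_right_mono nrm_mult) auto
      also have "\<dots> \<le> nrm A (a \<ominus> s) * K"
        using nrm_nonneg[of "a \<ominus> s"] a sA by (simp add: K_def algebra_simps)
      also have "\<dots> \<le> e / K * K"
        using s(2) \<open>0 < K\<close> by (intro mult_right_mono) auto
      also have "\<dots> = 0 + e" using \<open>0 < K\<close> by simp
      finally show "cmod (\<tau> (a \<otimes> b) - \<tau> (b \<otimes> a)) \<le> 0 + e" .
    qed
    then show "\<tau> (a \<otimes> b) = \<tau> (b \<otimes> a)" by simp
  qed auto
  moreover have "star A a \<in> ?D" if a: "a \<in> ?D" for a
  proof (intro CollectI conjI ballI)
    fix b assume b: "b \<in> carrier A"
    have "\<tau> (star A a \<otimes> b) = cnj (\<tau> (star A b \<otimes> a))"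
      using a b by (intro fun_star_mult) auto
    also have "\<tau> (star A b \<otimes> a) = \<tau> (a \<otimes> star A b)" using a b by simp
    also have "cnj \<dots> = \<tau> (star A (a \<otimes> star A b))" using a b fun_star[of "a \<otimes> star A b"] by simp
    also have "\<dots> = \<tau> (b \<otimes> star A a)" using a b by (simp add: star_mult star_star)
    finally show "\<tau> (star A a \<otimes> b) = \<tau> (b \<otimes> star A a)" .
  qed (use a in auto)
  ultimately show ?thesis
    unfolding cstar_subalgebra_def using smult_D by blast
qed

lemma trace_of_generators:
  assumes "carrier A = cstar_generated A S" "S \<subseteq> carrier A" "\<tau> \<one> = 1"
    and "\<And>s b. s \<in> S \<Longrightarrow> b \<in> carrier A \<Longrightarrow> \<tau> (s \<otimes> b) = \<tau> (b \<otimes> s)"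
  shows "trace A \<tau>"
proof
  have "S \<subseteq> {a \<in> carrier A. \<forall>b\<in>carrier A. \<tau> (a \<otimes> b) = \<tau> (b \<otimes> a)}" using assms(2,4) by blast
  then have "cstar_generated A S \<subseteq> {a \<in> carrier A. \<forall>b\<in>carrier A. \<tau> (a \<otimes> b) = \<tau> (b \<otimes> a)}"
    using commutant_cstar_subalgebra unfolding cstar_generated_def by blast
  then show "\<tau> (a \<otimes> b) = \<tau> (b \<otimes> a)" if "a \<in> carrier A" "b \<in> carrier A" for a b
    using that assms(1) by blast
qed fact

end

lemma convergent_approx:
  fixes X :: "nat \<Rightarrow> complex"
  assumes "\<And>e. 0 < e \<Longrightarrow> \<exists>Y. convergent Y \<and> (\<forall>n. cmod (X n - Y n) \<le> e)"
  shows "convergent X"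
proof -
  have "Cauchy X"
  proof (rule metric_CauchyI)
    fix e :: real assume "0 < e"
    then obtain Y where Y: "convergent Y" "\<forall>n. cmod (X n - Y n) \<le> e / 4"
      using assms[of "e / 4"] by auto
    obtain N where N: "\<forall>m\<ge>N. \<forall>n\<ge>N. dist (Y m) (Y n) < e / 4"
      using Y(1)[folded Cauchy_convergent_iff, unfolded Cauchy_def, rule_format, of "e / 4"] \<open>0 < e\<close> by auto
    have "dist (X m) (X n) < e" if "N \<le> m" "N \<le> n" for m n
    proof -
      have "cmod (X m - X n) \<le> cmod (X m - Y m) + (cmod (Y m - Y n) + cmod (X n - Y n))"
        using norm_triangle_ineq[of "X m - Y m" "(Y m - Y n) - (X n - Y n)"]
          norm_triangle_ineq4[of "Y m - Y n" "X n - Y n"] by simp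
      moreover have "cmod (Y m - Y n) < e / 4" using N that by (simp add: dist_norm)
      ultimately show ?thesis
        unfolding dist_norm using Y(2)[rule_format, of m] Y(2)[rule_format, of n] \<open>0 < e\<close> by linarith
    qed
    then show "\<exists>N. \<forall>m\<ge>N. \<forall>n\<ge>N. dist (X m) (X n) < e" by blast
  qed
  then show ?thesis by (simp add: Cauchy_convergent_iff)
qed

lemma average_diff_le:
  fixes f g :: "nat \<Rightarrow> complex"
  assumes "\<And>k. cmod (f k - g k) \<le> e" "0 \<le> e"
  shows "cmod ((\<Sum>k<M. f k) / of_nat M - (\<Sum>k<M. g k) / of_nat M) \<le> e"
proof (cases "M = 0")
  case False
  have "cmod (\<Sum>k<M. f k - g k) \<le> (\<Sum>k<M. e)"
    by (rule sum_norm_le) (use assms in auto)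
  then show ?thesis
    using False by (simp add: norm_divide divide_le_eq mult.commute flip: diff_divide_distrib sum_subtractf)
qed (use assms in simp)

text \<open>Weyl's equidistribution argument: convergence is clear for monomials and survives
  uniform limits. The limit is the Haar integral, but only its existence is recorded.\<close>

lemma (in irrational_rotation) orbit_average_convergent:
  fixes f :: "complex \<Rightarrow> complex"
  assumes "continuous_on unit_circle f" "\<xi> \<in> unit_circle"
  shows "convergent (\<lambda>M. (\<Sum>k<M. f (\<mu> powi int k * \<xi>)) / of_nat M)"
  using assms(1)
proof (induction rule: circle_function_induct)
  case (monom c n)
  have "(\<lambda>M. c * \<xi> powi n * ((\<Sum>k<M. \<mu> powi (n * int k)) / of_nat M)) \<longlonglongrightarrow> c * \<xi> powi n * (if n = 0 then 1 else 0)"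
    by (intro tendsto_intros average_mu_powi_tendsto)
  moreover have eq: "c * (\<mu> powi int k * \<xi>) powi n = c * \<xi> powi n * \<mu> powi (n * int k)" for k
    by (simp add: power_int_mult_distrib mult.commute[of n] power_int_mult del: power_int_of_nat)
  ultimately show ?case
    unfolding convergent_def eq sum_distrib_left[symmetric] times_divide_eq_right[symmetric] by blast
next
  case (add f g)
  then show ?case
    using convergent_add[OF add.IH] by (simp add: sum.distrib add_divide_distrib)
next
  case (limit f)
  show ?case
  proof (rule convergent_approx)
    fix e :: real assume "0 < e"
    then obtain g where g: "convergent (\<lambda>M. (\<Sum>k<M. g (\<mu> powi int k * \<xi>)) / of_nat M)"
      "\<forall>z\<in>unit_circle. cmod (f z - g z) \<le> e" using limit.IH by blast
    have "cmod (f (\<mu> powi int k * \<xi>) - g (\<mu> powi int k * \<xi>)) \<le> e" for k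
      by (rule g(2)[rule_format, OF orbit_circle[OF assms(2)]])
    from average_diff_le[OF this] g(1) \<open>0 < e\<close>
    show "\<exists>Y. convergent Y \<and> (\<forall>M. cmod ((\<Sum>k<M. f (\<mu> powi int k * \<xi>)) / of_nat M - Y M) \<le> e)"
      by (meson less_imp_le)
  qed
qed

section \<open>Diagonal entries and the traces built from them\<close>

context rotation_algebra
begin

definition entry :: "complex \<Rightarrow> int \<Rightarrow> 'a \<Rightarrow> complex" where
  "entry \<xi> k a = coord (orbit_rep \<xi> a (unit_vector k)) k"

lemma entry_positive_functional: "\<xi> \<in> unit_circle \<Longrightarrow> positive_functional A (entry \<xi> k)"
  using representation.rep_positive_functional[OF orbit_rep(1)] unfolding entry_def[abs_def] .

lemma entry_one: "\<xi> \<in> unit_circle \<Longrightarrow> entry \<xi> k \<one> = 1"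
  using representation.rep_one[OF orbit_rep(1)] by (simp add: entry_def coord_unit_vector)

lemma entry_diff_le:
  assumes "\<xi> \<in> unit_circle" "a \<in> carrier A" "b \<in> carrier A"
  shows "cmod (entry \<xi> k a - entry \<xi> k b) \<le> nrm A (a \<ominus> b)"
proof -
  interpret positive_functional A "entry \<xi> k" by (rule entry_positive_functional[OF assms(1)])
  show ?thesis using fun_bounded[of "a \<ominus> b"] assms by (simp add: fun_minus entry_one)
qed

lemma entry_w: "\<xi> \<in> unit_circle \<Longrightarrow> entry \<xi> k w = \<mu> powi k * \<xi>"
  by (simp add: entry_def orbit_rep_w coord_unit_vector)

lemma entry_calc:
  "\<xi> \<in> unit_circle \<Longrightarrow> continuous_on unit_circle f \<Longrightarrow> entry \<xi> k (calc f) = f (\<mu> powi k * \<xi>)"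
  by (simp add: entry_def orbit_rep_calc coord_unit_vector)

lemma entry_w_commute:
  assumes \<xi>: "\<xi> \<in> unit_circle" and b: "b \<in> carrier A"
  shows "entry \<xi> k (w \<otimes> b) = entry \<xi> k (b \<otimes> w)"
proof -
  interpret representation A "orbit_rep \<xi>" by (rule orbit_rep[OF \<xi>])
  show ?thesis
    using b by (simp add: entry_def rep_mult orbit_rep_w[OF \<xi>] rep_scalar)
      (simp add: orbit_rep(3)[OF \<xi>] coord_orbit_diagonal[OF continuous_on_id \<xi>])
qed

text \<open>The diagonal entries of \<open>x \<otimes> b\<close> and \<open>b \<otimes> x\<close>
  are of this form at neighbouring indices, so sums of commutator entries telescope. The first
  factor vanishes where \<gamma> does, and this is what cuts out finite blocks.\<close>

definition boundary_term :: "complex \<Rightarrow> 'a \<Rightarrow> int \<Rightarrow> complex" where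
  "boundary_term \<xi> b k = complex_of_real (sqrt (\<gamma> (\<mu> powi (k - 1) * \<xi>))) * coord (orbit_rep \<xi> b (unit_vector k)) (k - 1)"

lemma entry_x_commute:
  assumes \<xi>: "\<xi> \<in> unit_circle" and b: "b \<in> carrier A"
  shows "entry \<xi> k (x \<otimes> b) - entry \<xi> k (b \<otimes> x) = boundary_term \<xi> b k - boundary_term \<xi> b (k + 1)"
proof -
  interpret representation A "orbit_rep \<xi>" by (rule orbit_rep[OF \<xi>])
  have "entry \<xi> k (x \<otimes> b) = boundary_term \<xi> b k"
    using b unfolding entry_def boundary_term_def rep_mult[OF x_closed b] orbit_rep(2)[OF \<xi>] orbit_shift_def
    by (simp add: coord_weighted_shift[OF bounded_weights_orbit_shift[OF gamma_continuous \<xi>]])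
  moreover have "entry \<xi> k (b \<otimes> x) = boundary_term \<xi> b (k + 1)"
    using b unfolding entry_def boundary_term_def rep_mult[OF b x_closed]
    by (simp add: orbit_rep_x[OF \<xi>] rep_scalar)
  ultimately show ?thesis by simp
qed

text \<open>The window starts at 0 for the Haar trace and at 1 for the trace of a finite
  block.\<close>

lemma sum_entry_x_commute:
  assumes "\<xi> \<in> unit_circle" "b \<in> carrier A"
  shows "(\<Sum>k<n. entry \<xi> (l + int k) (x \<otimes> b)) - (\<Sum>k<n. entry \<xi> (l + int k) (b \<otimes> x))
    = boundary_term \<xi> b l - boundary_term \<xi> b (l + int n)"
proof (induction n)
  case (Suc n)
  have "(\<Sum>k<Suc n. entry \<xi> (l + int k) (x \<otimes> b)) - (\<Sum>k<Suc n. entry \<xi> (l + int k) (b \<otimes> x))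
    = ((\<Sum>k<n. entry \<xi> (l + int k) (x \<otimes> b)) - (\<Sum>k<n. entry \<xi> (l + int k) (b \<otimes> x)))
      + (entry \<xi> (l + int n) (x \<otimes> b) - entry \<xi> (l + int n) (b \<otimes> x))"
    by simp
  also have "\<dots> = boundary_term \<xi> b l - boundary_term \<xi> b (l + int (Suc n))"
    unfolding Suc entry_x_commute[OF assms] by (simp add: ac_simps)
  finally show ?case .
qed simp

lemma boundary_term_bound:
  assumes \<xi>: "\<xi> \<in> unit_circle" and b: "b \<in> carrier A"
  obtains C where "\<And>k. cmod (boundary_term \<xi> b k) \<le> C"
proof -
  interpret representation A "orbit_rep \<xi>" by (rule orbit_rep[OF \<xi>])
  obtain D where D: "\<And>k. cmod (complex_of_real (sqrt (\<gamma> (\<mu> powi (k - 1) * \<xi>)))) \<le> D"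
    using bounded_weights_orbit_shift[OF gamma_continuous \<xi>] unfolding bounded_weights_def by blast
  have "0 \<le> D" using order_trans[OF norm_ge_zero D[of 0]] .
  have "cmod (boundary_term \<xi> b k) \<le> D * nrm A b" for k
    unfolding boundary_term_def norm_mult
    by (intro mult_mono D coord_rep_le b \<open>0 \<le> D\<close>) auto
  then show thesis by (rule that)
qed

text \<open>The mean of the diagonal entries along the forward half-orbit of 1; on C(T) this is the
  Haar integral, by equidistribution. \<open>haar_trace_tendsto\<close> justifies the use of
  \<open>lim\<close>.\<close>

definition haar_trace :: "'a \<Rightarrow> complex" where
  "haar_trace a = lim (\<lambda>M. (\<Sum>k<M. entry 1 (int k) a) / of_nat M)"

lemma haar_trace_tendsto:
  assumes a: "a \<in> carrier A"
  shows "(\<lambda>M. (\<Sum>k<M. entry 1 (int k) a) / of_nat M) \<longlonglongrightarrow> haar_trace a"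
proof -
  have one: "(1 :: complex) \<in> unit_circle" by simp
  have "convergent (\<lambda>M. (\<Sum>k<M. entry 1 (int k) a) / of_nat M)"
  proof (rule convergent_approx)
    fix e :: real assume "0 < e"
    then obtain p where p: "p \<in> poly_elements" "nrm A (a \<ominus> p) < e"
      using poly_elements_dense[OF a] by blast
    obtain f where f: "continuous_on unit_circle f"
      "\<And>\<xi> k. \<xi> \<in> unit_circle \<Longrightarrow> coord (orbit_rep \<xi> p (unit_vector k)) k = f (\<mu> powi k * \<xi>)"
      by (rule poly_elements_diagonal[OF p(1)]) blast
    have "convergent (\<lambda>M. (\<Sum>k<M. entry 1 (int k) p) / of_nat M)"
      using orbit_average_convergent[OF f(1) one] unfolding entry_def f(2)[OF one] .
    moreover have "cmod (entry 1 (int k) a - entry 1 (int k) p) \<le> e" for k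
      using entry_diff_le[OF one a poly_elements_carrier[OF p(1)], of "int k"] p(2) by simp
    ultimately show "\<exists>Y. convergent Y \<and> (\<forall>M. cmod ((\<Sum>k<M. entry 1 (int k) a) / of_nat M - Y M) \<le> e)"
      using \<open>0 < e\<close> by (intro exI[of _ "\<lambda>M. (\<Sum>k<M. entry 1 (int k) p) / of_nat M"]) (auto intro!: average_diff_le)
  qed
  then show ?thesis unfolding haar_trace_def by (simp add: convergent_LIMSEQ_iff)
qed

lemma average_entries_positive_functional:
  assumes "\<xi> \<in> unit_circle"
  shows "positive_functional A (\<lambda>a. (\<Sum>k<n. entry \<xi> (l + int k) a) / of_nat n)"
proof -
  have e: "positive_functional A (entry \<xi> k)" for k by (rule entry_positive_functional[OF assms])
  show ?thesis
  proof
    fix a assume a: "a \<in> carrier A"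
    show "(\<Sum>k<n. entry \<xi> (l + int k) (c \<odot> a)) / of_nat n = c * ((\<Sum>k<n. entry \<xi> (l + int k) a) / of_nat n)" for c
      using positive_functional.fun_smult[OF e a] by (simp add: sum_distrib_left)
    have "(\<Sum>k<n. entry \<xi> (l + int k) (star A a \<otimes> a)) \<in> \<real>\<^sub>\<ge>\<^sub>0"
      by (induction n) (auto intro: nonneg_Reals_add_I positive_functional.fun_positive[OF e a])
    then show "(\<Sum>k<n. entry \<xi> (l + int k) (star A a \<otimes> a)) / of_nat n \<in> \<real>\<^sub>\<ge>\<^sub>0"
      by (intro nonneg_Reals_divide_I) auto
    fix b assume "b \<in> carrier A"
    then show "(\<Sum>k<n. entry \<xi> (l + int k) (a \<oplus> b)) / of_nat n
        = (\<Sum>k<n. entry \<xi> (l + int k) a) / of_nat n + (\<Sum>k<n. entry \<xi> (l + int k) b) / of_nat n"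
      using positive_functional.fun_add[OF e a] by (simp add: sum.distrib add_divide_distrib)
  qed
qed

text \<open>Each finite mean is a positive functional. On commutators with x it telescopes to two
  bounded boundary terms divided by M, which disappear in the limit; commutators with w have
  vanishing diagonal entries from the start.\<close>

lemma haar_trace: "trace A haar_trace"
proof -
  have one: "(1 :: complex) \<in> unit_circle" by simp
  let ?av = "\<lambda>a M. (\<Sum>k<M. entry 1 (int k) a) / of_nat M"
  note avg = average_entries_positive_functional[OF one, where l = 0, unfolded add_0]
  have "positive_functional A haar_trace"
  proof
    fix a assume a: "a \<in> carrier A"
    show "haar_trace (c \<odot> a) = c * haar_trace a" for c
    proof (rule LIMSEQ_unique[OF haar_trace_tendsto])
      show "?av (c \<odot> a) \<longlonglongrightarrow> c * haar_trace a"
        unfolding positive_functional.fun_smult[OF avg a] by (intro tendsto_intros haar_trace_tendsto a)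
    qed (use a in simp)
    show "haar_trace (star A a \<otimes> a) \<in> \<real>\<^sub>\<ge>\<^sub>0"
      by (rule closed_sequentially[OF closed_nonneg_Reals_complex _ haar_trace_tendsto])
         (use a positive_functional.fun_positive[OF avg a] in auto)
    fix b assume b: "b \<in> carrier A"
    show "haar_trace (a \<oplus> b) = haar_trace a + haar_trace b"
    proof (rule LIMSEQ_unique[OF haar_trace_tendsto])
      show "?av (a \<oplus> b) \<longlonglongrightarrow> haar_trace a + haar_trace b"
        unfolding positive_functional.fun_add[OF avg a b] by (intro tendsto_intros haar_trace_tendsto a b)
    qed (use a b in simp)
  qed
  then interpret positive_functional A haar_trace .
  show ?thesis
  proof (rule trace_of_generators[OF generated])
    have "?av \<one> \<longlonglongrightarrow> 1" using average_one_tendsto_1 by (simp add: entry_one)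
    then show "haar_trace \<one> = 1" using haar_trace_tendsto[of \<one>] LIMSEQ_unique by blast
    fix s b assume s: "s \<in> {x, w}" and b: "b \<in> carrier A"
    have "(\<lambda>M. ?av (s \<otimes> b) M - ?av (b \<otimes> s) M) \<longlonglongrightarrow> 0"
    proof (cases "s = w")
      case True
      then show ?thesis using entry_w_commute[OF one b] by simp
    next
      case False
      then have "s = x" using s by simp
      obtain C where C: "\<And>k. cmod (boundary_term 1 b k) \<le> C"
        by (rule boundary_term_bound[OF one b]) blast
      show ?thesis
      proof (rule Lim_null_comparison)
        show "\<forall>\<^sub>F M in sequentially. cmod (?av (s \<otimes> b) M - ?av (b \<otimes> s) M) \<le> (C + C) / real M"
        proof (intro always_eventually allI)
          fix M
          have "?av (s \<otimes> b) M - ?av (b \<otimes> s) M = (boundary_term 1 b 0 - boundary_term 1 b (int M)) / of_nat M"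
            using sum_entry_x_commute[OF one b, where n = M and l = 0] by (simp add: \<open>s = x\<close> flip: diff_divide_distrib)
          moreover have "cmod (boundary_term 1 b 0 - boundary_term 1 b (int M)) \<le> C + C"
            by (rule order_trans[OF norm_triangle_ineq4 add_mono[OF C C]])
          ultimately show "cmod (?av (s \<otimes> b) M - ?av (b \<otimes> s) M) \<le> (C + C) / real M"
            by (simp add: norm_divide divide_right_mono)
        qed
      qed (rule lim_const_over_n)
    qed
    moreover have "(\<lambda>M. ?av (s \<otimes> b) M - ?av (b \<otimes> s) M) \<longlonglongrightarrow> haar_trace (s \<otimes> b) - haar_trace (b \<otimes> s)"
      using s b by (intro tendsto_diff haar_trace_tendsto) auto
    ultimately have "haar_trace (s \<otimes> b) - haar_trace (b \<otimes> s) = 0" by (rule LIMSEQ_unique[symmetric])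
    then show "haar_trace (s \<otimes> b) = haar_trace (b \<otimes> s)" by simp
  qed auto
qed

lemma haar_trace_w: "haar_trace w = 0"
proof (rule LIMSEQ_unique[OF haar_trace_tendsto[OF w_closed]])
  have "entry 1 (int k) w = \<mu> powi (1 * int k)" for k using entry_w[of 1 "int k"] by simp
  then show "(\<lambda>M. (\<Sum>k<M. entry 1 (int k) w) / of_nat M) \<longlonglongrightarrow> 0"
    using average_mu_powi_tendsto[of 1] by simp
qed

text \<open>The zeros at \<xi> and \<open>\<mu> ^ n * \<xi>\<close> remove the weight of x into
  \<open>unit_vector 1\<close> and the weight out of the unit vector at \<open>n\<close>. The
  vectors from 1 to \<open>n\<close> thus span a block that reduces the representation, which
  explains the offset in \<open>1 + int k\<close>.\<close>

lemma finite_dimensional_trace: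
  assumes \<xi>: "\<xi> \<in> unit_circle" and n: "0 < n" and zero: "\<gamma> \<xi> = 0" "\<gamma> (\<mu> ^ n * \<xi>) = 0"
  obtains \<tau> a where "trace A \<tau>" "\<tau> w \<noteq> 0" "a \<in> carrier A" "a \<noteq> \<zero>" "\<tau> (star A a \<otimes> a) = 0"
proof -
  define \<tau> where "\<tau> a = (\<Sum>k<n. entry \<xi> (1 + int k) a) / of_nat n" for a
  interpret positive_functional A \<tau>
    unfolding \<tau>_def[abs_def] by (rule average_entries_positive_functional[OF \<xi>])
  have tr: "trace A \<tau>"
  proof (rule trace_of_generators[OF generated])
    show "\<tau> \<one> = 1" using n by (simp add: \<tau>_def entry_one[OF \<xi>])
    fix s b assume s: "s \<in> {x, w}" and b: "b \<in> carrier A"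
    have "boundary_term \<xi> b 1 = 0" "boundary_term \<xi> b (1 + int n) = 0"
      using zero by (simp_all add: boundary_term_def)
    then show "\<tau> (s \<otimes> b) = \<tau> (b \<otimes> s)"
      using s sum_entry_x_commute[OF \<xi> b, where n = n and l = 1] entry_w_commute[OF \<xi> b] by (auto simp: \<tau>_def)
  qed auto
  \<comment> \<open>A geometric sum, nonzero because \<open>\<mu> ^ n \<noteq> 1\<close>; this
    separates the trace from \<open>haar_trace\<close>, which vanishes at w.\<close>
  have "(\<Sum>k<n. entry \<xi> (1 + int k) w) = (\<mu> * \<xi>) * (\<Sum>k<n. \<mu> ^ k)"
    by (simp add: entry_w[OF \<xi>] sum_distrib_left power_int_add mult_ac)
  moreover have "(\<Sum>k<n. \<mu> ^ k) = (\<mu> ^ n - 1) / (\<mu> - 1)"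
    using mu_powi_eq_1_iff[of 1] by (intro geometric_sum) simp
  moreover have "\<mu> ^ n \<noteq> 1" "\<mu> \<noteq> 1"
    using mu_powi_eq_1_iff[of "int n"] mu_powi_eq_1_iff[of 1] n by auto
  ultimately have w: "\<tau> w \<noteq> 0" using n \<xi> by (auto simp: \<tau>_def)
  \<comment> \<open>It vanishes at the \<open>n\<close> orbit points of the block but not at \<xi>,
    so \<open>calc f\<close> is a nonzero element of the null ideal.\<close>
  define f where "f z = (\<Prod>k<n. z - \<mu> powi (1 + int k) * \<xi>)" for z
  have f: "continuous_on unit_circle f" unfolding f_def by (intro continuous_intros)
  have cf: "continuous_on unit_circle (\<lambda>z. cnj (f z))" by (intro continuous_intros f)
  have "star A (calc f) \<otimes> calc f = calc (\<lambda>z. cnj (f z) * f z)"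
    by (simp add: calc_mult[OF cf f] calc_star[OF f])
  moreover have "f (\<mu> powi (1 + int k) * \<xi>) = 0" if "k < n" for k
    unfolding f_def using that by (intro prod_zero) auto
  ultimately have null: "\<tau> (star A (calc f) \<otimes> calc f) = 0"
    by (simp add: \<tau>_def entry_calc[OF \<xi> continuous_on_mult[OF cf f]])
  have "f \<xi> \<noteq> 0"
  proof
    assume "f \<xi> = 0"
    then obtain k where "\<xi> = \<mu> powi (1 + int k) * \<xi>" by (auto simp: f_def prod_zero_iff)
    then have "\<mu> powi (1 + int k) = 1" using \<xi> by auto
    then show False by (simp add: mu_powi_eq_1_iff)
  qed
  moreover have "entry \<xi> 0 \<zero> = 0"
    using positive_functional.fun_smult[OF entry_positive_functional[OF \<xi>], of \<zero> 0 0] by simp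
  ultimately have "calc f \<noteq> \<zero>" using entry_calc[OF \<xi> f, of 0] by auto
  then show thesis using that[OF tr w _ _ null] f by auto
qed

text \<open>For a negative exponent the two zeros exchange their roles.\<close>

lemma not_zeros_separatedE:
  assumes "\<not> zeros_separated"
  obtains \<xi> n where "\<xi> \<in> unit_circle" "0 < n" "\<gamma> \<xi> = 0" "\<gamma> (\<mu> ^ n * \<xi>) = 0"
proof -
  obtain z k where z: "z \<in> unit_circle" "k \<noteq> 0" "\<gamma> z = 0" "\<gamma> (\<mu> powi k * z) = 0"
    using assms unfolding zeros_separated_def by blast
  show thesis
  proof (cases "0 < k")
    case True
    then show thesis using that[of z "nat k"] z by (simp add: power_int_def)
  next
    case False
    have "\<mu> powi (- k) * \<mu> powi k = 1" by (simp add: power_int_minus)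
    moreover have "\<mu> powi (- k) = \<mu> ^ nat (- k)" using False by (simp add: power_int_def)
    ultimately have eq: "\<mu> ^ nat (- k) * (\<mu> powi k * z) = z" by (simp flip: mult.assoc)
    have "\<gamma> (\<mu> ^ nat (- k) * (\<mu> powi k * z)) = 0" unfolding eq by (rule z(3))
    moreover have "0 < nat (- k)" using False z(2) by simp
    ultimately show thesis using that[OF orbit_circle[OF z(1)] _ z(4)] by blast
  qed
qed

lemma zeros_separated_if_simple:
  assumes "simple_cstar A" shows zeros_separated
proof (rule ccontr)
  assume "\<not> zeros_separated"
  then obtain \<xi> n where "\<xi> \<in> unit_circle" "0 < n" "\<gamma> \<xi> = 0" "\<gamma> (\<mu> ^ n * \<xi>) = 0"
    by (rule not_zeros_separatedE)
  then obtain \<tau> a where "trace A \<tau>" "a \<in> carrier A" "a \<noteq> \<zero>" "\<tau> (star A a \<otimes> a) = 0"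
    by (rule finite_dimensional_trace) blast
  then show False using trace.trace_faithful_if_simple[OF _ assms] by blast
qed

lemma zeros_separated_if_unique_trace:
  assumes "unique_tracial_state A" shows zeros_separated
proof (rule ccontr)
  assume "\<not> zeros_separated"
  then obtain \<xi> n where "\<xi> \<in> unit_circle" "0 < n" "\<gamma> \<xi> = 0" "\<gamma> (\<mu> ^ n * \<xi>) = 0"
    by (rule not_zeros_separatedE)
  then obtain \<tau> where "trace A \<tau>" "\<tau> w \<noteq> 0"
    by (rule finite_dimensional_trace) blast
  moreover have "\<tau> w = haar_trace w"
    using assms haar_trace \<open>trace A \<tau>\<close> w_closed unfolding unique_tracial_state_def trace_iff by blast
  ultimately show False by (simp add: haar_trace_w)
qed

end

section \<open>Uniqueness of the trace\<close>

context rotation_algebra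
begin

text \<open>For fixed \<open>k\<close> the sum of \<gamma> at z and at
  \<open>\<mu> powi k * z\<close> is positive, hence bounded below by compactness, and half of its
  minimum works. The finitely many \<open>k\<close> are combined by taking the least of these
  numbers.\<close>

lemma zeros_separated_uniform:
  assumes zeros_separated
  obtains \<epsilon> where "0 < \<epsilon>"
    "\<And>z k. z \<in> unit_circle \<Longrightarrow> k \<noteq> 0 \<Longrightarrow> \<bar>k\<bar> \<le> int N \<Longrightarrow> \<gamma> z < \<epsilon> \<Longrightarrow> \<epsilon> \<le> \<gamma> (\<mu> powi k * z)"
proof -
  have single: "\<exists>\<epsilon>>0. \<forall>z\<in>unit_circle. \<gamma> z < \<epsilon> \<longrightarrow> \<epsilon> \<le> \<gamma> (\<mu> powi k * z)" if k: "k \<noteq> 0" for k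
  proof -
    have "continuous_on unit_circle (\<lambda>z. \<gamma> (\<mu> powi k * z))"
      by (rule continuous_on_compose2[OF gamma_continuous]) (auto intro!: continuous_intros simp: norm_mult)
    then have cont: "continuous_on unit_circle (\<lambda>z. \<gamma> z + \<gamma> (\<mu> powi k * z))"
      by (intro continuous_on_add gamma_continuous)
    have "(1 :: complex) \<in> unit_circle" by simp
    then have "unit_circle \<noteq> {}" by blast
    then obtain y where y: "y \<in> unit_circle"
      "\<forall>z\<in>unit_circle. \<gamma> y + \<gamma> (\<mu> powi k * y) \<le> \<gamma> z + \<gamma> (\<mu> powi k * z)"
      using continuous_attains_inf[OF compact_sphere _ cont] by blast
    have nonneg: "0 \<le> \<gamma> y" "0 \<le> \<gamma> (\<mu> powi k * y)"
      using gamma_nonneg y(1) orbit_circle[OF y(1)] by auto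
    have "\<gamma> y = 0 \<longrightarrow> \<gamma> (\<mu> powi k * y) \<noteq> 0"
      using assms y(1) k unfolding zeros_separated_def by blast
    then have pos: "0 < \<gamma> y + \<gamma> (\<mu> powi k * y)" using nonneg by auto
    have half: "s / 2 \<le> t" if "r < s / 2" "s \<le> r + t" for r s t :: real
      using that by simp
    show ?thesis
    proof (intro exI[of _ "(\<gamma> y + \<gamma> (\<mu> powi k * y)) / 2"] conjI ballI impI)
      fix z :: complex assume z: "z \<in> unit_circle" and "\<gamma> z < (\<gamma> y + \<gamma> (\<mu> powi k * y)) / 2"
      then show "(\<gamma> y + \<gamma> (\<mu> powi k * y)) / 2 \<le> \<gamma> (\<mu> powi k * z)"
        using y(2)[rule_format, OF z] by (intro half)
    qed (use pos in simp)
  qed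
  have "finite J \<Longrightarrow> 0 \<notin> J \<Longrightarrow> \<exists>\<epsilon>>0. \<forall>k\<in>J. \<forall>z\<in>unit_circle. \<gamma> z < \<epsilon> \<longrightarrow> \<epsilon> \<le> \<gamma> (\<mu> powi k * z)" for J
  proof (induction rule: finite_induct)
    case empty
    then show ?case by (intro exI[of _ 1]) simp
  next
    case (insert k J)
    obtain \<epsilon> where "0 < \<epsilon>" "\<forall>k\<in>J. \<forall>z\<in>unit_circle. \<gamma> z < \<epsilon> \<longrightarrow> \<epsilon> \<le> \<gamma> (\<mu> powi k * z)"
      using insert by auto
    moreover obtain \<delta> where "0 < \<delta>" "\<forall>z\<in>unit_circle. \<gamma> z < \<delta> \<longrightarrow> \<delta> \<le> \<gamma> (\<mu> powi k * z)"
      using single[of k] insert.prems by auto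
    ultimately show ?case
      by (intro exI[of _ "min \<epsilon> \<delta>"]) (auto simp: min_le_iff_disj)
  qed
  from this[of "{- int N..int N} - {0}"] obtain \<epsilon> where \<epsilon>: "0 < \<epsilon>"
    "\<forall>k\<in>{- int N..int N} - {0}. \<forall>z\<in>unit_circle. \<gamma> z < \<epsilon> \<longrightarrow> \<epsilon> \<le> \<gamma> (\<mu> powi k * z)"
    by auto
  show thesis
  proof (rule that[OF \<epsilon>(1)])
    fix z k assume "z \<in> unit_circle" "k \<noteq> 0" "\<bar>k\<bar> \<le> int N" "\<gamma> z < \<epsilon>"
    moreover have "k \<in> {- int N..int N} - {0}" using \<open>k \<noteq> 0\<close> \<open>\<bar>k\<bar> \<le> int N\<close> by auto
    ultimately show "\<epsilon> \<le> \<gamma> (\<mu> powi k * z)" using \<epsilon>(2) by blast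
  qed
qed

end

section \<open>The restriction of a trace to C(T)\<close>

locale rotation_trace = rotation_algebra \<theta> \<mu> A \<gamma> x w + trace A \<tau>
  for \<theta> :: real and \<mu> :: complex and A :: "'a cstar" (structure) and \<gamma> x w \<tau>
begin

text \<open>Integration against the probability measure that the trace induces on the circle, kept
  as a functional.\<close>

definition moment :: "(complex \<Rightarrow> complex) \<Rightarrow> complex" where
  "moment f = \<tau> (calc f)"

lemma moment_add:
  "continuous_on unit_circle f \<Longrightarrow> continuous_on unit_circle g \<Longrightarrow> moment (\<lambda>z. f z + g z) = moment f + moment g"
  by (simp add: moment_def calc_add fun_add)

lemma moment_smult: "continuous_on unit_circle f \<Longrightarrow> moment (\<lambda>z. c * f z) = c * moment f"
  by (simp add: moment_def calc_smult fun_smult)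

lemma moment_cong: "(\<And>z. z \<in> unit_circle \<Longrightarrow> f z = g z) \<Longrightarrow> moment f = moment g"
  unfolding moment_def by (metis calc_cong)

text \<open>Evaluate the trace at \<open>x \<otimes> calc f \<otimes> star A x\<close> before and
  after moving \<open>star A x\<close> to the front. Each side contains a product of x with its
  adjoint, so the invariance concerns multiples of \<gamma>.\<close>

lemma moment_rotated_gam:
  assumes f: "continuous_on unit_circle f"
  shows "moment (rotated (- 1) (\<lambda>z. f z * gam z)) = moment (\<lambda>z. f z * gam z)"
proof -
  have r: "continuous_on unit_circle (rotated (- 1) f)" "continuous_on unit_circle (rotated (- 1) gam)"
    using f by auto
  have "moment (rotated (- 1) (\<lambda>z. f z * gam z)) = \<tau> (calc (rotated (- 1) f) \<otimes> (x \<otimes> star A x))"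
    unfolding x_star_x calc_mult[OF r, symmetric] by (simp add: moment_def rotated_def[abs_def])
  also have "\<dots> = \<tau> (x \<otimes> calc f \<otimes> star A x)"
    unfolding x_calc[OF f] using r by (simp add: m_assoc)
  also have "\<dots> = \<tau> (star A x \<otimes> (x \<otimes> calc f))"
    using f by (intro trace_commute) auto
  also have "\<dots> = \<tau> (calc gam \<otimes> calc f)"
    using f by (simp add: star_x_x flip: m_assoc)
  also have "\<dots> = moment (\<lambda>z. f z * gam z)"
    using f by (simp add: moment_def calc_mult calc_commute)
  finally show ?thesis .
qed

lemma moment_nonneg:
  assumes "continuous_on unit_circle h" "\<And>z. z \<in> unit_circle \<Longrightarrow> 0 \<le> h z"
  shows "0 \<le> Re (moment (\<lambda>z. complex_of_real (h z)))"
proof -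
  define s where "s z = complex_of_real (sqrt (h z))" for z
  have s: "continuous_on unit_circle s" unfolding s_def by (intro continuous_intros assms)
  have cs: "continuous_on unit_circle (\<lambda>z. cnj (s z))" by (intro continuous_intros s)
  have "moment (\<lambda>z. complex_of_real (h z)) = moment (\<lambda>z. cnj (s z) * s z)"
    by (rule moment_cong) (simp add: s_def assms flip: of_real_mult)
  also have "\<dots> = \<tau> (star A (calc s) \<otimes> calc s)"
    by (simp add: moment_def calc_mult[OF cs s] calc_star[OF s])
  finally show ?thesis using fun_positive_Re[of "calc s"] s by simp
qed

text \<open>Cauchy-Schwarz for the square root of \<open>h\<close> and its product with
  \<open>g\<close>, each of which contributes the mass of \<open>h\<close>.\<close>

lemma moment_mult_le:
  assumes g: "continuous_on unit_circle g" "\<And>z. z \<in> unit_circle \<Longrightarrow> cmod (g z) = 1"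
    and h: "continuous_on unit_circle h" "\<And>z. z \<in> unit_circle \<Longrightarrow> 0 \<le> h z"
  shows "cmod (moment (\<lambda>z. g z * complex_of_real (h z))) \<le> Re (moment (\<lambda>z. complex_of_real (h z)))"
proof (rule power2_le_imp_le)
  define s where "s z = complex_of_real (sqrt (h z))" for z
  have s: "continuous_on unit_circle s" unfolding s_def by (intro continuous_intros h)
  have cs: "continuous_on unit_circle (\<lambda>z. cnj (s z))" by (intro continuous_intros s)
  have gs: "continuous_on unit_circle (\<lambda>z. g z * s z)" by (intro continuous_intros s g)
  have cgs: "continuous_on unit_circle (\<lambda>z. cnj (g z * s z))" by (intro continuous_intros s g)
  have ss: "s z * s z = complex_of_real (h z)" "cnj (s z) = s z" if "z \<in> unit_circle" for z
    using h(2)[OF that] by (simp_all add: s_def flip: of_real_mult)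
  have gg: "cnj (g z) * g z = 1" if "z \<in> unit_circle" for z
    using complex_norm_square[of "g z"] g(2)[OF that] by (simp add: mult.commute)
  have "moment (\<lambda>z. g z * complex_of_real (h z)) = moment (\<lambda>z. cnj (s z) * (g z * s z))"
    by (rule moment_cong) (simp add: ss flip: ss(1))
  also have "\<dots> = \<tau> (star A (calc s) \<otimes> calc (\<lambda>z. g z * s z))"
    by (simp add: moment_def calc_mult[OF cs gs] calc_star[OF s])
  finally have 1: "moment (\<lambda>z. g z * complex_of_real (h z)) = \<tau> (star A (calc s) \<otimes> calc (\<lambda>z. g z * s z))" .
  have "moment (\<lambda>z. complex_of_real (h z)) = moment (\<lambda>z. cnj (s z) * s z)"
    by (rule moment_cong) (simp add: ss flip: ss(1))
  also have "\<dots> = \<tau> (star A (calc s) \<otimes> calc s)"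
    by (simp add: moment_def calc_mult[OF cs s] calc_star[OF s])
  finally have 2: "moment (\<lambda>z. complex_of_real (h z)) = \<tau> (star A (calc s) \<otimes> calc s)" .
  have "moment (\<lambda>z. complex_of_real (h z)) = moment (\<lambda>z. cnj (g z * s z) * (g z * s z))"
  proof (rule moment_cong)
    fix z :: complex assume z: "z \<in> unit_circle"
    have "cnj (g z * s z) * (g z * s z) = (cnj (g z) * g z) * (cnj (s z) * s z)" by simp
    also have "\<dots> = complex_of_real (h z)" by (simp add: gg[OF z] ss[OF z])
    finally show "complex_of_real (h z) = cnj (g z * s z) * (g z * s z)" ..
  qed
  also have "\<dots> = \<tau> (star A (calc (\<lambda>z. g z * s z)) \<otimes> calc (\<lambda>z. g z * s z))"
    unfolding moment_def calc_mult[OF cgs gs] calc_star[OF gs] ..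
  finally have 3: "moment (\<lambda>z. complex_of_real (h z)) = \<tau> (star A (calc (\<lambda>z. g z * s z)) \<otimes> calc (\<lambda>z. g z * s z))" .
  show "(cmod (moment (\<lambda>z. g z * complex_of_real (h z))))\<^sup>2 \<le> (Re (moment (\<lambda>z. complex_of_real (h z))))\<^sup>2"
    using Cauchy_Schwarz[of "calc s" "calc (\<lambda>z. g z * s z)"] s gs
    unfolding 1 2[symmetric] 3[symmetric] by (simp add: power2_eq_square)
qed (rule moment_nonneg[OF h])

text \<open>The bump function \<open>b\<close> lives on \<open>{\<gamma> < \<epsilon>}\<close>, whose translates by up to \<open>N\<close> steps are
  disjoint.  Away from the zeros of \<open>\<gamma>\<close> the functional is rotation invariant, so these translates all
  have the same mass, which is therefore at most \<open>1 / N\<close>; and \<open>1 - b\<close> is divisible by \<open>\<gamma>\<close>.\<close>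

lemma moment_rotated_diff_le:
  assumes sep: zeros_separated and N: "0 < N"
    and g: "continuous_on unit_circle g" "\<And>z. z \<in> unit_circle \<Longrightarrow> cmod (g z) = 1"
  shows "cmod (moment (rotated (- 1) g) - moment g) \<le> 2 / real N"
proof -
  obtain \<epsilon> where \<epsilon>: "0 < \<epsilon>"
    "\<And>z k. z \<in> unit_circle \<Longrightarrow> k \<noteq> 0 \<Longrightarrow> \<bar>k\<bar> \<le> int N \<Longrightarrow> \<gamma> z < \<epsilon> \<Longrightarrow> \<epsilon> \<le> \<gamma> (\<mu> powi k * z)"
    using zeros_separated_uniform[OF sep, of N] by blast
  define b where "b z = max 0 (1 - \<gamma> z / \<epsilon>)" for z
  define B where "B z = complex_of_real (b z)" for z
  have b: "continuous_on unit_circle b"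
    unfolding b_def using \<epsilon>(1) by (intro continuous_intros gamma_continuous) auto
  have b_range: "0 \<le> b z" "b z \<le> 1" if "z \<in> unit_circle" for z
    using gamma_nonneg that \<epsilon>(1) by (auto simp: b_def)
  have b_supp: "\<gamma> z < \<epsilon>" if "b z \<noteq> 0" for z
    using that \<epsilon>(1) by (auto simp: b_def max_def divide_less_eq split: if_splits)
  have B: "continuous_on unit_circle B" unfolding B_def by (intro continuous_intros b)
  \<comment> \<open>The denominator stays positive and \<open>B z + gam z / d z = 1\<close> on the
    circle: where \<gamma> is below \<epsilon> the quotient is
    \<open>\<gamma> z / \<epsilon>\<close>, and elsewhere it is 1 and the bump vanishes.\<close>
  define d where "d z = complex_of_real (max (\<gamma> z) \<epsilon>)" for z
  have d_nz: "d z \<noteq> 0" for z using \<epsilon>(1) by (auto simp: d_def max_def)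
  have d: "continuous_on unit_circle d" unfolding d_def by (intro continuous_intros gamma_continuous)
  have invariant: "moment (rotated (- 1) h) = moment h"
    if f: "continuous_on unit_circle f" and eq: "\<And>z. z \<in> unit_circle \<Longrightarrow> h z = f z * gam z" for f h
  proof -
    have "moment (rotated (- 1) h) = moment (rotated (- 1) (\<lambda>z. f z * gam z))"
    proof (rule moment_cong)
      fix z :: complex assume "z \<in> unit_circle"
      then show "rotated (- 1) h z = rotated (- 1) (\<lambda>z. f z * gam z) z"
        unfolding rotated_def using orbit_circle[of z "- 1"] by (intro eq)
    qed
    also have "\<dots> = moment h" unfolding moment_rotated_gam[OF f] by (rule moment_cong) (simp add: eq)
    finally show ?thesis .
  qed
  \<comment> \<open>Where \<open>rotated j B\<close> is nonzero, the choice of \<epsilon> with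
    exponent \<open>- j\<close> gives \<open>\<epsilon> \<le> \<gamma> z\<close>, so that dividing
    by \<open>d\<close> is dividing by \<gamma>. The case \<open>j = 0\<close> has to be left out,
    as the bump itself sits on the zeros.\<close>
  have shift: "moment (rotated (j - 1) B) = moment (rotated j B)" if j: "j \<noteq> 0" "\<bar>j\<bar> \<le> int N" for j
  proof -
    have rj: "continuous_on unit_circle (rotated j B)" using B by auto
    have "moment (rotated (- 1) (rotated j B)) = moment (rotated j B)"
    proof (rule invariant)
      show "continuous_on unit_circle (\<lambda>z. rotated j B z / d z)" using d_nz by (intro continuous_intros rj d) auto
      fix z :: complex assume z: "z \<in> unit_circle"
      show "rotated j B z = rotated j B z / d z * gam z"
      proof (cases "b (\<mu> powi j * z) = 0")
        case False
        then have "\<gamma> (\<mu> powi j * z) < \<epsilon>" by (rule b_supp)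
        from \<epsilon>(2)[OF orbit_circle[OF z] _ _ this, of "- j"] j
        have "\<epsilon> \<le> \<gamma> z" by (simp add: power_int_minus flip: mult.assoc)
        then show ?thesis using d_nz[of z] by (simp add: d_def gam_def max_def)
      qed (simp add: rotated_def B_def)
    qed
    then show ?thesis by (simp add: rotated_rotated)
  qed
  \<comment> \<open>No step leads across \<open>j = 0\<close>, so two separate chains of
    \<open>N\<close> translates are formed, with exponents from 0 to \<open>N - 1\<close> and from
    \<open>- N\<close> to -1, one for each of the two masses.\<close>
  have masses: "Re (moment B) \<le> 1 / real N \<and> Re (moment (rotated (- 1) B)) \<le> 1 / real N"
  proof -
    have total: "real N * Re m \<le> 1"
      if eq: "\<And>k. k < N \<Longrightarrow> moment (rotated (l + int k) B) = m" for l m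
    proof -
      have rc: "continuous_on unit_circle (rotated (l + int k) B)" for k using B by auto
      have sum: "moment (\<lambda>z. \<Sum>k<n. rotated (l + int k) B z) = (\<Sum>k<n. moment (rotated (l + int k) B))" for n
      proof (induction n)
        case 0
        show ?case using moment_smult[of "\<lambda>_. 0" 0] by simp
      next
        case (Suc n)
        have "continuous_on unit_circle (\<lambda>z. \<Sum>k<n. rotated (l + int k) B z)" by (intro continuous_intros rc)
        from moment_add[OF this rc] Suc show ?case by simp
      qed
      \<comment> \<open>Two translates that are both nonzero at z would put two orbit points fewer
        than \<open>N\<close> steps apart below the level \<epsilon>.\<close>
      have le_one: "(\<Sum>k<N. b (\<mu> powi (l + int k) * z)) \<le> 1" if z: "z \<in> unit_circle" for z
      proof (cases "\<exists>k<N. b (\<mu> powi (l + int k) * z) \<noteq> 0")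
        case True
        then obtain k where k: "k < N" "b (\<mu> powi (l + int k) * z) \<noteq> 0" by blast
        have "b (\<mu> powi (l + int j) * z) = 0" if "j < N" "j \<noteq> k" for j
        proof (rule ccontr)
          assume "b (\<mu> powi (l + int j) * z) \<noteq> 0"
          then have "\<gamma> (\<mu> powi (l + int j) * z) < \<epsilon>" by (rule b_supp)
          moreover have "\<mu> powi (l + int j) * z = \<mu> powi (int j - int k) * (\<mu> powi (l + int k) * z)"
            by (simp add: add.commute flip: mult.assoc power_int_add)
          moreover have "\<epsilon> \<le> \<gamma> (\<mu> powi (int j - int k) * (\<mu> powi (l + int k) * z))"
            using that k by (intro \<epsilon>(2) orbit_circle z b_supp) auto
          ultimately show False by simp
        qed
        then have "(\<Sum>k<N. b (\<mu> powi (l + int k) * z)) = (\<Sum>j\<in>{k}. b (\<mu> powi (l + int j) * z))"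
          using k by (intro sum.mono_neutral_right) auto
        then show ?thesis using b_range[OF orbit_circle[OF z]] by simp
      qed simp
      have "0 \<le> Re (moment (\<lambda>z. complex_of_real (1 - (\<Sum>k<N. b (\<mu> powi (l + int k) * z)))))"
      proof (rule moment_nonneg)
        have "continuous_on unit_circle (\<lambda>z. b (\<mu> powi k * z))" for k
          by (rule continuous_on_compose2[OF b]) (auto intro!: continuous_intros simp: norm_mult)
        then show "continuous_on unit_circle (\<lambda>z. 1 - (\<Sum>k<N. b (\<mu> powi (l + int k) * z)))"
          by (intro continuous_intros)
      qed (use le_one in simp)
      also have "moment (\<lambda>z. complex_of_real (1 - (\<Sum>k<N. b (\<mu> powi (l + int k) * z))))
          = moment (\<lambda>z. 1 + (- 1) * (\<Sum>k<N. rotated (l + int k) B z))"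
        by (rule moment_cong) (simp add: rotated_def B_def)
      also have "\<dots> = 1 - of_nat N * m"
      proof -
        have c: "continuous_on unit_circle (\<lambda>z. \<Sum>k<N. rotated (l + int k) B z)"
          "continuous_on unit_circle (\<lambda>z. (- 1) * (\<Sum>k<N. rotated (l + int k) B z))"
          by (intro continuous_intros rc)+
        have "moment (\<lambda>_. 1) = 1" by (simp add: moment_def calc_one trace_one)
        then show ?thesis
          unfolding moment_add[OF continuous_on_const c(2)] moment_smult[OF c(1)] sum by (simp add: eq)
      qed
      finally show ?thesis by simp
    qed
    have up: "moment (rotated (0 + int k) B) = moment B" if "k < N" for k
      using that
    proof (induction k)
      case (Suc k)
      then show ?case using shift[of "int k + 1"] by (simp add: add.commute)
    qed simp
    have down: "moment (rotated (- int N + int k) B) = moment (rotated (- 1) B)" if k: "k < N" for k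
    proof -
      have "moment (rotated (- 1 - int j) B) = moment (rotated (- 1) B)" if "j < N" for j
        using that
      proof (induction j)
        case (Suc j)
        then show ?case using shift[of "- 1 - int j"] by (simp add: algebra_simps)
      qed simp
      from this[of "N - 1 - k"] k show ?thesis by (simp add: of_nat_diff algebra_simps)
    qed
    show ?thesis using total[OF up] total[OF down] N by (simp add: field_simps)
  qed
  have gB: "continuous_on unit_circle (\<lambda>z. g z * B z)" by (intro continuous_intros g B)
  have gd: "continuous_on unit_circle (\<lambda>z. g z / d z * gam z)"
    "continuous_on unit_circle (\<lambda>z. g z / d z)"
    using d_nz by (intro continuous_intros g d continuous_on_gam; auto)+
  have split: "g z = g z * B z + g z / d z * gam z" if "z \<in> unit_circle" for z
  proof -
    have "complex_of_real (b z) + complex_of_real (\<gamma> z) / complex_of_real (max (\<gamma> z) \<epsilon>) = complex_of_real 1"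
      unfolding of_real_divide[symmetric] of_real_add[symmetric] of_real_eq_iff
      using \<epsilon>(1) by (auto simp: b_def max_def divide_less_eq field_simps)
    then have "B z + gam z / d z = 1" by (simp add: B_def gam_def d_def)
    then have "g z * (B z + gam z / d z) = g z" by simp
    then show ?thesis by (simp add: distrib_left)
  qed
  have rgB: "continuous_on unit_circle (rotated (- 1) (\<lambda>z. g z * B z))"
    "continuous_on unit_circle (rotated (- 1) (\<lambda>z. g z / d z * gam z))"
    using gB gd by auto
  \<comment> \<open>The part divisible by \<gamma> is invariant and cancels; only the bump part
    contributes to the difference.\<close>
  have "moment g = moment (\<lambda>z. g z * B z) + moment (\<lambda>z. g z / d z * gam z)"
    unfolding moment_add[OF gB gd(1), symmetric] by (rule moment_cong) (rule split)
  moreover have "moment (rotated (- 1) g)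
      = moment (rotated (- 1) (\<lambda>z. g z * B z)) + moment (rotated (- 1) (\<lambda>z. g z / d z * gam z))"
    unfolding moment_add[OF rgB, symmetric]
  proof (rule moment_cong)
    fix z :: complex assume "z \<in> unit_circle"
    then show "rotated (- 1) g z = rotated (- 1) (\<lambda>z. g z * B z) z + rotated (- 1) (\<lambda>z. g z / d z * gam z) z"
      unfolding rotated_def by (intro split orbit_circle)
  qed
  ultimately have eq: "moment (rotated (- 1) g) - moment g = moment (rotated (- 1) (\<lambda>z. g z * B z)) - moment (\<lambda>z. g z * B z)"
    unfolding moment_rotated_gam[OF gd(2)] by simp
  have "cmod (moment (rotated (- 1) g) - moment g)
      \<le> cmod (moment (rotated (- 1) (\<lambda>z. g z * B z))) + cmod (moment (\<lambda>z. g z * B z))"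
    unfolding eq by (rule norm_triangle_ineq4)
  also have "\<dots> \<le> Re (moment (rotated (- 1) B)) + Re (moment B)"
  proof (rule add_mono)
    show "cmod (moment (\<lambda>z. g z * B z)) \<le> Re (moment B)"
      using moment_mult_le[OF g b b_range(1)] unfolding B_def[abs_def] .
    have c: "continuous_on unit_circle (\<lambda>z. g (\<mu> powi - 1 * z))" "continuous_on unit_circle (\<lambda>z. b (\<mu> powi - 1 * z))"
      by (rule continuous_on_compose2[OF g(1)] continuous_on_compose2[OF b],
          auto intro!: continuous_intros simp: norm_mult norm_inverse)+
    show "cmod (moment (rotated (- 1) (\<lambda>z. g z * B z))) \<le> Re (moment (rotated (- 1) B))"
      unfolding rotated_def[abs_def] B_def
      by (rule moment_mult_le[OF c(1) g(2)[OF orbit_circle] c(2) b_range(1)[OF orbit_circle]])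
  qed
  also have "\<dots> \<le> 2 / real N" using masses by simp
  finally show ?thesis .
qed

text \<open>Letting \<open>N\<close> grow turns the previous estimate into exact rotation
  invariance, while the rotation multiplies the monomial by \<open>\<mu> powi (- k)\<close>, which
  is not 1.\<close>

lemma moment_power_int:
  assumes sep: zeros_separated and "k \<noteq> 0" shows "moment (\<lambda>z. z powi k) = 0"
proof -
  have unimodular: "cmod (z powi k) = 1" if "z \<in> unit_circle" for z :: complex
    using that by (simp add: norm_power_int)
  have "cmod (moment (rotated (- 1) (\<lambda>z. z powi k)) - moment (\<lambda>z. z powi k)) \<le> 0"
  proof (rule LIMSEQ_le_const)
    show "(\<lambda>N. 2 / real N) \<longlonglongrightarrow> 0" by (rule lim_const_over_n)
    show "\<exists>N. \<forall>n\<ge>N. cmod (moment (rotated (- 1) (\<lambda>z. z powi k)) - moment (\<lambda>z. z powi k)) \<le> 2 / real n"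
      using moment_rotated_diff_le[OF sep _ continuous_on_power_int_circle unimodular] by (intro exI[of _ 1]) auto
  qed
  moreover have "rotated (- 1) (\<lambda>z. z powi k) = (\<lambda>z. \<mu> powi (- k) * z powi k)"
    by (rule ext) (simp add: rotated_def power_int_mult_distrib power_int_minus power_int_inverse)
  ultimately have "(\<mu> powi (- k) - 1) * moment (\<lambda>z. z powi k) = 0"
    using moment_smult[of "\<lambda>z. z powi k" "\<mu> powi (- k)"] by (simp add: left_diff_distrib)
  then show ?thesis using mu_powi_eq_1_iff[of "- k"] \<open>k \<noteq> 0\<close> by simp
qed

text \<open>Conjugation by the unitary w leaves a trace unchanged but multiplies degree n by
  \<open>\<mu> powi n\<close>, which is not 1.\<close>

lemma trace_homogeneous:
  assumes "c \<in> homogeneous n" "n \<noteq> 0" shows "\<tau> c = 0"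
proof -
  have c: "c \<in> carrier A" by (rule homogeneous_carrier[OF assms(1)])
  have "w_power (- 1) \<otimes> w_power 1 = calc (\<lambda>z. z powi (- 1) * z powi 1)"
    unfolding w_power_def by (rule calc_mult[symmetric]) (rule continuous_on_power_int_circle)+
  also have "\<dots> = \<one>"
    unfolding calc_one[symmetric]
  proof (rule calc_cong)
    fix z :: complex assume "z \<in> unit_circle"
    then have "z \<noteq> 0" by auto
    then show "z powi (- 1) * z powi 1 = 1" by simp
  qed
  finally have unit: "w_power (- 1) \<otimes> w_power 1 = \<one>" .
  have "\<mu> powi n * \<tau> c = \<tau> (conj_w 1 c)"
    using c by (simp add: conj_w_homogeneous[OF assms(1)] fun_smult)
  also have "\<dots> = \<tau> (w_power (- 1) \<otimes> (w_power 1 \<otimes> c))"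
    unfolding conj_w_def using c by (simp add: trace_commute[of "w_power 1 \<otimes> c" "w_power (- 1)"])
  also have "\<dots> = \<tau> c"
    using c unit by (simp flip: m_assoc)
  finally have "(\<mu> powi n - 1) * \<tau> c = 0" by (simp add: left_diff_distrib)
  then show ?thesis using assms(2) by (simp add: mu_powi_eq_1_iff)
qed

end

context rotation_algebra
begin

text \<open>Nonzero degrees do not contribute, degree 0 is fixed by the moments of the monomials,
  and traces are contractive, so agreement on polynomial elements suffices.\<close>

lemma trace_unique:
  assumes sep: zeros_separated and tr: "trace A \<tau>" "trace A \<tau>'" and a: "a \<in> carrier A"
  shows "\<tau> a = \<tau>' a"
proof -
  interpret T: trace A \<tau> by fact
  interpret T': trace A \<tau>' by fact
  interpret R: rotation_trace \<theta> \<mu> A \<gamma> x w \<tau> by unfold_locales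
  interpret R': rotation_trace \<theta> \<mu> A \<gamma> x w \<tau>' by unfold_locales
  have close: "cmod (\<tau> b - \<tau>' b) \<le> 2 * nrm A (b \<ominus> c)"
    if b: "b \<in> carrier A" and c: "c \<in> carrier A" and eq: "\<tau> c = \<tau>' c" for b c
  proof -
    have "\<tau> b - \<tau>' b = \<tau> (b \<ominus> c) - \<tau>' (b \<ominus> c)"
      by (simp add: T.fun_minus[OF b c] T'.fun_minus[OF b c] eq)
    moreover have "cmod (\<tau> (b \<ominus> c)) \<le> nrm A (b \<ominus> c)" "cmod (\<tau>' (b \<ominus> c)) \<le> nrm A (b \<ominus> c)"
      by (rule T.trace_bounded[OF M.minus_closed[OF b c]], rule T'.trace_bounded[OF M.minus_closed[OF b c]])
    ultimately show ?thesis
      using norm_triangle_ineq4[of "\<tau> (b \<ominus> c)" "\<tau>' (b \<ominus> c)"] by simp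
  qed
  have calc_eq: "\<tau> (calc f) = \<tau>' (calc f)" if "continuous_on unit_circle f" for f
    using that
  proof (induction rule: circle_function_induct)
    case (monom c k)
    have "R.moment (\<lambda>z. z powi k) = R'.moment (\<lambda>z. z powi k)"
    proof (cases "k = 0")
      case True
      then show ?thesis by (simp add: R.moment_def R'.moment_def calc_one T.trace_one T'.trace_one)
    next
      case False
      then show ?thesis by (simp add: R.moment_power_int[OF sep] R'.moment_power_int[OF sep])
    qed
    then have "R.moment (\<lambda>z. c * z powi k) = R'.moment (\<lambda>z. c * z powi k)"
      by (simp add: R.moment_smult R'.moment_smult)
    then show ?case by (simp add: R.moment_def R'.moment_def)
  next
    case (add f g)
    then show ?case by (simp add: calc_add T.fun_add T'.fun_add)
  next
    case (limit f)
    have "cmod (\<tau> (calc f) - \<tau>' (calc f)) \<le> 0"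
    proof (rule field_le_epsilon)
      fix e :: real assume "0 < e"
      then obtain g where g: "continuous_on unit_circle g" "\<tau> (calc g) = \<tau>' (calc g)"
        "\<forall>z\<in>unit_circle. cmod (f z - g z) \<le> e / 2" using limit.IH[of "e / 2"] by auto
      have "nrm A (calc f \<ominus> calc g) \<le> e / 2"
        using limit.hyps g by (intro calc_diff_le) auto
      moreover have "cmod (\<tau> (calc f) - \<tau>' (calc f)) \<le> 2 * nrm A (calc f \<ominus> calc g)"
        by (rule close[OF calc_closed[OF limit.hyps] calc_closed[OF g(1)] g(2)])
      ultimately show "cmod (\<tau> (calc f) - \<tau>' (calc f)) \<le> 0 + e" by simp
    qed
    then show ?case by simp
  qed
  have poly_eq: "\<tau> p = \<tau>' p" if "p \<in> poly_elements" for p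
    using that
  proof induction
    case (homogeneous c n)
    show ?case
    proof (cases "n = 0")
      case True
      then show ?thesis using homogeneous calc_eq by (metis homogeneous_0E)
    next
      case False
      then show ?thesis using R.trace_homogeneous[OF homogeneous] R'.trace_homogeneous[OF homogeneous] by simp
    qed
  next
    case (add p q)
    then show ?case by (simp add: T.fun_add T'.fun_add poly_elements_carrier)
  qed
  have "cmod (\<tau> a - \<tau>' a) \<le> 0"
  proof (rule field_le_epsilon)
    fix e :: real assume "0 < e"
    then obtain p where p: "p \<in> poly_elements" "nrm A (a \<ominus> p) < e / 2"
      using poly_elements_dense[OF a, of "e / 2"] by auto
    have pA: "p \<in> carrier A" by (rule poly_elements_carrier[OF p(1)])
    show "cmod (\<tau> a - \<tau>' a) \<le> 0 + e"
      using close[OF a pA poly_eq[OF p(1)]] p(2) by simp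
  qed
  then show ?thesis by simp
qed

lemma unique_trace_if_zeros_separated:
  assumes zeros_separated shows "unique_tracial_state A"
  unfolding unique_tracial_state_def trace_iff[symmetric]
  using haar_trace trace_unique[OF assms] by blast

end

section \<open>The rotation orbits of the zero set\<close>

context irrational_rotation
begin

lemma rotation_eq: "rotation \<theta> = (\<lambda>z. \<mu> * z)"
  unfolding rotation_def \<mu>_def cis_conv_exp by (auto simp: mult_ac)

lemma int_iterate_rotation: "int_iterate (rotation \<theta>) k z = \<mu> powi k * z"
proof -
  have "inv_into UNIV (\<lambda>z. \<mu> * z) = (\<lambda>z. inverse \<mu> * z)"
    by (rule inv_equality) (simp_all flip: mult.assoc)
  moreover have "((\<lambda>z. c * z) ^^ n) z = c ^ n * z" for c :: complex and n
    by (induction n) simp_all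
  ultimately show ?thesis
    by (simp add: int_iterate_def rotation_eq power_int_def)
qed

end

theorem theorem4p3:
  fixes \<theta> :: real and \<gamma> :: "complex \<Rightarrow> real"
    and A :: "'a cstar" and x w :: 'a
  assumes "\<theta> \<notin> \<rat>"
    and "continuous_on unit_circle \<gamma>"
    and "\<forall>z\<in>unit_circle. 0 \<le> \<gamma> z"
    and "universal_rotation_algebra \<theta> \<gamma> A x w"
  shows "(simple_cstar A \<longleftrightarrow> unique_tracial_state A) \<and>
    (unique_tracial_state A \<longleftrightarrow>
       (\<forall>n::int. n \<noteq> 0 \<longrightarrow> int_iterate (rotation \<theta>) n ` zero_set \<gamma> \<inter> zero_set \<gamma> = {})) \<and>
    ((\<forall>n::int. n \<noteq> 0 \<longrightarrow> int_iterate (rotation \<theta>) n ` zero_set \<gamma> \<inter> zero_set \<gamma> = {}) \<longleftrightarrow>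
       (\<forall>\<xi>\<in>unit_circle. \<exists>\<^sub>\<le>\<^sub>1 p. p \<in> rotation_orbit \<theta> \<xi> \<inter> zero_set \<gamma>))"
proof -
  define \<mu> where "\<mu> = cis (2 * pi * \<theta>)"
  interpret irrational_rotation \<theta> \<mu>
    by unfold_locales (use assms(1) in \<open>simp_all add: \<mu>_def\<close>)
  interpret unital_cstar_algebra A
    using assms(4) unfolding universal_rotation_algebra_def by blast
  interpret rotation_algebra \<theta> \<mu> A \<gamma> x w
    by unfold_locales (fact assms)+
  have zero_set: "z \<in> zero_set \<gamma> \<longleftrightarrow> z \<in> unit_circle \<and> \<gamma> z = 0" for z
    by (auto simp: zero_set_def)
  have three: "(\<forall>n::int. n \<noteq> 0 \<longrightarrow> int_iterate (rotation \<theta>) n ` zero_set \<gamma> \<inter> zero_set \<gamma> = {}) \<longleftrightarrow> zeros_separated"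
  proof -
    have "int_iterate (rotation \<theta>) n ` zero_set \<gamma> \<inter> zero_set \<gamma> = {} \<longleftrightarrow>
        (\<forall>z\<in>unit_circle. \<gamma> z = 0 \<longrightarrow> \<gamma> (\<mu> powi n * z) \<noteq> 0)" for n
      using orbit_circle[of _ n]
      by (auto simp: disjoint_iff image_iff zero_set int_iterate_rotation simp del: mem_sphere_0)
    then show ?thesis unfolding zeros_separated_def by blast
  qed
  have four: "(\<forall>\<xi>\<in>unit_circle. \<exists>\<^sub>\<le>\<^sub>1 p. p \<in> rotation_orbit \<theta> \<xi> \<inter> zero_set \<gamma>) \<longleftrightarrow> zeros_separated"
  proof
    assume one: "\<forall>\<xi>\<in>unit_circle. \<exists>\<^sub>\<le>\<^sub>1 p. p \<in> rotation_orbit \<theta> \<xi> \<inter> zero_set \<gamma>"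
    show zeros_separated
      unfolding zeros_separated_def
    proof (intro ballI allI impI notI)
      fix z k assume z: "z \<in> unit_circle" "k \<noteq> 0" "\<gamma> z = 0" "\<gamma> (\<mu> powi k * z) = 0"
      have "\<mu> powi 0 * z \<in> rotation_orbit \<theta> z" "\<mu> powi k * z \<in> rotation_orbit \<theta> z"
        unfolding rotation_orbit_def int_iterate_rotation by blast+
      then have "z \<in> rotation_orbit \<theta> z \<inter> zero_set \<gamma>" "\<mu> powi k * z \<in> rotation_orbit \<theta> z \<inter> zero_set \<gamma>"
        using z orbit_circle[OF z(1), of k] zero_set by simp_all
      then have "z = \<mu> powi k * z"
        using one z(1) unfolding Uniq_def by blast
      then have "\<mu> powi k = 1" using z(1) by auto
      then show False using z(2) by (simp add: mu_powi_eq_1_iff)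
    qed
  next
    assume sep: zeros_separated
    show "\<forall>\<xi>\<in>unit_circle. \<exists>\<^sub>\<le>\<^sub>1 p. p \<in> rotation_orbit \<theta> \<xi> \<inter> zero_set \<gamma>"
    proof (intro ballI Uniq_I)
      fix \<xi> p q assume \<xi>: "\<xi> \<in> unit_circle"
        and pq: "p \<in> rotation_orbit \<theta> \<xi> \<inter> zero_set \<gamma>" "q \<in> rotation_orbit \<theta> \<xi> \<inter> zero_set \<gamma>"
      then obtain i j where ij: "p = \<mu> powi i * \<xi>" "q = \<mu> powi j * \<xi>"
        unfolding rotation_orbit_def int_iterate_rotation by auto
      \<comment> \<open>Two points of one orbit differ by the exponent \<open>j - i\<close>, which
        separation of zeros forces to be 0.\<close>
      have "q = \<mu> powi (j - i) * p"
        unfolding ij by (simp flip: mult.assoc power_int_add)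
      moreover have "p \<in> unit_circle" "\<gamma> p = 0" "\<gamma> q = 0"
        using pq by (auto simp: zero_set simp del: mem_sphere_0)
      ultimately have "j - i = 0"
        using sep unfolding zeros_separated_def by metis
      then show "p = q" by (simp add: ij)
    qed
  qed
  show ?thesis
    unfolding three four
    using simple_if_zeros_separated zeros_separated_if_simple
      unique_trace_if_zeros_separated zeros_separated_if_unique_trace by blast
qed

end
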